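(* Let $1\le p\le\infty$, let $E$ be a Banach space and $X$ a Banach lattice. Suppose that $E$ has the approximation property or $X^{*}$ has the positive metric approximation property. Then $\Upsilon_{p^{*}}(E,X^{**})=(\widetilde{\mathcal N}^{p}(X,E))^{*}$ isometrically via trace duality: the map $S\mapsto V_S$, where for $S\in\Upsilon_{p^{*}}(E,X^{**})$ and $T\in\widetilde{\mathcal N}^{p}(X,E)$ $$V_S(T)=\operatorname{trace}(ST):=\sum_{n=1}^{\infty}\langle Su_n,x_n^{*}\rangle\quad\text{for any positively $p$-nuclear representation } T=\sum_{n=1}^{\infty}x_n^{*}\otimes u_n,$$ is a well-defined surjective linear isometry from $(\Upsilon_{p^{*}}(E,X^{**}),\|\cdot\|_{\Upsilon_{p^{*}}})$ onto the dual of $(\widetilde{\mathcal N}^{p}(X,E),\widetilde\nu^{p})$.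
   Context: All Banach spaces and Banach lattices are real; operators are bounded and linear. $p\in[1,\infty]$ and $p^{*}$ is the conjugate exponent, $1/p+1/p^{*}=1$. For a Banach lattice $X$, $X_+$ is the positive cone. For a Banach space $E$, $l_p(E)$ is the space of $p$-summable sequences with norm $\|(u_n)_n\|_p=(\sum_n\|u_n\|^p)^{1/p}$, and $l_p^w(E)$ is the space of weakly $p$-summable sequences with norm $\|(u_n)_n\|_p^w=\sup_{u^*\in B_{E^*}}(\sum_n|\langle u^*,u_n\rangle|^p)^{1/p}$ (usual modification for exponent $\infty$; same notation for finite sequences). $l_p^w(X)_+$ denotes the sequences in $l_p^w(X)$ with all terms in $X_+$. $x^*\otimes u$ is the operator $x\mapsto\langle x^*,x\rangle u$. Positively $p$-nuclear operators: $T:X\to E$ is positively $p$-nuclear if $T=\sum_{j=1}^\infty x_j^*\otimes u_j$ (i.e. $Tx=\sum_j\langle x_j^*,x\rangle u_j$ for $x\in X$) with $(x_j^* )_j\in l^w_{p^*}(X^* )_+$ and $(u_j)_j\in l_p(E)$; this is called a positively $p$-nuclear representation, and $\widetilde\nu^p(T)=\inf\|(x_j^* )_j\|^w_{p^*}\|(u_j)_j\|_p$ over all such representations. $\widetilde{\mathcal N}^p(X,E)$ is the space of these operators. Positive $p$-majorizing operators: $S:E\to X$ is positive $p$-majorizing if there is $C>0$ with $(\sum_{j=1}^n|\langle x_j^*,Su_j\rangle|^p)^{1/p}\le C\|(x_j^* )_{j=1}^n\|_p^w$ for all finite families $(u_j)_{j=1}^n$ in $B_E$ and $(x_j^* )_{j=1}^n$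 in $(X^* )_+$; $\Upsilon_p(E,X)$ is the space of these operators and $\|S\|_{\Upsilon_p}$ is the infimum of such $C$. $E$ has the approximation property if for every $\epsilon>0$ and compact $K\subset E$ there is a finite rank operator $S$ on $E$ with $\|Su-u\|<\epsilon$ for all $u\in K$. A Banach lattice $X$ has the positive metric approximation property if for every $\epsilon>0$ and compact $K\subset X$ there is a positive finite rank operator $R$ on $X$ with $\|R\|\le1$ and $\|Rx-x\|<\epsilon$ for all $x\in K$.
   Formalization: For p = ∞, the sequence (u_j) in a positively p-nuclear representation is required to converge to 0 in norm, not merely to be bounded; with bounded sequences the trace is not well defined (X = l_1, E = ℝ, S given by a Banach limit). *)

theory Defs
  imports "HOL-Analysis.Analysis" "HOL-Library.Lattice_Algebras"
begin

class banach_lattice = banach + ordered_real_vector + lattice_ab_group_add_abs +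
  assumes norm_mono_abs: "\<bar>x\<bar> \<le> \<bar>y\<bar> \<Longrightarrow> norm x \<le> norm y"

instance real :: banach_lattice
  by standard simp

subsection \<open>Positive cones of dual spaces\<close>

text \<open>
  The dual of a normed space \<open>'a\<close> is the type \<open>'a \<Rightarrow>\<^sub>L real\<close> and the bidual is
  \<open>('a \<Rightarrow>\<^sub>L real) \<Rightarrow>\<^sub>L real\<close>.  The orders of the Banach lattices X*, X** and X*** enter the notions
  below only through their positive cones, which are obtained from the cone of X by iterating
  \<open>dual_cone\<close>.  The notions depending on an order therefore take the positive cone as an argument.
\<close>

definition dual_cone :: "'a::real_normed_vector set \<Rightarrow> ('a \<Rightarrow>\<^sub>L real) set" where
  "dual_cone K = {f. \<forall>x\<in>K. 0 \<le> blinfun_apply f x}"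

definition dual_pos :: "('x::banach_lattice \<Rightarrow>\<^sub>L real) set" where
  "dual_pos = dual_cone {0..}"

definition bidual_pos :: "(('x::banach_lattice \<Rightarrow>\<^sub>L real) \<Rightarrow>\<^sub>L real) set" where
  "bidual_pos = dual_cone dual_pos"

subsection \<open>Strongly and weakly p-summable sequences\<close>

text \<open>Exponents are extended nonnegative reals, with \<open>1 / 0 = \<infinity>\<close> and \<open>1 / \<infinity> = 0\<close>.\<close>

definition conj_exp :: "ennreal \<Rightarrow> ennreal" where
  "conj_exp p = 1 / (1 - 1 / p)"

lemma conj_exp_eq:
  assumes "1 \<le> p"
  shows "1 / p + 1 / conj_exp p = 1"
proof -
  have "inverse p \<le> 1"
  proof (cases p)
    case (real r)
    with assms have "1 \<le> r" by (metis ennreal_1 ennreal_le_iff)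
    with real have "inverse p = ennreal (inverse r)" by (simp add: inverse_ennreal)
    also have "\<dots> \<le> 1" using \<open>1 \<le> r\<close> by (simp add: ennreal_le_1 inverse_le_1_iff)
    finally show ?thesis .
  qed simp
  moreover have "inverse (inverse a) = a" for a :: ennreal
  proof (cases a)
    case (real r)
    then show ?thesis by (cases "r = 0") (simp_all add: inverse_ennreal)
  qed simp
  ultimately show ?thesis
    by (simp add: conj_exp_def divide_ennreal_def add.commute diff_add_cancel_ennreal)
qed

definition lp_seq :: "ennreal \<Rightarrow> (nat \<Rightarrow> 'a::real_normed_vector) set" where
  "lp_seq p = {u. if p = \<infinity> then bounded (range u)
                  else summable (\<lambda>n. norm (u n) powr enn2real p)}"

definition lp_norm :: "ennreal \<Rightarrow> (nat \<Rightarrow> 'a::real_normed_vector) \<Rightarrow> real" where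
  "lp_norm p u = (if p = \<infinity> then (SUP n. norm (u n))
                  else (\<Sum>n. norm (u n) powr enn2real p) powr (1 / enn2real p))"

definition weak_lp_seq :: "ennreal \<Rightarrow> (nat \<Rightarrow> 'a::real_normed_vector) set" where
  "weak_lp_seq p = {u. \<forall>f :: 'a \<Rightarrow>\<^sub>L real. (\<lambda>n. blinfun_apply f (u n)) \<in> lp_seq p}"

text \<open>On \<open>weak_lp_seq p\<close> the supremum is finite by the uniform boundedness principle.\<close>

definition weak_lp_norm :: "ennreal \<Rightarrow> (nat \<Rightarrow> 'a::real_normed_vector) \<Rightarrow> real" where
  "weak_lp_norm p u =
     (SUP f\<in>{f :: 'a \<Rightarrow>\<^sub>L real. norm f \<le> 1}. lp_norm p (\<lambda>n. blinfun_apply f (u n)))"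

text \<open>
  The finite family \<open>u 0, \<dots>, u (n - 1)\<close> is treated as a sequence by padding with zeros; this does
  not affect the norms above.
\<close>

definition fin_seq :: "nat \<Rightarrow> (nat \<Rightarrow> 'a::zero) \<Rightarrow> nat \<Rightarrow> 'a" where
  "fin_seq n u = (\<lambda>j. if j < n then u j else 0)"

subsection \<open>Approximation properties\<close>

definition finite_rank :: "('a::real_normed_vector \<Rightarrow>\<^sub>L 'b::real_normed_vector) \<Rightarrow> bool" where
  "finite_rank R \<longleftrightarrow> (\<exists>B. finite B \<and> range (blinfun_apply R) \<subseteq> span B)"

definition approximation_property :: "'e::real_normed_vector itself \<Rightarrow> bool" where
  "approximation_property _ \<longleftrightarrow>
     (\<forall>\<epsilon>>0. \<forall>K :: 'e set. compact K \<longrightarrow>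
        (\<exists>S :: 'e \<Rightarrow>\<^sub>L 'e. finite_rank S \<and> (\<forall>u\<in>K. norm (blinfun_apply S u - u) < \<epsilon>)))"

text \<open>\<open>P\<close> is the positive cone of the space.\<close>

definition positive_metric_approximation_property :: "'a::real_normed_vector set \<Rightarrow> bool" where
  "positive_metric_approximation_property P \<longleftrightarrow>
     (\<forall>\<epsilon>>0. \<forall>K. compact K \<longrightarrow>
        (\<exists>R :: 'a \<Rightarrow>\<^sub>L 'a. finite_rank R \<and> (\<forall>x\<in>P. blinfun_apply R x \<in> P) \<and> norm R \<le> 1 \<and>
             (\<forall>x\<in>K. norm (blinfun_apply R x - x) < \<epsilon>)))"

subsection \<open>Positively p-nuclear operators\<close>

text \<open>
  For \<open>p = \<infinity>\<close> the sequence of vectors is required to be a null sequence, as usual in the theory of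
  nuclear operators; for finite \<open>p\<close> this is automatic.  Merely bounded sequences would not do: let
  X be the space of absolutely summable sequences and E the real line.  The sum functional on X
  is then represented both by itself (followed by zeros) and by the sequence of all coordinate
  functionals, with coefficients 1.  Pairing with a Banach limit in X** gives 1 for the first
  representation and 0 for the second, so the trace would not be well defined.
\<close>

definition pos_nuclear_rep ::
    "ennreal \<Rightarrow> ('x::banach_lattice \<Rightarrow>\<^sub>L 'e::banach) \<Rightarrow> (nat \<Rightarrow> 'x \<Rightarrow>\<^sub>L real) \<Rightarrow> (nat \<Rightarrow> 'e) \<Rightarrow> bool" where
  "pos_nuclear_rep p T xs us \<longleftrightarrow>
     xs \<in> weak_lp_seq (conj_exp p) \<and> (\<forall>n. xs n \<in> dual_pos) \<and>
     us \<in> lp_seq p \<and> (p = \<infinity> \<longrightarrow> us \<longlonglongrightarrow> 0) \<and>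
     (\<forall>x. (\<lambda>n. blinfun_apply (xs n) x *\<^sub>R us n) sums blinfun_apply T x)"

definition pos_nuclear :: "ennreal \<Rightarrow> ('x::banach_lattice \<Rightarrow>\<^sub>L 'e::banach) set" where
  "pos_nuclear p = {T. \<exists>xs us. pos_nuclear_rep p T xs us}"

definition pos_nuclear_norm :: "ennreal \<Rightarrow> ('x::banach_lattice \<Rightarrow>\<^sub>L 'e::banach) \<Rightarrow> real" where
  "pos_nuclear_norm p T =
     Inf {weak_lp_norm (conj_exp p) xs * lp_norm p us | xs us. pos_nuclear_rep p T xs us}"

subsection \<open>Positive p-majorizing operators\<close>

text \<open>\<open>P\<close> is the positive cone of the target space \<open>'y\<close>.\<close>

definition pos_majorizing_bound ::
    "ennreal \<Rightarrow> 'y::banach set \<Rightarrow> ('e::banach \<Rightarrow>\<^sub>L 'y) \<Rightarrow> real \<Rightarrow> bool" where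
  "pos_majorizing_bound p P S C \<longleftrightarrow>
     (\<forall>n u f. (\<forall>j<n. norm (u j) \<le> 1) \<longrightarrow> (\<forall>j<n. f j \<in> dual_cone P) \<longrightarrow>
        lp_norm p (fin_seq n (\<lambda>j. blinfun_apply (f j) (blinfun_apply S (u j))))
          \<le> C * weak_lp_norm p (fin_seq n f))"

definition pos_majorizing :: "ennreal \<Rightarrow> 'y::banach set \<Rightarrow> ('e::banach \<Rightarrow>\<^sub>L 'y) set" where
  "pos_majorizing p P = {S. \<exists>C>0. pos_majorizing_bound p P S C}"

definition pos_majorizing_norm :: "ennreal \<Rightarrow> 'y::banach set \<Rightarrow> ('e::banach \<Rightarrow>\<^sub>L 'y) \<Rightarrow> real" where
  "pos_majorizing_norm p P S = Inf {C. 0 < C \<and> pos_majorizing_bound p P S C}"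

subsection \<open>The dual of a subspace with its own norm\<close>

text \<open>
  \<open>M\<close> is a linear subspace carrying a norm \<open>\<nu>\<close> unrelated to that of the ambient type.  Functionals
  on \<open>M\<close> are represented extensionally, so that equality of functions is equality on \<open>M\<close>.
\<close>

definition normed_dual :: "'a::real_vector set \<Rightarrow> ('a \<Rightarrow> real) \<Rightarrow> ('a \<Rightarrow> real) set" where
  "normed_dual M \<nu> = {V \<in> extensional M.
     (\<forall>x\<in>M. \<forall>y\<in>M. V (x + y) = V x + V y) \<and>
     (\<forall>c. \<forall>x\<in>M. V (c *\<^sub>R x) = c * V x) \<and>
     (\<exists>C. \<forall>x\<in>M. \<bar>V x\<bar> \<le> C * \<nu> x)}"

definition normed_dual_norm :: "'a::real_vector set \<Rightarrow> ('a \<Rightarrow> real) \<Rightarrow> ('a \<Rightarrow> real) \<Rightarrow> real" where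
  "normed_dual_norm M \<nu> V = (SUP x\<in>{x\<in>M. \<nu> x \<le> 1}. \<bar>V x\<bar>)"

subsection \<open>Trace duality\<close>

definition trace_duality ::
    "ennreal \<Rightarrow> ('e::banach \<Rightarrow>\<^sub>L (('x::banach_lattice \<Rightarrow>\<^sub>L real) \<Rightarrow>\<^sub>L real)) \<Rightarrow> ('x \<Rightarrow>\<^sub>L 'e) \<Rightarrow> real" where
  "trace_duality p S = (\<lambda>T\<in>pos_nuclear p.
     THE t. \<forall>xs us. pos_nuclear_rep p T xs us \<longrightarrow>
       (\<lambda>n. blinfun_apply (blinfun_apply S (us n)) (xs n)) sums t)"

end

theory Submission
  imports Defs
begin

text \<open>
  The trace of a composition is bounded by Hoelder's inequality, applied to the coefficients and to
  the majorizing estimate for the canonical images of the functionals in X***.  A representation of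
  the zero operator has trace zero once \<open>S u\<^sub>n\<close> is replaced by \<open>S (R u\<^sub>n)\<close>, or \<open>x\<^sub>n\<close> by \<open>R x\<^sub>n\<close>, for a
  finite rank operator R.  The error is small because \<open>u\<^sub>n = \<lambda>\<^sub>n v\<^sub>n\<close> with \<open>(\<lambda>\<^sub>n)\<close> in \<open>l\<^sub>p\<close> and \<open>v\<^sub>n\<close> tending
  to zero, so that R need only be close to the identity on the compact set of the \<open>v\<^sub>n\<close>; in the
  positive metric case \<open>(R x\<^sub>n)\<close> is an admissible sequence of no larger norm, so the tails are
  uniformly small and R need only be close to the identity on finitely many \<open>x\<^sub>n\<close>.

  Conversely, a functional V on the nuclear operators defines \<open>S u x = V (x \<otimes> u)\<close>.  Testing V on finite
  sums yields the majorizing estimate for functionals in X* only.  It extends to positive functionals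
  in X*** by a Hahn-Banach argument: an inequality \<open>\<Sum> y\<^sub>j x\<^sub>j \<le> M \<parallel>x\<parallel>\<close> on the positive cone, where the
  weak norm is replaced up to \<open>\<epsilon>\<close> by a maximum over a finite net of the unit ball of \<open>l\<^sub>p\<close>, is witnessed
  by finitely many functionals, and such a witness is preserved in the bidual.
\<close>

section \<open>Strong and weak summability\<close>

text \<open>A representation converges only pointwise on X, while \<open>S\<close> takes values in
  X**, whose elements need not respect pointwise convergence. Equality of operators therefore does
  not by itself give equality of traces. Finite rank perturbations are harmless because the adjoint
  series converges in the norm of X*, and the approximation hypothesis carries this over to
  \<open>S\<close>.

  In the converse direction, the isometry leaves no room for a lost constant. The net serves to keep
  the separation argument on a finite product of copies of X*, where a functional is a tuple of
  elements of X**, so that members of X*** can be applied to its components. Its mesh costs a factor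
  \<open>1 - n / N\<close>, which disappears in the limit.\<close>

lemma conj_exp_cases:
  assumes "1 \<le> p"
  obtains (one) "p = 1" "conj_exp p = \<infinity>"
  | (inf) "p = \<infinity>" "conj_exp p = 1"
  | (real) r s where "1 < r" "1 < s" "1 / r + 1 / s = 1" "p = ennreal r" "conj_exp p = ennreal s"
proof (cases p)
  case top
  then show thesis
    by (intro inf) (simp_all add: conj_exp_def divide_ennreal_def)
next
  case (real r)
  with assms have r: "1 \<le> r"
    by (metis ennreal_1 ennreal_le_iff)
  show thesis
  proof (cases "r = 1")
    case True
    then show thesis
      using real by (intro one) (simp_all add: conj_exp_def divide_ennreal_def)
  next
    case False
    with r have r: "1 < r" by simp
    define s where "s = 1 / (1 - 1 / r)"
    have "1 / ennreal r = ennreal (1 / r)"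
      using r by (simp add: divide_ennreal flip: ennreal_1)
    then have "1 - 1 / ennreal r = ennreal (1 - 1 / r)"
      using r by (simp add: ennreal_minus flip: ennreal_1)
    then have "conj_exp p = ennreal s"
      using r real by (simp add: conj_exp_def s_def divide_ennreal flip: ennreal_1)
    moreover have "1 < s" "1 / r + 1 / s = 1"
      using r by (simp_all add: s_def field_simps)
    ultimately show thesis
      using that(3) r real by blast
  qed
qed

lemma conj_exp_ge_1: "1 \<le> p \<Longrightarrow> 1 \<le> conj_exp p"
  by (erule conj_exp_cases) (simp_all add: ennreal_ge_1)

lemma conj_exp_conj_exp:
  assumes "1 \<le> p"
  shows "conj_exp (conj_exp p) = p"
  using assms
proof (cases rule: conj_exp_cases)
  case one
  then show ?thesis by (simp add: conj_exp_def divide_ennreal_def)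
next
  case inf
  then show ?thesis by (simp add: conj_exp_def divide_ennreal_def)
next
  case (real r s)
  then have s: "1 \<le> conj_exp p" and ne: "conj_exp p \<noteq> \<infinity>" "conj_exp p \<noteq> 1"
    by (auto simp: ennreal_ge_1)
  show ?thesis
    using s
  proof (cases rule: conj_exp_cases)
    case one
    with ne show ?thesis by simp
  next
    case inf
    with ne show ?thesis by simp
  next
    case (real r' s')
    with \<open>conj_exp p = ennreal s\<close> \<open>1 < s\<close> have "r' = s" by simp
    with real \<open>1 / r + 1 / s = 1\<close> have "1 / s + 1 / s' = 1" by simp
    with \<open>1 / r + 1 / s = 1\<close> have "1 / s' = 1 / r" by linarith
    then have "s' = r" by simp
    with real \<open>p = ennreal r\<close> show ?thesis by simp
  qed
qed

section \<open>Finite families: Hoelder's inequality and its equality case\<close>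

lemma bounded_imp_bdd_above_norm:
  "bounded (range u) \<Longrightarrow> bdd_above (range (\<lambda>n. norm (u n)))"
  by (auto simp: bounded_iff bdd_above_def)

text \<open>Index \<open>n\<close> always carries a padding zero, so the range is finite and
  contains 0; inserting 0 also gives the maximum a meaning for \<open>n = 0\<close>.\<close>

lemma lp_norm_fin_seq_infty:
  "lp_norm top (fin_seq n a) = Max (insert 0 ((\<lambda>j. norm (a j)) ` {..<n}))"
proof -
  have "norm (fin_seq n a n) = 0"
    by (simp add: fin_seq_def)
  then have "0 \<in> range (\<lambda>j. norm (fin_seq n a j))"
    by (metis rangeI)
  then have "range (\<lambda>j. norm (fin_seq n a j)) = insert 0 ((\<lambda>j. norm (a j)) ` {..<n})"
    by (auto simp: fin_seq_def)
  then show ?thesis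
    by (simp add: lp_norm_def cSup_eq_Max)
qed

lemma sums_fin_seq_powr:
  "(\<lambda>j. norm (fin_seq n a j) powr r) sums (\<Sum>j<n. norm (a j) powr r)"
proof -
  have "(\<lambda>j. norm (fin_seq n a j) powr r) sums (\<Sum>j<n. norm (fin_seq n a j) powr r)"
    by (rule sums_finite) (auto simp: fin_seq_def)
  then show ?thesis by (simp add: fin_seq_def)
qed

lemma lp_norm_fin_seq_real:
  "0 \<le> r \<Longrightarrow> lp_norm (ennreal r) (fin_seq n a) = (\<Sum>j<n. norm (a j) powr r) powr (1 / r)"
  using sums_unique[OF sums_fin_seq_powr[of n a r]] by (simp add: lp_norm_def)

lemma lp_norm_fin_seq_1: "lp_norm 1 (fin_seq n a) = (\<Sum>j<n. norm (a j))"
  using lp_norm_fin_seq_real[of 1 n a] by (simp add: sum_nonneg)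

lemma lp_norm_fin_seq_nonneg: "0 \<le> lp_norm p (fin_seq n a)"
  by (cases p) (simp_all add: lp_norm_fin_seq_real lp_norm_fin_seq_infty)

lemma lp_norm_fin_seq_mono:
  assumes "\<And>j. j < n \<Longrightarrow> norm (a j) \<le> norm (b j)"
  shows "lp_norm p (fin_seq n a) \<le> lp_norm p (fin_seq n b)"
proof (cases p)
  case (real r)
  then show ?thesis
    using assms by (auto simp: lp_norm_fin_seq_real intro!: powr_mono2 sum_mono sum_nonneg)
next
  case top
  have "Max (insert 0 ((\<lambda>j. norm (a j)) ` {..<n})) \<le> Max (insert 0 ((\<lambda>j. norm (b j)) ` {..<n}))"
  proof (rule Max.boundedI)
    fix x assume "x \<in> insert 0 ((\<lambda>j. norm (a j)) ` {..<n})"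
    then show "x \<le> Max (insert 0 ((\<lambda>j. norm (b j)) ` {..<n}))"
      using assms by (force simp: Max_ge_iff)
  qed auto
  with top show ?thesis
    by (simp add: lp_norm_fin_seq_infty)
qed

lemma norm_le_lp_norm_fin_seq_infty:
  "j < n \<Longrightarrow> norm (a j) \<le> lp_norm top (fin_seq n a)"
  by (auto simp: lp_norm_fin_seq_infty intro!: Max_ge)

text \<open>Both families are rescaled to norm one; Young's inequality in each term then adds up to
  \<open>1 / r + 1 / s = 1\<close>. If one of the two norms vanishes, so does every product.\<close>

lemma Hoelder_fin_seq_real:
  fixes a :: "nat \<Rightarrow> 'a::real_normed_vector" and b :: "nat \<Rightarrow> 'b::real_normed_vector"
  assumes "1 < r" "1 < s" "1 / r + 1 / s = 1"
  shows "(\<Sum>j<n. norm (a j) * norm (b j))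
    \<le> (\<Sum>j<n. norm (a j) powr r) powr (1 / r) * (\<Sum>j<n. norm (b j) powr s) powr (1 / s)"
proof -
  define A where "A = (\<Sum>j<n. norm (a j) powr r)"
  define B where "B = (\<Sum>j<n. norm (b j) powr s)"
  have nonneg: "0 \<le> A" "0 \<le> B"
    by (simp_all add: A_def B_def sum_nonneg)
  show ?thesis
  proof (cases "A = 0 \<or> B = 0")
    case True
    then have "norm (a j) * norm (b j) = 0" if "j < n" for j
      using that by (auto simp: A_def B_def sum_nonneg_eq_0_iff)
    then have "(\<Sum>j<n. norm (a j) * norm (b j)) = 0"
      by (intro sum.neutral) auto
    then show ?thesis by simp
  next
    case False
    with nonneg have pos: "0 < A" "0 < B" by auto
    define A' where "A' = A powr (1 / r)"
    define B' where "B' = B powr (1 / s)"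
    have pos': "0 < A'" "0 < B'" "A' powr r = A" "B' powr s = B"
      using pos assms by (simp_all add: A'_def B'_def powr_powr)
    have "(\<Sum>j<n. norm (a j) / A' * (norm (b j) / B'))
      \<le> (\<Sum>j<n. (norm (a j) / A') powr r / r + (norm (b j) / B') powr s / s)"
      using assms pos' by (intro sum_mono Youngs_inequality) auto
    also have "\<dots> = (\<Sum>j<n. norm (a j) powr r) / A / r + (\<Sum>j<n. norm (b j) powr s) / B / s"
      using pos' by (simp add: powr_divide sum.distrib sum_divide_distrib)
    also have "\<dots> = 1"
      using pos assms by (simp flip: A_def B_def)
    finally have "(\<Sum>j<n. norm (a j) * norm (b j)) / (A' * B') \<le> 1"
      by (simp add: sum_divide_distrib)
    then show ?thesis
      using pos' by (simp add: divide_le_eq A'_def B'_def A_def B_def)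
  qed
qed

lemma Hoelder_fin_seq:
  fixes a :: "nat \<Rightarrow> 'a::real_normed_vector" and b :: "nat \<Rightarrow> 'b::real_normed_vector"
  assumes "1 \<le> p"
  shows "(\<Sum>j<n. norm (a j) * norm (b j))
    \<le> lp_norm p (fin_seq n a) * lp_norm (conj_exp p) (fin_seq n b)"
  using assms
proof (cases rule: conj_exp_cases)
  case one
  have "(\<Sum>j<n. norm (a j) * norm (b j)) \<le> (\<Sum>j<n. norm (a j) * lp_norm top (fin_seq n b))"
    by (intro sum_mono mult_left_mono norm_le_lp_norm_fin_seq_infty) auto
  with one show ?thesis
    by (simp add: lp_norm_fin_seq_1 sum_distrib_right)
next
  case inf
  have "(\<Sum>j<n. norm (a j) * norm (b j)) \<le> (\<Sum>j<n. lp_norm top (fin_seq n a) * norm (b j))"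
    by (intro sum_mono mult_right_mono norm_le_lp_norm_fin_seq_infty) auto
  with inf show ?thesis
    by (simp add: lp_norm_fin_seq_1 sum_distrib_left)
next
  case (real r s)
  then show ?thesis
    using Hoelder_fin_seq_real[of r s a b n] by (simp add: lp_norm_fin_seq_real)
qed

lemma lp_norm_fin_seq_attained_real:
  fixes b :: "nat \<Rightarrow> real"
  assumes "1 < r" "1 < s" "1 / r + 1 / s = 1"
  shows "\<exists>a. (\<Sum>j<n. \<bar>a j\<bar> powr r) \<le> 1 \<and> (\<Sum>j<n. a j * b j) = (\<Sum>j<n. \<bar>b j\<bar> powr s) powr (1 / s)"
proof -
  define B where "B = (\<Sum>j<n. \<bar>b j\<bar> powr s)"
  have "0 \<le> B"
    by (simp add: B_def sum_nonneg)
  show ?thesis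
  proof (cases "B = 0")
    case True
    with assms show ?thesis
      by (intro exI[of _ "\<lambda>_. 0"]) (simp flip: B_def)
  next
    case False
    with \<open>0 \<le> B\<close> have B: "0 < B" by simp
    \<comment> \<open>The equality case of Hoelder's inequality:
      \<open>\<bar>a j\<bar> powr r\<close> has to be proportional to
      \<open>\<bar>b j\<bar> powr s\<close>, and dividing by \<open>B powr (1 / r)\<close> gives
      \<open>a\<close> norm one.\<close>
    define a where "a j = sgn (b j) * \<bar>b j\<bar> powr (s - 1) / B powr (1 / r)" for j
    have exps: "(s - 1) * r = s" "1 - 1 / r = 1 / s"
      using assms by (simp_all add: field_simps)
    have "\<bar>a j\<bar> powr r = \<bar>b j\<bar> powr s / B" for j
      using B assms exps by (cases "b j = 0") (simp_all add: a_def abs_mult powr_divide powr_powr)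
    then have "(\<Sum>j<n. \<bar>a j\<bar> powr r) = 1"
      using B by (simp add: B_def flip: sum_divide_distrib)
    moreover have "a j * b j = \<bar>b j\<bar> powr s / B powr (1 / r)" for j
    proof -
      have "sgn (b j) * b j * \<bar>b j\<bar> powr (s - 1) = \<bar>b j\<bar> powr s"
        using powr_mult_base[of "\<bar>b j\<bar>" "s - 1"] by (simp add: abs_sgn[of "b j", symmetric] mult.commute)
      then show ?thesis
        by (simp add: a_def mult_ac)
    qed
    then have "(\<Sum>j<n. a j * b j) = B powr 1 / B powr (1 / r)"
      using B by (simp add: B_def flip: sum_divide_distrib)
    then have "(\<Sum>j<n. a j * b j) = B powr (1 / s)"
      by (simp only: exps flip: powr_diff)
    ultimately show ?thesis
      by (intro exI[of _ a]) (simp add: B_def)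
  qed
qed

text \<open>The witness is a signed unit vector at an index of largest modulus for exponent 1, the
  signs of \<open>b\<close> for exponent \<infinity>, and the equality case of Hoelder's inequality
  in between.\<close>

lemma lp_norm_fin_seq_attained:
  fixes b :: "nat \<Rightarrow> real"
  assumes "1 \<le> p"
  shows "\<exists>a. lp_norm p (fin_seq n a) \<le> 1 \<and> (\<Sum>j<n. a j * b j) = lp_norm (conj_exp p) (fin_seq n b)"
  using assms
proof (cases rule: conj_exp_cases)
  case one
  let ?M = "insert 0 ((\<lambda>j. norm (b j)) ` {..<n})"
  have "Max ?M \<in> ?M"
    by (rule Max_in) auto
  then consider "Max ?M = 0" | k where "k < n" "Max ?M = \<bar>b k\<bar>"
    by auto
  then show ?thesis
  proof cases
    case 1
    with one show ?thesis
      by (intro exI[of _ "\<lambda>_. 0"]) (simp add: lp_norm_fin_seq_1 lp_norm_fin_seq_infty)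
  next
    case 2
    let ?a = "\<lambda>j. if j = k then sgn (b k) else 0"
    have "(\<Sum>j<n. \<bar>?a j\<bar>) = \<bar>sgn (b k)\<bar>"
      using \<open>k < n\<close> by (simp add: if_distrib cong: if_cong)
    moreover have "(\<Sum>j<n. ?a j * b j) = \<bar>b k\<bar>"
      using \<open>k < n\<close> by (simp add: if_distrib[of "\<lambda>x. x * _"] abs_sgn mult.commute[of "sgn _"] cong: if_cong)
    ultimately show ?thesis
      using 2 one
      by (intro exI[of _ ?a]) (simp add: lp_norm_fin_seq_1 lp_norm_fin_seq_infty abs_sgn_eq)
  qed
next
  case inf
  have "(\<Sum>j<n. sgn (b j) * b j) = (\<Sum>j<n. \<bar>b j\<bar>)"
    by (simp add: abs_sgn mult.commute)
  moreover have "Max (insert 0 ((\<lambda>j. \<bar>sgn (b j)\<bar>) ` {..<n})) \<le> 1"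
    by (auto intro!: Max.boundedI simp: abs_sgn_eq)
  ultimately show ?thesis
    using inf by (intro exI[of _ "\<lambda>j. sgn (b j)"]) (simp add: lp_norm_fin_seq_1 lp_norm_fin_seq_infty)
next
  case (real r s)
  then obtain a where a: "(\<Sum>j<n. \<bar>a j\<bar> powr r) \<le> 1"
      "(\<Sum>j<n. a j * b j) = (\<Sum>j<n. \<bar>b j\<bar> powr s) powr (1 / s)"
    using lp_norm_fin_seq_attained_real[of r s n b] by blast
  then have "(\<Sum>j<n. \<bar>a j\<bar> powr r) powr (1 / r) \<le> 1"
    using powr_mono2[of "1 / r" "\<Sum>j<n. \<bar>a j\<bar> powr r" 1] real by (simp add: sum_nonneg)
  with a real show ?thesis
    by (intro exI[of _ a]) (simp add: lp_norm_fin_seq_real)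
qed

text \<open>Turns a bound on a norm into bounds on linear pairings, for which linearity and
  separation arguments are available. The majorizing estimates below are proved in this
  form.\<close>

lemma lp_norm_fin_seq_leI:
  fixes b :: "nat \<Rightarrow> real"
  assumes "1 \<le> p"
    and "\<And>a. lp_norm p (fin_seq n a) \<le> 1 \<Longrightarrow> (\<Sum>j<n. a j * b j) \<le> C"
  shows "lp_norm (conj_exp p) (fin_seq n b) \<le> C"
  using lp_norm_fin_seq_attained[OF assms(1), of n b] assms(2) by metis

section \<open>Infinite sequences: truncations and tails\<close>

lemma lp_seq_scaleR:
  assumes "u \<in> lp_seq p" "1 \<le> p"
  shows "(\<lambda>n. c *\<^sub>R u n) \<in> lp_seq p" "lp_norm p (\<lambda>n. c *\<^sub>R u n) = \<bar>c\<bar> * lp_norm p u"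
proof -
  show "(\<lambda>n. c *\<^sub>R u n) \<in> lp_seq p"
  proof (cases "p = \<infinity>")
    case True
    with assms have "bounded ((*\<^sub>R) c ` range u)"
      by (intro bounded_scaling) (simp add: lp_seq_def)
    with True show ?thesis by (simp add: lp_seq_def image_image)
  qed (use assms in \<open>auto simp: lp_seq_def powr_mult intro!: summable_mult\<close>)
  show "lp_norm p (\<lambda>n. c *\<^sub>R u n) = \<bar>c\<bar> * lp_norm p u"
  proof (cases p)
    case top
    with assms have b: "bdd_above (range (\<lambda>n. norm (u n)))"
      by (auto simp: lp_seq_def bounded_imp_bdd_above_norm)
    have "(SUP n. \<bar>c\<bar> * norm (u n)) = \<bar>c\<bar> * (SUP n. norm (u n))"
    proof (cases "c = 0")
      case False
      have "mono (\<lambda>x::real. \<bar>c\<bar> * x)"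
        by (auto intro!: monoI mult_left_mono)
      moreover have "continuous (at_left (SUP n. norm (u n))) (\<lambda>x::real. \<bar>c\<bar> * x)"
        by (intro continuous_intros)
      ultimately show ?thesis
        using continuous_at_Sup_mono[of "\<lambda>x::real. \<bar>c\<bar> * x" "range (\<lambda>n. norm (u n))"] b
        by (simp add: image_image)
    qed simp
    with top show ?thesis by (simp add: lp_norm_def)
  next
    case (real r)
    with assms have "summable (\<lambda>n. norm (u n) powr r)" "1 \<le> r"
      by (auto simp: lp_seq_def)
    then show ?thesis using real
      by (simp add: lp_norm_def powr_mult suminf_mult suminf_nonneg powr_powr)
  qed
qed

lemma lp_norm_fin_seq_le:
  assumes "1 \<le> p" "u \<in> lp_seq p"
  shows "lp_norm p (fin_seq n u) \<le> lp_norm p u"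
proof (cases p)
  case top
  with assms have b: "bdd_above (range (\<lambda>n. norm (u n)))"
    by (auto simp: lp_seq_def bounded_imp_bdd_above_norm)
  have "(SUP j. norm (fin_seq n u j)) \<le> (SUP j. norm (u j))"
  proof (rule cSUP_least)
    fix j
    show "norm (fin_seq n u j) \<le> (SUP j. norm (u j))"
      using cSUP_upper2[OF b, of j 0] cSUP_upper2[OF b, of j "norm (u j)"] by (auto simp: fin_seq_def)
  qed simp
  with top show ?thesis by (simp add: lp_norm_def)
next
  case (real r)
  with assms have "summable (\<lambda>n. norm (u n) powr r)" "1 \<le> r"
    by (auto simp: lp_seq_def)
  then have "(\<Sum>j<n. norm (u j) powr r) powr (1 / r) \<le> (\<Sum>j. norm (u j) powr r) powr (1 / r)"
    by (intro powr_mono2 sum_le_suminf sum_nonneg) auto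
  with real \<open>1 \<le> r\<close> show ?thesis
    by (simp add: lp_norm_fin_seq_real) (simp add: lp_norm_def)
qed

lemma lp_norm_nonneg: "1 \<le> p \<Longrightarrow> u \<in> lp_seq p \<Longrightarrow> 0 \<le> lp_norm p u"
  using lp_norm_fin_seq_nonneg lp_norm_fin_seq_le order_trans by blast

text \<open>Together with \<open>lp_norm_fin_seq_le\<close> this makes the norm of a sequence the
  supremum of the norms of its truncations, so that later estimates need only be proved for finite
  families.\<close>

lemma lp_seqI:
  assumes "1 \<le> p" "\<And>n. lp_norm p (fin_seq n u) \<le> C"
  shows "u \<in> lp_seq p" "lp_norm p u \<le> C"
proof -
  have "u \<in> lp_seq p \<and> lp_norm p u \<le> C"
  proof (cases p)
    case top
    have le: "norm (u n) \<le> C" for n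
      using norm_le_lp_norm_fin_seq_infty[of n "Suc n" u] assms(2)[of "Suc n"] top by simp
    then have "bounded (range u)"
      by (auto simp: bounded_iff)
    moreover have "(SUP n. norm (u n)) \<le> C"
      using le by (intro cSUP_least) auto
    ultimately show ?thesis
      using top by (simp add: lp_seq_def lp_norm_def)
  next
    case (real r)
    with assms(1) have r: "1 \<le> r"
      by (metis ennreal_1 ennreal_le_iff)
    have "0 \<le> C"
      using assms(2) lp_norm_fin_seq_nonneg order_trans by blast
    have le: "(\<Sum>j<n. norm (u j) powr r) \<le> C powr r" for n
    proof -
      have "((\<Sum>j<n. norm (u j) powr r) powr (1 / r)) powr r \<le> C powr r"
        using assms(2)[of n] real r by (intro powr_mono2) (auto simp: lp_norm_fin_seq_real)
      then show ?thesis
        using r by (simp add: powr_powr sum_nonneg)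
    qed
    have sm: "summable (\<lambda>j. norm (u j) powr r)"
    proof (rule bounded_imp_summable)
      fix n show "(\<Sum>j\<le>n. norm (u j) powr r) \<le> C powr r"
        using le[of "Suc n"] by (simp add: lessThan_Suc_atMost)
    qed simp
    then have "(\<Sum>j. norm (u j) powr r) \<le> C powr r"
      using le by (rule suminf_le_const)
    then have "(\<Sum>j. norm (u j) powr r) powr (1 / r) \<le> (C powr r) powr (1 / r)"
      using r sm by (intro powr_mono2 suminf_nonneg) auto
    then show ?thesis
      using sm real r \<open>0 \<le> C\<close> by (simp add: lp_seq_def lp_norm_def powr_powr)
  qed
  then show "u \<in> lp_seq p" "lp_norm p u \<le> C" by auto
qed

lemma lp_seq_mono:
  assumes "1 \<le> p" "v \<in> lp_seq p" "\<And>n. norm (u n) \<le> norm (v n)"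
  shows "u \<in> lp_seq p" "lp_norm p u \<le> lp_norm p v"
proof -
  have "lp_norm p (fin_seq n u) \<le> lp_norm p v" for n
    using lp_norm_fin_seq_mono[of n u v p] lp_norm_fin_seq_le[of p v n] assms by force
  then show "u \<in> lp_seq p" "lp_norm p u \<le> lp_norm p v"
    using lp_seqI[OF assms(1)] by blast+
qed

lemma fin_seq_in_lp_seq: "fin_seq n u \<in> lp_seq p"
proof (cases "p = \<infinity>")
  case True
  have "range (fin_seq n u) \<subseteq> insert 0 (u ` {..<n})"
    by (auto simp: fin_seq_def)
  then have "bounded (range (fin_seq n u))"
    by (rule bounded_subset[rotated]) (simp add: finite_imp_bounded)
  with True show ?thesis by (simp add: lp_seq_def)
next
  case False
  then show ?thesis
    using sums_summable[OF sums_fin_seq_powr] by (auto simp: lp_seq_def)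
qed

lemma lp_seq_shift:
  assumes "1 \<le> p" "u \<in> lp_seq p"
  shows "(\<lambda>k. u (k + N)) \<in> lp_seq p" "lp_norm p (\<lambda>k. u (k + N)) \<le> lp_norm p u"
proof -
  have "(\<lambda>k. u (k + N)) \<in> lp_seq p \<and> lp_norm p (\<lambda>k. u (k + N)) \<le> lp_norm p u"
  proof (cases p)
    case top
    with assms have b: "bounded (range u)"
      by (simp add: lp_seq_def)
    then have "bounded (range (\<lambda>k. u (k + N)))"
      by (rule bounded_subset) auto
    moreover have "bdd_above (range (\<lambda>n. norm (u n)))"
      using b by (rule bounded_imp_bdd_above_norm)
    then have "(SUP k. norm (u (k + N))) \<le> (SUP n. norm (u n))"
      by (intro cSUP_mono) auto
    ultimately show ?thesis
      using top by (simp add: lp_seq_def lp_norm_def)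
  next
    case (real r)
    with assms have sm: "summable (\<lambda>n. norm (u n) powr r)" and r: "1 \<le> r"
      by (auto simp: lp_seq_def)
    have sm': "summable (\<lambda>k. norm (u (k + N)) powr r)"
      using sm by (rule summable_ignore_initial_segment)
    have "(\<Sum>k. norm (u (k + N)) powr r) \<le> (\<Sum>n. norm (u n) powr r)"
      using suminf_split_initial_segment[OF sm, of N] by (simp add: sum_nonneg)
    then have "(\<Sum>k. norm (u (k + N)) powr r) powr (1 / r) \<le> (\<Sum>n. norm (u n) powr r) powr (1 / r)"
      using r sm' by (intro powr_mono2 suminf_nonneg) auto
    with real r sm' show ?thesis
      by (simp add: lp_seq_def lp_norm_def)
  qed
  then show "(\<lambda>k. u (k + N)) \<in> lp_seq p" "lp_norm p (\<lambda>k. u (k + N)) \<le> lp_norm p u"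
    by auto
qed

text \<open>For finite \<open>p\<close> these are tails of a convergent series. For
  \<open>p = \<infinity>\<close> the null sequence clause of \<open>pos_nuclear_rep\<close> enters
  here: a merely bounded sequence has tails of norm bounded away from 0 in general.\<close>

lemma lp_norm_tail:
  assumes "1 \<le> p" "u \<in> lp_seq p" "p = \<infinity> \<Longrightarrow> u \<longlonglongrightarrow> 0"
  shows "(\<lambda>N. lp_norm p (\<lambda>k. u (k + N))) \<longlonglongrightarrow> 0"
proof (cases p)
  case top
  show ?thesis
  proof (rule LIMSEQ_I)
    fix e :: real assume "0 < e"
    then obtain N where N: "\<And>n. N \<le> n \<Longrightarrow> norm (u n) < e / 2"
      using LIMSEQ_D[OF assms(3), of "e / 2"] top by auto
    have "norm (lp_norm p (\<lambda>k. u (k + n)) - 0) < e" if "N \<le> n" for n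
    proof -
      have "(SUP k. norm (u (k + n))) \<le> e / 2"
        using N that by (intro cSUP_least) (auto intro: less_imp_le)
      then have "lp_norm p (\<lambda>k. u (k + n)) \<le> e / 2"
        using top by (simp add: lp_norm_def)
      moreover have "0 \<le> lp_norm p (\<lambda>k. u (k + n))"
        using lp_norm_nonneg lp_seq_shift assms by blast
      ultimately show ?thesis using \<open>0 < e\<close> by simp
    qed
    then show "\<exists>N. \<forall>n\<ge>N. norm (lp_norm p (\<lambda>k. u (k + n)) - 0) < e" by blast
  qed
next
  case (real r)
  with assms have sm: "summable (\<lambda>n. norm (u n) powr r)" and r: "1 \<le> r"
    by (auto simp: lp_seq_def)
  have "(\<lambda>N. (\<Sum>k. norm (u (k + N)) powr r) powr (1 / r)) \<longlonglongrightarrow> 0 powr (1 / r)"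
  proof (rule tendsto_powr')
    show "(\<lambda>N. \<Sum>k. norm (u (k + N)) powr r) \<longlonglongrightarrow> 0"
      using suminf_exist_split2[OF sm] .
    show "(\<lambda>_::nat. 1 / r) \<longlonglongrightarrow> 1 / r" by simp
    have "0 \<le> (\<Sum>k. norm (u (k + N)) powr r)" for N
      by (intro suminf_nonneg summable_ignore_initial_segment[OF sm]) simp
    \<comment> \<open>The base tends to 0, where continuity of \<open>powr\<close> requires a
      positive exponent and eventually nonnegative bases.\<close>
    then show "0 \<noteq> (0::real) \<or> 0 < 1 / r \<and>
        (\<forall>\<^sub>F N in sequentially. 0 \<le> (\<Sum>k. norm (u (k + N)) powr r))"
      using r by simp
  qed
  with real r show ?thesis
    by (simp add: lp_norm_def)
qed

section \<open>Uniform boundedness and weakly summable sequences\<close>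

text \<open>By Baire's theorem one of the closed sets \<open>F k\<close> contains a ball;
  differences of its points then bound the whole family on a ball about the origin.\<close>

theorem uniform_boundedness:
  fixes A :: "('a::banach \<Rightarrow>\<^sub>L 'b::real_normed_vector) set"
  assumes "\<And>x. \<exists>C. \<forall>T\<in>A. norm (blinfun_apply T x) \<le> C"
  obtains C where "0 \<le> C" "\<And>T x. T \<in> A \<Longrightarrow> norm (blinfun_apply T x) \<le> C * norm x"
proof -
  define F where "F k = {x. \<forall>T\<in>A. norm (blinfun_apply T x) \<le> real k}" for k
  have "closed (F k)" for k
  proof -
    have "F k = (\<Inter>T\<in>A. {x. norm (blinfun_apply T x) \<le> real k})"
      by (auto simp: F_def)
    then show ?thesis
      by (auto intro!: closed_INT closed_Collect_le continuous_intros)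
  qed
  moreover have "\<Union>(range F) = UNIV"
  proof -
    have "\<exists>k. x \<in> F k" for x
    proof -
      obtain C where C: "\<forall>T\<in>A. norm (blinfun_apply T x) \<le> C"
        using assms by blast
      obtain k :: nat where "C \<le> real k"
        using real_arch_simple by blast
      with C have "x \<in> F k"
        by (auto simp: F_def intro: order_trans)
      then show ?thesis ..
    qed
    then show ?thesis by blast
  qed
  ultimately obtain k where "interior (F k) \<noteq> {}"
    using Baire_category_alt[of "euclidean :: 'a topology" "range F"]
    by (fastforce simp: completely_metrizable_space_euclidean)
  then obtain x0 where "x0 \<in> interior (F k)"
    by blast
  then obtain r where r: "0 < r" "cball x0 r \<subseteq> F k"
    unfolding mem_interior_cball by blast
  have "norm (blinfun_apply T x) \<le> 2 * real k / r * norm x" if "T \<in> A" for T x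
  proof (cases "x = 0")
    case False
    \<comment> \<open>\<open>y\<close> lies at distance \<open>r\<close> from \<open>x0\<close> in
      the direction of \<open>x\<close>. The difference of two values of norm at most
      \<open>k\<close> controls \<open>T x\<close>, which is the source of the factor 2.\<close>
    define y where "y = x0 + (r / norm x) *\<^sub>R x"
    have "y \<in> F k" "x0 \<in> F k"
      using r False by (auto simp: y_def dist_norm subset_iff)
    then have "norm (blinfun_apply T y) \<le> real k" "norm (blinfun_apply T x0) \<le> real k"
      using that by (auto simp: F_def)
    then have "norm (blinfun_apply T y - blinfun_apply T x0) \<le> 2 * real k"
      using norm_triangle_ineq4[of "blinfun_apply T y" "blinfun_apply T x0"] by linarith
    moreover have "blinfun_apply T y - blinfun_apply T x0 = (r / norm x) *\<^sub>R blinfun_apply T x"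
      by (simp add: y_def blinfun.bilinear_simps)
    ultimately show ?thesis
      using r False by (simp add: field_simps)
  qed simp
  then show thesis
    using r by (intro that[of "2 * real k / r"]) auto
qed

definition bidual_embed :: "'a::real_normed_vector \<Rightarrow> ('a \<Rightarrow>\<^sub>L real) \<Rightarrow>\<^sub>L real" where
  "bidual_embed x = Blinfun (\<lambda>f. blinfun_apply f x)"

lemma bidual_embed_apply [simp]: "blinfun_apply (bidual_embed x) f = blinfun_apply f x"
  by (simp add: bidual_embed_def bounded_linear_Blinfun_apply blinfun.bounded_linear_left)

lemma norm_bidual_embed_le: "norm (bidual_embed x) \<le> norm x"
proof (rule norm_blinfun_bound)
  fix f :: "'a \<Rightarrow>\<^sub>L real"
  show "norm (blinfun_apply (bidual_embed x) f) \<le> norm x * norm f"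
    using norm_blinfun[of f x] by (simp add: mult.commute)
qed simp

lemma blinfun_apply_fin_seq:
  "blinfun_apply f (fin_seq n xs j) = fin_seq n (\<lambda>j. blinfun_apply f (xs j)) j"
  by (simp add: fin_seq_def)

lemma abs_sum_mult_le_lp_norm:
  assumes "1 \<le> p" "b \<in> lp_seq (conj_exp p)" "lp_norm p (fin_seq n a) \<le> 1"
  shows "\<bar>\<Sum>j<n. a j * b j\<bar> \<le> lp_norm (conj_exp p) b"
proof -
  have "\<bar>\<Sum>j<n. a j * b j\<bar> \<le> (\<Sum>j<n. norm (a j) * norm (b j))"
    using sum_abs[of "\<lambda>j. a j * b j" "{..<n}"] by (simp add: abs_mult)
  also have "\<dots> \<le> lp_norm p (fin_seq n a) * lp_norm (conj_exp p) (fin_seq n b)"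
    by (rule Hoelder_fin_seq) fact
  also have "\<dots> \<le> 1 * lp_norm (conj_exp p) b"
    using assms by (intro mult_mono lp_norm_fin_seq_le lp_norm_fin_seq_nonneg conj_exp_ge_1) auto
  finally show ?thesis by simp
qed

text \<open>Combinations of the \<open>xs j\<close> with coefficients in the unit ball of the
  conjugate exponent form, as elements of the bidual, a pointwise bounded family on the dual, which
  is complete even if the space is not. Uniform boundedness gives one constant, and the duality of
  the two exponents turns it back into a norm estimate.\<close>

lemma weak_lp_seq_bounded:
  fixes xs :: "nat \<Rightarrow> 'a::real_normed_vector"
  assumes p: "1 \<le> p" and xs: "xs \<in> weak_lp_seq p"
  obtains C where "0 \<le> C"
    "\<And>f :: 'a \<Rightarrow>\<^sub>L real. lp_norm p (\<lambda>n. blinfun_apply f (xs n)) \<le> C * norm f"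
proof -
  define q where "q = conj_exp p"
  have q: "1 \<le> q" "conj_exp q = p"
    using p by (simp_all add: q_def conj_exp_ge_1 conj_exp_conj_exp)
  define A where "A = {T. \<exists>n a. lp_norm q (fin_seq n a) \<le> 1 \<and>
    T = bidual_embed (\<Sum>j<n. a j *\<^sub>R xs j)}"
  have "\<bar>blinfun_apply f (\<Sum>j<n. a j *\<^sub>R xs j)\<bar> \<le> lp_norm p (\<lambda>n. blinfun_apply f (xs n))"
    if "lp_norm q (fin_seq n a) \<le> 1" for n a and f :: "'a \<Rightarrow>\<^sub>L real"
    using abs_sum_mult_le_lp_norm[of q "\<lambda>n. blinfun_apply f (xs n)" n a] q xs that
    by (simp add: weak_lp_seq_def blinfun.bilinear_simps)
  then have "\<exists>C. \<forall>T\<in>A. norm (blinfun_apply T f) \<le> C" for f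
    unfolding A_def by (intro exI[of _ "lp_norm p (\<lambda>n. blinfun_apply f (xs n))"]) auto
  then obtain C where C: "0 \<le> C" "\<And>T f. T \<in> A \<Longrightarrow> norm (blinfun_apply T f) \<le> C * norm f"
    using uniform_boundedness[of A] by blast
  have "lp_norm p (fin_seq n (\<lambda>n. blinfun_apply f (xs n))) \<le> C * norm f"
    for n and f :: "'a \<Rightarrow>\<^sub>L real"
  proof (rule lp_norm_fin_seq_leI[OF q(1), unfolded q(2)])
    fix a :: "nat \<Rightarrow> real" assume "lp_norm q (fin_seq n a) \<le> 1"
    then have "bidual_embed (\<Sum>j<n. a j *\<^sub>R xs j) \<in> A"
      by (auto simp: A_def)
    from C(2)[OF this, of f] show "(\<Sum>j<n. a j * blinfun_apply f (xs j)) \<le> C * norm f"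
      by (simp add: blinfun.bilinear_simps)
  qed
  then have "lp_norm p (\<lambda>n. blinfun_apply f (xs n)) \<le> C * norm f" for f :: "'a \<Rightarrow>\<^sub>L real"
    by (rule lp_seqI(2)[OF p])
  with C(1) show thesis
    by (rule that)
qed

lemma bdd_above_weak_lp:
  fixes xs :: "nat \<Rightarrow> 'a::real_normed_vector"
  assumes "1 \<le> p" "xs \<in> weak_lp_seq p"
  shows "bdd_above ((\<lambda>f. lp_norm p (\<lambda>n. blinfun_apply f (xs n))) ` {f :: 'a \<Rightarrow>\<^sub>L real. norm f \<le> 1})"
proof -
  obtain C where C: "0 \<le> C"
    "\<And>f :: 'a \<Rightarrow>\<^sub>L real. lp_norm p (\<lambda>n. blinfun_apply f (xs n)) \<le> C * norm f"
    using weak_lp_seq_bounded[OF assms] by blast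
  show ?thesis
  proof (rule bdd_aboveI2)
    fix f :: "'a \<Rightarrow>\<^sub>L real" assume "f \<in> {f. norm f \<le> 1}"
    then have "C * norm f \<le> C"
      using C(1) by (simp add: mult_left_le)
    with C(2)[of f] show "lp_norm p (\<lambda>n. blinfun_apply f (xs n)) \<le> C" by simp
  qed
qed

lemma lp_norm_le_weak_lp_norm:
  fixes xs :: "nat \<Rightarrow> 'a::real_normed_vector" and f :: "'a \<Rightarrow>\<^sub>L real"
  assumes "1 \<le> p" "xs \<in> weak_lp_seq p"
  shows "lp_norm p (\<lambda>n. blinfun_apply f (xs n)) \<le> weak_lp_norm p xs * norm f"
proof -
  obtain C where C: "0 \<le> C"
    "\<And>f :: 'a \<Rightarrow>\<^sub>L real. lp_norm p (\<lambda>n. blinfun_apply f (xs n)) \<le> C * norm f"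
    using weak_lp_seq_bounded[OF assms] by blast
  have unit: "lp_norm p (\<lambda>n. blinfun_apply g (xs n)) \<le> weak_lp_norm p xs"
    if "norm g \<le> 1" for g :: "'a \<Rightarrow>\<^sub>L real"
    unfolding weak_lp_norm_def using that bdd_above_weak_lp[OF assms] by (intro cSUP_upper) auto
  show ?thesis
  proof (cases "f = 0")
    case True
    with C(2)[of f] show ?thesis by simp
  next
    case False
    define g where "g = (1 / norm f) *\<^sub>R f"
    have g: "norm g \<le> 1" "f = norm f *\<^sub>R g"
      using False by (simp_all add: g_def)
    then have "lp_norm p (\<lambda>n. blinfun_apply f (xs n)) = norm f * lp_norm p (\<lambda>n. blinfun_apply g (xs n))"
      using lp_seq_scaleR(2)[of "\<lambda>n. blinfun_apply g (xs n)" p "norm f"] assms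
      by (metis (no_types, lifting) abs_norm_cancel weak_lp_seq_def mem_Collect_eq scaleR_blinfun.rep_eq ext)
    also have "\<dots> \<le> norm f * weak_lp_norm p xs"
      using unit[OF g(1)] by (rule mult_left_mono) simp
    finally show ?thesis by (simp add: mult.commute)
  qed
qed

lemma weak_lp_norm_nonneg:
  fixes xs :: "nat \<Rightarrow> 'a::real_normed_vector"
  assumes "1 \<le> p" "xs \<in> weak_lp_seq p"
  shows "0 \<le> weak_lp_norm p xs"
proof -
  have "(\<lambda>n. blinfun_apply (0 :: 'a \<Rightarrow>\<^sub>L real) (xs n)) \<in> lp_seq p"
    using assms(2) unfolding weak_lp_seq_def by blast
  then have "0 \<le> lp_norm p (\<lambda>n. blinfun_apply (0 :: 'a \<Rightarrow>\<^sub>L real) (xs n))"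
    using assms(1) by (intro lp_norm_nonneg)
  also have "\<dots> \<le> weak_lp_norm p xs"
    unfolding weak_lp_norm_def using bdd_above_weak_lp[OF assms] by (intro cSUP_upper) auto
  finally show ?thesis .
qed

lemma weak_lp_seqI:
  fixes xs :: "nat \<Rightarrow> 'a::real_normed_vector"
  assumes p: "1 \<le> p"
    and le: "\<And>f n. norm (f :: 'a \<Rightarrow>\<^sub>L real) \<le> 1 \<Longrightarrow>
      lp_norm p (fin_seq n (\<lambda>j. blinfun_apply f (xs j))) \<le> C"
  shows "xs \<in> weak_lp_seq p" "weak_lp_norm p xs \<le> C"
proof -
  have unit: "(\<lambda>j. blinfun_apply f (xs j)) \<in> lp_seq p" "lp_norm p (\<lambda>j. blinfun_apply f (xs j)) \<le> C"
    if "norm f \<le> 1" for f :: "'a \<Rightarrow>\<^sub>L real"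
    using lp_seqI[OF p le[OF that]] by auto
  show "xs \<in> weak_lp_seq p"
    unfolding weak_lp_seq_def
  proof safe
    fix f :: "'a \<Rightarrow>\<^sub>L real"
    \<comment> \<open>For \<open>f = 0\<close> division by zero gives \<open>g = 0\<close>, so both
      facts below hold without a case distinction.\<close>
    define g where "g = (1 / norm f) *\<^sub>R f"
    have g: "norm g \<le> 1" "f = norm f *\<^sub>R g"
      by (simp_all add: g_def)
    then have "(\<lambda>j. norm f *\<^sub>R blinfun_apply g (xs j)) \<in> lp_seq p"
      by (intro lp_seq_scaleR unit p)
    with g(2) show "(\<lambda>j. blinfun_apply f (xs j)) \<in> lp_seq p"
      by (metis (no_types, lifting) scaleR_blinfun.rep_eq ext)
  qed
  show "weak_lp_norm p xs \<le> C"
    unfolding weak_lp_norm_def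
    using unit(2) by (intro cSUP_least) (auto intro: exI[of _ 0])
qed

lemma weak_lp_fin_seq_le:
  fixes xs :: "nat \<Rightarrow> 'a::real_normed_vector" and f :: "'a \<Rightarrow>\<^sub>L real"
  assumes "1 \<le> p" "xs \<in> weak_lp_seq p" "norm f \<le> 1"
  shows "lp_norm p (fin_seq n (\<lambda>j. blinfun_apply f (xs j))) \<le> weak_lp_norm p xs"
proof -
  have "lp_norm p (fin_seq n (\<lambda>j. blinfun_apply f (xs j))) \<le> lp_norm p (\<lambda>j. blinfun_apply f (xs j))"
    using assms by (intro lp_norm_fin_seq_le) (auto simp: weak_lp_seq_def)
  also have "\<dots> \<le> weak_lp_norm p xs * norm f"
    using assms(1,2) by (rule lp_norm_le_weak_lp_norm)
  also have "\<dots> \<le> weak_lp_norm p xs"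
    using assms weak_lp_norm_nonneg by (intro mult_left_le)
  finally show ?thesis .
qed

lemma fin_seq_in_weak_lp_seq: "fin_seq n xs \<in> weak_lp_seq p"
  by (simp add: weak_lp_seq_def blinfun_apply_fin_seq fin_seq_in_lp_seq)

lemma weak_lp_norm_fin_seq_le:
  fixes xs :: "nat \<Rightarrow> 'a::real_normed_vector"
  assumes "1 \<le> p" "xs \<in> weak_lp_seq p"
  shows "weak_lp_norm p (fin_seq n xs) \<le> weak_lp_norm p xs"
proof (rule weak_lp_seqI(2)[OF assms(1)])
  fix f :: "'a \<Rightarrow>\<^sub>L real" and m assume f: "norm f \<le> 1"
  have "lp_norm p (fin_seq m (\<lambda>j. blinfun_apply f (fin_seq n xs j)))
      \<le> lp_norm p (fin_seq m (\<lambda>j. blinfun_apply f (xs j)))"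
    by (rule lp_norm_fin_seq_mono) (simp add: fin_seq_def)
  also have "\<dots> \<le> weak_lp_norm p xs"
    using assms f by (rule weak_lp_fin_seq_le)
  finally show "lp_norm p (fin_seq m (\<lambda>j. blinfun_apply f (fin_seq n xs j))) \<le> weak_lp_norm p xs" .
qed

lemma weak_lp_seq_shift:
  fixes xs :: "nat \<Rightarrow> 'a::real_normed_vector"
  assumes "1 \<le> p" "xs \<in> weak_lp_seq p"
  shows "(\<lambda>k. xs (k + N)) \<in> weak_lp_seq p" "weak_lp_norm p (\<lambda>k. xs (k + N)) \<le> weak_lp_norm p xs"
proof -
  have "lp_norm p (fin_seq n (\<lambda>k. blinfun_apply f (xs (k + N)))) \<le> weak_lp_norm p xs"
    if "norm f \<le> 1" for f :: "'a \<Rightarrow>\<^sub>L real" and n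
  proof -
    have u: "(\<lambda>k. blinfun_apply f (xs k)) \<in> lp_seq p"
      using assms by (simp add: weak_lp_seq_def)
    have "lp_norm p (fin_seq n (\<lambda>k. blinfun_apply f (xs (k + N)))) \<le> lp_norm p (\<lambda>k. blinfun_apply f (xs (k + N)))"
      using lp_seq_shift(1)[OF assms(1) u] assms(1) by (rule lp_norm_fin_seq_le[rotated])
    also have "\<dots> \<le> lp_norm p (\<lambda>k. blinfun_apply f (xs k))"
      by (rule lp_seq_shift(2)[OF assms(1) u])
    also have "\<dots> \<le> weak_lp_norm p xs * norm f"
      using assms by (rule lp_norm_le_weak_lp_norm)
    also have "\<dots> \<le> weak_lp_norm p xs"
      using that assms weak_lp_norm_nonneg by (intro mult_left_le)
    finally show ?thesis .
  qed
  then show "(\<lambda>k. xs (k + N)) \<in> weak_lp_seq p" "weak_lp_norm p (\<lambda>k. xs (k + N)) \<le> weak_lp_norm p xs"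
    by (auto intro: weak_lp_seqI[OF assms(1)])
qed

lemma weak_lp_seq_blinfun:
  fixes R :: "'a::real_normed_vector \<Rightarrow>\<^sub>L 'b::real_normed_vector"
  assumes "1 \<le> p" "xs \<in> weak_lp_seq p" "norm R \<le> 1"
  shows "(\<lambda>n. blinfun_apply R (xs n)) \<in> weak_lp_seq p"
    "weak_lp_norm p (\<lambda>n. blinfun_apply R (xs n)) \<le> weak_lp_norm p xs"
proof -
  have "lp_norm p (fin_seq n (\<lambda>j. blinfun_apply f (blinfun_apply R (xs j)))) \<le> weak_lp_norm p xs"
    if "norm f \<le> 1" for f :: "'b \<Rightarrow>\<^sub>L real" and n
  proof -
    have "norm (f o\<^sub>L R) \<le> 1"
      using norm_blinfun_compose[of f R] mult_mono[OF that assms(3)] by simp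
    from weak_lp_fin_seq_le[OF assms(1,2) this] show ?thesis
      by simp
  qed
  then show "(\<lambda>n. blinfun_apply R (xs n)) \<in> weak_lp_seq p"
    "weak_lp_norm p (\<lambda>n. blinfun_apply R (xs n)) \<le> weak_lp_norm p xs"
    by (auto intro: weak_lp_seqI[OF assms(1)])
qed

section \<open>The Hahn--Banach theorem in sandwich form\<close>

definition sublinear :: "('a::real_vector \<Rightarrow> real) \<Rightarrow> bool" where
  "sublinear s \<longleftrightarrow> (\<forall>x y. s (x + y) \<le> s x + s y) \<and> (\<forall>c\<ge>0. \<forall>x. s (c *\<^sub>R x) = c * s x)"

lemma sublinear_add: "sublinear s \<Longrightarrow> s (x + y) \<le> s x + s y"
  and sublinear_scaleR: "sublinear s \<Longrightarrow> 0 \<le> c \<Longrightarrow> s (c *\<^sub>R x) = c * s x"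
  by (auto simp: sublinear_def)

lemma sublinear_0: "sublinear s \<Longrightarrow> s 0 = 0"
  using sublinear_scaleR[of s 0 0] by simp

lemma sublinear_minus: "sublinear s \<Longrightarrow> - s (- x) \<le> s x"
  using sublinear_add[of s x "- x"] sublinear_0[of s] by simp

text \<open>The inequality for the factor \<open>1 / c\<close>, applied to
  \<open>c *\<^sub>R x\<close>, is the reverse inequality for \<open>c\<close>.\<close>

lemma sublinearI:
  assumes "\<And>x y. s (x + y) \<le> s x + s y" "s 0 = 0"
    and le: "\<And>c x. 0 < c \<Longrightarrow> s (c *\<^sub>R x) \<le> c * s x"
  shows "sublinear s"
proof -
  have "s (c *\<^sub>R x) = c * s x" if "0 \<le> c" for c x
  proof (cases "c = 0")
    case False
    with that have "0 < c" by simp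
    then have "s ((1 / c) *\<^sub>R c *\<^sub>R x) \<le> (1 / c) * s (c *\<^sub>R x)"
      by (intro le) simp
    then have "c * s x \<le> s (c *\<^sub>R x)"
      using \<open>0 < c\<close> by (simp add: field_simps)
    with le[OF \<open>0 < c\<close>, of x] show ?thesis by simp
  qed (use assms(2) in simp)
  with assms(1) show ?thesis by (simp add: sublinear_def)
qed

text \<open>A pair \<open>(k, c)\<close> in \<open>D\<close> stands for the demand
  \<open>c \<le> g k\<close> on a linear functional \<open>g\<close>. Passing from \<open>s\<close>
  to \<open>h\<close> builds these lower bounds into the upper bound: a linear \<open>g\<close>
  below \<open>h\<close> has \<open>- g k \<le> h (- k) \<le> - c\<close>.\<close>

lemma sublinear_INF_cone:
  assumes s: "sublinear s" and D: "convex_cone D"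
    and le: "\<And>k c. (k, c) \<in> D \<Longrightarrow> c \<le> s k"
  defines "h \<equiv> \<lambda>x. INF (k, c)\<in>D. s (x + k) - c"
  shows "sublinear h" "h x \<le> s x" "(k, c) \<in> D \<Longrightarrow> h (- k) \<le> - c"
proof -
  \<comment> \<open>Subadditivity for \<open>k = (x + k) + (- x)\<close> and
    \<open>c \<le> s k\<close> keep the infimum finite.\<close>
  have "- s (- x) \<le> s (x + k) - c" if "(k, c) \<in> D" for x k c
    using sublinear_add[OF s, of "x + k" "- x"] le[OF that] by simp
  then have bdd: "bdd_below ((\<lambda>(k, c). s (x + k) - c) ` D)" for x
    by (intro bdd_belowI2[of _ "- s (- x)"]) auto
  have lower: "h x \<le> s (x + k) - c" if "(k, c) \<in> D" for x k c
    unfolding h_def using cINF_lower[OF bdd that, of x] by simp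
  have greatest: "b \<le> h x" if "\<And>k c. (k, c) \<in> D \<Longrightarrow> b \<le> s (x + k) - c" for x b
    unfolding h_def using that convex_cone_nonempty[OF D] by (intro cINF_greatest) auto
  have D0: "(0, 0) \<in> D"
    using convex_cone_contains_0[OF D] by (simp add: zero_prod_def)
  show "h x \<le> s x" for x
    using lower[OF D0, of x] by simp
  show "h (- k) \<le> - c" if "(k, c) \<in> D" for k c
    using lower[OF that, of "- k"] sublinear_0[OF s] by simp
  show "sublinear h"
  proof (rule sublinearI)
    fix x y
    have "h (x + y) - (s (y + k') - c') \<le> s (x + k) - c" if "(k, c) \<in> D" "(k', c') \<in> D" for k c k' c'
    proof -
      have "(k + k', c + c') \<in> D"
        using convex_cone_add[OF D that] by simp
      from lower[OF this, of "x + y"] sublinear_add[OF s, of "x + k" "y + k'"] show ?thesis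
        by (simp add: algebra_simps)
    qed
    then have "h (x + y) - (s (y + k') - c') \<le> h x" if "(k', c') \<in> D" for k' c'
      using that by (intro greatest)
    then have "h (x + y) - h x \<le> h y"
      by (intro greatest) (simp add: algebra_simps)
    then show "h (x + y) \<le> h x + h y" by simp
  next
    have "0 \<le> h 0"
      using le by (intro greatest) simp
    with lower[OF D0, of 0] sublinear_0[OF s] show "h 0 = 0" by simp
  next
    fix c :: real and x assume c: "0 < c"
    have "h (c *\<^sub>R x) / c \<le> s (x + k) - b" if "(k, b) \<in> D" for k b
    proof -
      have "(c *\<^sub>R k, c * b) \<in> D"
        using convex_cone_scaleR[OF D _ that, of c] c by simp
      from lower[OF this, of "c *\<^sub>R x"] have "h (c *\<^sub>R x) \<le> c * (s (x + k) - b)"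
        using sublinear_scaleR[OF s, of c "x + k"] c by (simp add: algebra_simps)
      then show ?thesis
        using c by (simp add: divide_le_eq mult.commute)
    qed
    then have "h (c *\<^sub>R x) / c \<le> h x"
      by (rule greatest)
    then show "h (c *\<^sub>R x) \<le> c * h x"
      using c by (simp add: divide_le_eq mult.commute)
  qed
qed

text \<open>An infimum of sublinear functionals is not subadditive in general; in a chain the
  smaller of two members serves both summands at once. This supplies the chain bounds for Zorn's
  lemma.\<close>

lemma sublinear_chain_INF:
  assumes s: "sublinear s" and C: "C \<noteq> {}" "\<And>t. t \<in> C \<Longrightarrow> sublinear t \<and> t \<le> s"
    and chain: "\<And>t t'. t \<in> C \<Longrightarrow> t' \<in> C \<Longrightarrow> t \<le> t' \<or> t' \<le> t"
  defines "u \<equiv> \<lambda>x. INF t\<in>C. t x"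
  shows "sublinear u" "t \<in> C \<Longrightarrow> u \<le> t"
proof -
  have "- s (- x) \<le> t x" if "t \<in> C" for t x
    using sublinear_minus[of t x] le_funD[of t s "- x"] C(2)[OF that] by simp
  then have bdd: "bdd_below ((\<lambda>t. t x) ` C)" for x
    by (intro bdd_belowI2[of _ "- s (- x)"])
  have lower: "u x \<le> t x" if "t \<in> C" for t x
    unfolding u_def using cINF_lower[OF bdd that] .
  have greatest: "b \<le> u x" if "\<And>t. t \<in> C \<Longrightarrow> b \<le> t x" for x b
    unfolding u_def using C(1) that by (rule cINF_greatest)
  show "u \<le> t" if "t \<in> C" for t
    using lower[OF that] by (rule le_funI)
  show "sublinear u"
  proof (rule sublinearI)
    fix x y
    have "u (x + y) - t' y \<le> t x" if "t \<in> C" "t' \<in> C" for t t'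
    proof -
      obtain r where r: "r \<in> C" "r \<le> t" "r \<le> t'"
        using chain[of t t'] \<open>t \<in> C\<close> \<open>t' \<in> C\<close> by blast
      then have "u (x + y) \<le> r x + r y"
        using lower[OF r(1)] sublinear_add C(2) order_trans by blast
      also have "\<dots> \<le> t x + t' y"
        using r by (intro add_mono) (auto simp: le_fun_def)
      finally show ?thesis by simp
    qed
    then have "u (x + y) - t' y \<le> u x" if "t' \<in> C" for t'
      using that by (intro greatest)
    then have "u (x + y) - u x \<le> u y"
      by (intro greatest) (simp add: algebra_simps)
    then show "u (x + y) \<le> u x + u y" by simp
  next
    show "u 0 = 0"
      unfolding u_def using C sublinear_0 by (subst INF_cong[of C C _ "\<lambda>_. 0"]) auto
  next
    fix c :: real and x assume c: "0 < c"
    have "u (c *\<^sub>R x) / c \<le> t x" if "t \<in> C" for t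
      using lower[OF that, of "c *\<^sub>R x"] C(2)[OF that] sublinear_scaleR[of t c x] c
      by (simp add: divide_le_eq mult.commute)
    then have "u (c *\<^sub>R x) / c \<le> u x"
      by (rule greatest)
    then show "u (c *\<^sub>R x) \<le> c * u x"
      using c by (simp add: divide_le_eq mult.commute)
  qed
qed

text \<open>Minimal sublinear functionals are linear.\<close>

theorem sublinear_dominates_linear:
  fixes s :: "'a::real_vector \<Rightarrow> real"
  assumes s: "sublinear s"
  obtains g where "linear g" "\<And>x. g x \<le> s x"
proof -
  define A where "A = {t. sublinear t \<and> t \<le> s}"
  \<comment> \<open>Zorn's lemma is applied to the reversed order, so that bounds of chains are
    pointwise infima and the resulting element is minimal.\<close>
  have "\<exists>m\<in>A. \<forall>t\<in>A. t \<le> m \<longrightarrow> t = m"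
  proof (rule predicate_Zorn)
    show "partial_order_on A (relation_of (\<lambda>a b. b \<le> a) A)"
      by (rule partial_order_on_relation_ofI) auto
  next
    fix C assume "C \<in> Chains (relation_of (\<lambda>a b. b \<le> a) A)"
    then have chain: "\<And>t. t \<in> C \<Longrightarrow> t \<in> A" "\<And>t t'. t \<in> C \<Longrightarrow> t' \<in> C \<Longrightarrow> t \<le> t' \<or> t' \<le> t"
      by (auto simp: Chains_def relation_of_def)
    show "\<exists>u\<in>A. \<forall>a\<in>C. u \<le> a"
    proof (cases "C = {}")
      case True
      with s show ?thesis by (auto simp: A_def)
    next
      case False
      let ?u = "\<lambda>x. INF t\<in>C. t x"
      have u: "sublinear ?u" "\<And>t. t \<in> C \<Longrightarrow> ?u \<le> t"
        using sublinear_chain_INF[OF s False] chain by (auto simp: A_def)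
      moreover obtain t where "t \<in> C" using False by blast
      ultimately have "?u \<in> A"
        using chain(1)[of t] u(2)[of t] by (auto simp: A_def intro: order_trans)
      with u show ?thesis by blast
    qed
  qed
  then obtain m where m: "sublinear m" "m \<le> s" and min: "\<And>t. sublinear t \<Longrightarrow> t \<le> m \<Longrightarrow> t = m"
    unfolding A_def by (metis (mono_tags, lifting) mem_Collect_eq order_trans)
  have neg: "m (- x) = - m x" for x
  proof -
    \<comment> \<open>The ray through \<open>(x, m x)\<close> demands at \<open>x\<close> the value
      that \<open>m\<close> already has. The resulting \<open>h\<close> lies below the minimal
      \<open>m\<close>, hence equals it, and brings \<open>h (- x) \<le> - m x\<close> with
      it.\<close>
    define D where "D = (\<lambda>r. (r *\<^sub>R x, r * m x)) ` {0..}"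
    have "convex_cone D"
      unfolding convex_cone_iff D_def
    proof (intro conjI ballI allI impI)
      show "0 \<in> (\<lambda>r. (r *\<^sub>R x, r * m x)) ` {0..}"
        by (auto simp: zero_prod_def image_iff intro!: bexI[of _ 0])
    next
      fix a b assume "a \<in> (\<lambda>r. (r *\<^sub>R x, r * m x)) ` {0..}" "b \<in> (\<lambda>r. (r *\<^sub>R x, r * m x)) ` {0..}"
      then obtain r r' where "a = (r *\<^sub>R x, r * m x)" "b = (r' *\<^sub>R x, r' * m x)" "0 \<le> r" "0 \<le> r'"
        by auto
      then show "a + b \<in> (\<lambda>r. (r *\<^sub>R x, r * m x)) ` {0..}"
        by (intro image_eqI[of _ _ "r + r'"]) (auto simp: algebra_simps)
    next
      fix a and c :: real assume "a \<in> (\<lambda>r. (r *\<^sub>R x, r * m x)) ` {0..}" "0 \<le> c"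
      then obtain r where "a = (r *\<^sub>R x, r * m x)" "0 \<le> r" by auto
      with \<open>0 \<le> c\<close> show "c *\<^sub>R a \<in> (\<lambda>r. (r *\<^sub>R x, r * m x)) ` {0..}"
        by (intro image_eqI[of _ _ "c * r"]) auto
    qed
    moreover have "b \<le> m k" if "(k, b) \<in> D" for k b
      using that sublinear_scaleR[OF m(1)] by (auto simp: D_def)
    moreover define h where "h y = (INF (k, b)\<in>D. m (y + k) - b)" for y
    ultimately have h: "sublinear h" "\<And>y. h y \<le> m y" "\<And>k b. (k, b) \<in> D \<Longrightarrow> h (- k) \<le> - b"
      unfolding h_def using sublinear_INF_cone[OF m(1)] by blast+
    then have "h = m"
      by (intro min) (auto simp: le_fun_def)
    moreover have "(x, m x) \<in> D"
      unfolding D_def by (rule image_eqI[of _ _ 1]) auto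
    ultimately have "m (- x) \<le> - m x"
      using h(3) by metis
    with sublinear_minus[OF m(1), of x] show ?thesis by linarith
  qed
  have "linear m"
  proof (rule linearI)
    fix x y
    have "m (- x + - y) \<le> m (- x) + m (- y)"
      using m(1) by (rule sublinear_add)
    then have "- m (x + y) \<le> - m x - m y"
      using neg[of "x + y"] neg[of x] neg[of y] by simp
    with sublinear_add[OF m(1), of x y] show "m (x + y) = m x + m y" by simp
  next
    fix r x
    show "m (r *\<^sub>R x) = r *\<^sub>R m x"
    proof (cases "0 \<le> r")
      case True
      with m(1) show ?thesis by (simp add: sublinear_scaleR)
    next
      case False
      then have "m ((- r) *\<^sub>R x) = - r * m x"
        using m(1) by (intro sublinear_scaleR) auto
      with neg[of "r *\<^sub>R x"] show ?thesis by simp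
    qed
  qed
  with m(2) show thesis
    by (intro that) (auto simp: le_fun_def)
qed

text \<open>The choice of \<open>D\<close> adapts this to each use: a ray in
  \<open>exists_blinfun_eq_1\<close>, the graph of a functional over the positive cone in
  \<open>exists_dual_pos_dominating\<close>, and an image of the families in a cone in
  \<open>dominated_on_bidual_cone\<close>.\<close>

theorem linear_sandwich:
  fixes s :: "'a::real_vector \<Rightarrow> real"
  assumes "sublinear s" "convex_cone D" "\<And>k c. (k, c) \<in> D \<Longrightarrow> c \<le> s k"
  obtains g where "linear g" "\<And>x. g x \<le> s x" "\<And>k c. (k, c) \<in> D \<Longrightarrow> c \<le> g k"
proof -
  define h where "h x = (INF (k, c)\<in>D. s (x + k) - c)" for x
  have h: "sublinear h" "\<And>x. h x \<le> s x" "\<And>k c. (k, c) \<in> D \<Longrightarrow> h (- k) \<le> - c"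
    unfolding h_def using sublinear_INF_cone[OF assms] by blast+
  obtain g where g: "linear g" "\<And>x. g x \<le> h x"
    using sublinear_dominates_linear[OF h(1)] by blast
  show thesis
  proof (rule that[OF g(1)])
    show "g x \<le> s x" for x
      using g(2) h(2) order_trans by blast
    show "c \<le> g k" if "(k, c) \<in> D" for k c
      using g(2)[of "- k"] h(3)[OF that] linear_neg[OF g(1), of k] by simp
  qed
qed

section \<open>Bounded functionals and finite rank operators\<close>

lemma linear_le_norm_imp_blinfun:
  assumes "linear g" "\<And>x. g x \<le> C * norm x" "0 \<le> C"
  obtains f :: "'a::real_normed_vector \<Rightarrow>\<^sub>L real" where "blinfun_apply f = g" "norm f \<le> C"
proof -
  have abs: "\<bar>g x\<bar> \<le> C * norm x" for x
    using assms(2)[of x] assms(2)[of "- x"] linear_neg[OF assms(1), of x] by (simp add: abs_le_iff)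
  then have "bounded_linear g"
    using assms(1) by (intro bounded_linear_intro[where K = C]) (auto simp: linear_add linear_scale mult.commute)
  then have f: "blinfun_apply (Blinfun g) = g"
    by (rule bounded_linear_Blinfun_apply)
  moreover have "norm (Blinfun g) \<le> C"
    using abs assms(3) by (intro norm_blinfun_bound) (auto simp: f)
  ultimately show thesis
    by (rule that)
qed

text \<open>The ray through \<open>(x, norm x)\<close> forces \<open>norm x \<le> g x\<close> while
  the norm is the upper bound, so \<open>g x\<close> is nonzero and can be scaled to 1.\<close>

lemma exists_blinfun_eq_1:
  fixes x :: "'a::real_normed_vector"
  assumes "x \<noteq> 0"
  obtains f :: "'a \<Rightarrow>\<^sub>L real" where "blinfun_apply f x = 1"
proof -
  define D where "D = (\<lambda>r. r *\<^sub>R (x, norm x)) ` {0..}"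
  have D: "convex_cone D"
    unfolding convex_cone_iff D_def
  proof (intro conjI ballI allI impI)
    show "0 \<in> (\<lambda>r. r *\<^sub>R (x, norm x)) ` {0..}"
      by (auto simp: image_iff intro!: bexI[of _ 0] simp: zero_prod_def)
  next
    fix a b assume "a \<in> (\<lambda>r. r *\<^sub>R (x, norm x)) ` {0..}" "b \<in> (\<lambda>r. r *\<^sub>R (x, norm x)) ` {0..}"
    then obtain r r' where "a = r *\<^sub>R (x, norm x)" "b = r' *\<^sub>R (x, norm x)" "0 \<le> r" "0 \<le> r'"
      by auto
    then show "a + b \<in> (\<lambda>r. r *\<^sub>R (x, norm x)) ` {0..}"
      by (intro image_eqI[of _ _ "r + r'"]) (auto simp: algebra_simps)
  next
    fix a and c :: real assume "a \<in> (\<lambda>r. r *\<^sub>R (x, norm x)) ` {0..}" "0 \<le> c"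
    then obtain r where "a = r *\<^sub>R (x, norm x)" "0 \<le> r" by auto
    with \<open>0 \<le> c\<close> show "c *\<^sub>R a \<in> (\<lambda>r. r *\<^sub>R (x, norm x)) ` {0..}"
      by (intro image_eqI[of _ _ "c * r"]) auto
  qed
  have s: "sublinear (norm :: 'a \<Rightarrow> real)"
    by (intro sublinearI) (auto intro: norm_triangle_ineq)
  have "c \<le> norm k" if "(k, c) \<in> D" for k c
    using that by (auto simp: D_def)
  then obtain g where g: "linear g" "\<And>y. g y \<le> norm y" "\<And>k c. (k, c) \<in> D \<Longrightarrow> c \<le> g k"
    using linear_sandwich[OF s D] by blast
  obtain f :: "'a \<Rightarrow>\<^sub>L real" where f: "blinfun_apply f = g"
    using linear_le_norm_imp_blinfun[OF g(1), of 1] g(2) by auto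
  have "(x, norm x) \<in> D"
    unfolding D_def by (rule image_eqI[of _ _ 1]) auto
  then have "norm x \<le> g x"
    by (rule g(3))
  then have "g x \<noteq> 0"
    using assms by auto
  then show thesis
    using f by (intro that[of "(1 / g x) *\<^sub>R f"]) (simp add: scaleR_blinfun.rep_eq)
qed

text \<open>The projection \<open>y \<mapsto> y - f y *\<^sub>R b\<close>, where \<open>f b = 1\<close>, removes the basis vector \<open>b\<close>.\<close>

lemma finite_rank_eq_sum:
  fixes R :: "'a::real_normed_vector \<Rightarrow>\<^sub>L 'b::real_normed_vector"
  assumes "finite_rank R"
  shows "\<exists>(n::nat) f b. \<forall>x. blinfun_apply R x = (\<Sum>i<n. blinfun_apply (f i) x *\<^sub>R b i)"
proof -
  have "\<exists>(n::nat) (f :: nat \<Rightarrow> 'a \<Rightarrow>\<^sub>L real) b. \<forall>x. blinfun_apply R x = (\<Sum>i<n. blinfun_apply (f i) x *\<^sub>R b i)"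
    if "finite B" "range (blinfun_apply R) \<subseteq> span B" for B and R :: "'a \<Rightarrow>\<^sub>L 'b"
    using that
  proof (induction "card B" arbitrary: B R rule: less_induct)
    case less
    show ?case
    proof (cases "B \<subseteq> {0}")
      case True
      then have "span B \<subseteq> {0}"
        by (metis span_0 span_insert_0 span_empty span_mono)
      with less.prems have "blinfun_apply R x = 0" for x by auto
      then show ?thesis
        by (intro exI[of _ 0]) simp
    next
      case False
      then obtain b where b: "b \<in> B" "b \<noteq> 0" by auto
      define B' where "B' = B - {b}"
      have B: "B = insert b B'" "finite B'" "card B' < card B"
        using b less.prems card_Diff1_less[of B b] by (auto simp: B'_def)
      obtain f :: "'b \<Rightarrow>\<^sub>L real" where f: "blinfun_apply f b = 1"
        using b(2) by (rule exists_blinfun_eq_1)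
      define P where "P = id_blinfun - (blinfun_scaleR_left b o\<^sub>L f)"
      have P: "blinfun_apply P y = y - blinfun_apply f y *\<^sub>R b" for y
        by (simp add: P_def blinfun.bilinear_simps)
      have card: "card (blinfun_apply P ` B') < card B"
        using B card_image_le le_less_trans by blast
      have "range (blinfun_apply (P o\<^sub>L R)) \<subseteq> blinfun_apply P ` span B"
        using less.prems by auto
      also have "\<dots> = span (blinfun_apply P ` B)"
        using linear_span_image[of "blinfun_apply P" B]
        by (simp add: blinfun.bounded_linear_right bounded_linear.linear)
      \<comment> \<open>\<open>P b = 0\<close> contributes nothing to the span. The spanning set has
        lost an element, and the induction hypothesis applies to
        \<open>P o\<^sub>L R\<close>.\<close>
      also have "\<dots> = span (blinfun_apply P ` B')"
        using B f by (simp add: P)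
      finally have r: "range (blinfun_apply (P o\<^sub>L R)) \<subseteq> span (blinfun_apply P ` B')" .
      from less.hyps[OF card finite_imageI[OF B(2)] r]
      obtain n :: nat and g :: "nat \<Rightarrow> 'a \<Rightarrow>\<^sub>L real" and c
        where g: "\<And>x. blinfun_apply (P o\<^sub>L R) x = (\<Sum>i<n. blinfun_apply (g i) x *\<^sub>R c i)"
        by blast
      show ?thesis
      proof (intro exI allI)
        fix x
        \<comment> \<open>The component removed by \<open>P\<close> returns as the term with index
          \<open>n\<close>.\<close>
        have "blinfun_apply R x = blinfun_apply (P o\<^sub>L R) x + blinfun_apply (f o\<^sub>L R) x *\<^sub>R b"
          by (simp add: P)
        also have "\<dots> = (\<Sum>i<Suc n. blinfun_apply ((g(n := f o\<^sub>L R)) i) x *\<^sub>R (c(n := b)) i)"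
          using g[of x] by simp
        finally show "blinfun_apply R x = (\<Sum>i<Suc n. blinfun_apply ((g(n := f o\<^sub>L R)) i) x *\<^sub>R (c(n := b)) i)" .
      qed
    qed
  qed
  with assms show ?thesis
    unfolding finite_rank_def by blast
qed

section \<open>Positive functionals on a Banach lattice\<close>

lemma pprt_scaleR:
  fixes x :: "'a::banach_lattice"
  assumes "0 \<le> c"
  shows "pprt (c *\<^sub>R x) = c *\<^sub>R pprt x"
proof (cases "c = 0")
  case False
  with assms have c: "0 < c" by simp
  have le: "pprt (r *\<^sub>R y) \<le> r *\<^sub>R pprt y" if "0 \<le> r" for r and y :: 'a
  proof -
    have "r *\<^sub>R y \<le> r *\<^sub>R pprt y" "0 \<le> r *\<^sub>R pprt y"
      using that by (auto intro!: scaleR_left_mono scaleR_nonneg_nonneg simp: pprt_def)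
    then show ?thesis
      unfolding pprt_def[of "r *\<^sub>R y"] by simp
  qed
  have "pprt ((1 / c) *\<^sub>R c *\<^sub>R x) \<le> (1 / c) *\<^sub>R pprt (c *\<^sub>R x)"
    using c by (intro le) simp
  then have "c *\<^sub>R pprt x \<le> c *\<^sub>R (1 / c) *\<^sub>R pprt (c *\<^sub>R x)"
    using c by (intro scaleR_left_mono) simp_all
  with le[of c x] c show ?thesis
    by (intro antisym) simp_all
qed simp

lemma norm_mono_nonneg:
  fixes x :: "'a::banach_lattice"
  assumes "0 \<le> x" "x \<le> y"
  shows "norm x \<le> norm y"
  using assms by (intro norm_mono_abs) (auto intro: order_trans)

text \<open>Sandwiching with \<open>x \<mapsto> norm f * norm (pprt x)\<close> replaces the Riesz--Kantorovich formula.\<close>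

lemma exists_dual_pos_dominating:
  fixes f :: "'x::banach_lattice \<Rightarrow>\<^sub>L real"
  obtains g where "g \<in> dual_pos" "g - f \<in> dual_pos" "norm g \<le> norm f"
proof -
  define s :: "'x \<Rightarrow> real" where "s x = norm f * norm (pprt x)" for x
  have s: "sublinear s"
  proof (rule sublinearI)
    fix x y :: 'x
    have "pprt (x + y) \<le> pprt x + pprt y"
      unfolding pprt_def[of "x + y"] by (auto intro: add_mono simp: pprt_def add_nonneg_nonneg)
    then have "norm (pprt (x + y)) \<le> norm (pprt x + pprt y)"
      by (intro norm_mono_nonneg) simp_all
    also have "\<dots> \<le> norm (pprt x) + norm (pprt y)"
      by (rule norm_triangle_ineq)
    finally show "s (x + y) \<le> s x + s y"
      unfolding s_def by (simp add: mult_left_mono flip: distrib_left)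
  qed (simp_all add: s_def pprt_scaleR)
  \<comment> \<open>The graph of \<open>f\<close> over the positive cone demands
    \<open>f z \<le> g z\<close> there, that is, positivity of \<open>g - f\<close>.\<close>
  define D where "D = (\<lambda>z. (z, blinfun_apply f z)) ` {0..}"
  have "convex_cone D"
    unfolding convex_cone_iff D_def
    by (auto simp: zero_prod_def image_iff blinfun.bilinear_simps scaleR_nonneg_nonneg)
  moreover have "c \<le> s k" if "(k, c) \<in> D" for k c
    using that norm_blinfun[of f k] by (auto simp: D_def s_def)
  ultimately obtain h where h: "linear h" "\<And>x. h x \<le> s x" "\<And>k c. (k, c) \<in> D \<Longrightarrow> c \<le> h k"
    using linear_sandwich[OF s] by blast
  have "s x \<le> norm f * norm x" for x
  proof -
    have "\<bar>pprt x\<bar> \<le> \<bar>x\<bar>"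
      by (simp add: abs_prts[of x])
    then show ?thesis
      unfolding s_def by (intro mult_left_mono norm_mono_abs) simp_all
  qed
  then have "h x \<le> norm f * norm x" for x
    using h(2) order_trans by blast
  then obtain g where g: "blinfun_apply g = h" "norm g \<le> norm f"
    using linear_le_norm_imp_blinfun[OF h(1)] by (metis norm_ge_zero)
  \<comment> \<open>The positive part of \<open>- x\<close> is 0, so \<open>s (- x) = 0\<close>:
    domination by \<open>s\<close> already contains positivity.\<close>
  have "0 \<le> h x" if "0 \<le> x" for x
    using h(2)[of "- x"] that linear_neg[OF h(1), of x] by (simp add: s_def)
  then have "g \<in> dual_pos"
    by (simp add: dual_pos_def dual_cone_def g)
  moreover have "g - f \<in> dual_pos"
    using h(3) by (auto simp: dual_pos_def dual_cone_def g D_def blinfun.bilinear_simps)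
  ultimately show thesis
    using g(2) by (rule that)
qed

section \<open>Positive local reflexivity\<close>

lemma norm_le_lp_norm_fin_seq:
  assumes "1 \<le> p" "j < n"
  shows "norm (a j) \<le> lp_norm p (fin_seq n a)"
proof (cases p)
  case top
  with assms show ?thesis by (simp add: norm_le_lp_norm_fin_seq_infty)
next
  case (real r)
  with assms have r: "1 \<le> r"
    by (metis ennreal_1 ennreal_le_iff)
  have "(norm (a j) powr r) powr (1 / r) \<le> (\<Sum>j<n. norm (a j) powr r) powr (1 / r)"
    using r assms(2) by (intro powr_mono2 member_le_sum) auto
  with real r show ?thesis
    by (simp add: lp_norm_fin_seq_real powr_powr)
qed

text \<open>Coordinates are rounded towards zero onto a grid of mesh \<open>1 / N\<close>. This
  decreases every modulus, so the rounded point stays in the unit ball by monotonicity of the norm;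
  and since coordinates in the ball are at most 1 in modulus, finitely many grid points
  suffice.\<close>

lemma lp_unit_ball_net:
  assumes p: "1 \<le> p" and N: "0 < (N::nat)"
  obtains G where "finite G" "\<And>g. g \<in> G \<Longrightarrow> lp_norm p (fin_seq n g) \<le> 1"
    "\<And>a :: nat \<Rightarrow> real. lp_norm p (fin_seq n a) \<le> 1 \<Longrightarrow> \<exists>g\<in>G. \<forall>j<n. \<bar>a j - g j\<bar> \<le> 1 / N"
proof -
  define I where "I = {..<n} \<rightarrow>\<^sub>E {- int N..int N}"
  define G where "G = {g \<in> (\<lambda>k j. real_of_int (k j) / N) ` I. lp_norm p (fin_seq n g) \<le> 1}"
  have "finite I"
    unfolding I_def by (rule finite_PiE) auto
  then have "finite G"
    by (rule finite_subset[OF _ finite_imageI, rotated]) (auto simp: G_def)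
  moreover have "\<exists>g\<in>G. \<forall>j<n. \<bar>a j - g j\<bar> \<le> 1 / N" if a: "lp_norm p (fin_seq n a) \<le> 1" for a :: "nat \<Rightarrow> real"
  proof -
    define t where "t x = (if 0 \<le> x then \<lfloor>x\<rfloor> else \<lceil>x\<rceil>)" for x :: real
    have t1: "\<bar>real_of_int (t x)\<bar> \<le> \<bar>x\<bar>" for x
      unfolding t_def by (auto; linarith)
    have t2: "\<bar>x - t x\<bar> \<le> 1" for x
      unfolding t_def abs_le_iff by (cases "0 \<le> x") (simp_all, linarith+)
    note t = t1 t2
    \<comment> \<open>Restriction to \<open>{..<n}\<close> makes \<open>k\<close> a member of the
      extensional product \<open>I\<close>, which is finite.\<close>
    define k where "k = (\<lambda>j\<in>{..<n}. t (a j * N))"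
    define g where "g j = real_of_int (k j) / N" for j
    have le: "\<bar>g j\<bar> \<le> \<bar>a j\<bar>" "\<bar>a j - g j\<bar> \<le> 1 / N" if "j < n" for j
    proof -
      have g: "g j = t (a j * N) / N"
        using that by (simp add: g_def k_def)
      show "\<bar>g j\<bar> \<le> \<bar>a j\<bar>"
        using t(1)[of "a j * N"] N by (simp add: g divide_le_eq abs_mult)
      have "a j - g j = (a j * N - t (a j * N)) / N"
        using N by (simp add: g field_simps)
      then show "\<bar>a j - g j\<bar> \<le> 1 / N"
        using t(2)[of "a j * N"] N by (simp add: divide_right_mono)
    qed
    have "k \<in> I"
      unfolding I_def
    proof (rule PiE_I)
      fix j assume j: "j \<in> {..<n}"
      have "\<bar>a j\<bar> \<le> 1"
        using norm_le_lp_norm_fin_seq[OF p, of j n a] a j by simp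
      then have "\<bar>a j * N\<bar> \<le> N"
        by (simp add: abs_mult mult_left_le_one_le)
      then have "\<bar>real_of_int (t (a j * N))\<bar> \<le> N"
        using t(1) order_trans by blast
      then show "k j \<in> {- int N..int N}"
        using j by (simp add: k_def abs_le_iff)
    qed (simp add: k_def)
    moreover have "lp_norm p (fin_seq n g) \<le> 1"
      using lp_norm_fin_seq_mono[of n g a p] le(1) a by fastforce
    ultimately have "g \<in> G"
      unfolding G_def g_def by auto
    with le(2) show ?thesis by blast
  qed
  ultimately show thesis
    by (intro that[of G]) (auto simp: G_def)
qed

lemma weak_lp_norm_fin_seqI:
  fixes x :: "nat \<Rightarrow> 'a::real_normed_vector"
  assumes "\<And>h :: 'a \<Rightarrow>\<^sub>L real. norm h \<le> 1 \<Longrightarrow> lp_norm p (fin_seq n (\<lambda>j. blinfun_apply h (x j))) \<le> C"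
  shows "weak_lp_norm p (fin_seq n x) \<le> C"
  unfolding weak_lp_norm_def
proof (rule cSUP_least)
  show "{h :: 'a \<Rightarrow>\<^sub>L real. norm h \<le> 1} \<noteq> {}"
    by (auto intro: exI[of _ 0])
qed (use assms in \<open>simp add: blinfun_apply_fin_seq\<close>)

lemma lp_norm_fin_seq_le_weak_lp_norm:
  fixes x :: "nat \<Rightarrow> 'a::real_normed_vector" and h :: "'a \<Rightarrow>\<^sub>L real"
  assumes "1 \<le> p"
  shows "lp_norm p (fin_seq n (\<lambda>j. blinfun_apply h (x j))) \<le> weak_lp_norm p (fin_seq n x) * norm h"
  using lp_norm_le_weak_lp_norm[OF assms fin_seq_in_weak_lp_seq[of n x], of h]
  by (simp add: blinfun_apply_fin_seq)

text \<open>Moving from an optimal coefficient vector to a net point costs at most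
  \<open>\<epsilon> * W\<close> per coordinate, where \<open>W\<close> is the weak norm being
  estimated. The loss is absorbed on the left, whence the factor
  \<open>1 - n * \<epsilon>\<close>.\<close>

lemma weak_lp_norm_net_le:
  fixes x :: "nat \<Rightarrow> 'a::real_normed_vector"
  assumes p: "1 \<le> p"
    and net: "\<And>a :: nat \<Rightarrow> real. lp_norm p (fin_seq n a) \<le> 1 \<Longrightarrow> \<exists>g\<in>G. \<forall>j<n. \<bar>a j - g j\<bar> \<le> \<epsilon>"
    and le: "\<And>g. g \<in> G \<Longrightarrow> norm (\<Sum>j<n. g j *\<^sub>R x j) \<le> B"
  shows "(1 - n * \<epsilon>) * weak_lp_norm (conj_exp p) (fin_seq n x) \<le> B"
proof -
  define q where "q = conj_exp p"
  have q: "1 \<le> q"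
    using p by (simp add: q_def conj_exp_ge_1)
  define W where "W = weak_lp_norm q (fin_seq n x)"
  have "W \<le> B + n * \<epsilon> * W"
    unfolding W_def
  proof (rule weak_lp_norm_fin_seqI, fold W_def)
    fix h :: "'a \<Rightarrow>\<^sub>L real" assume h: "norm h \<le> 1"
    obtain a :: "nat \<Rightarrow> real" where a: "lp_norm p (fin_seq n a) \<le> 1"
        "(\<Sum>j<n. a j * blinfun_apply h (x j)) = lp_norm q (fin_seq n (\<lambda>j. blinfun_apply h (x j)))"
      using lp_norm_fin_seq_attained[OF p, of n "\<lambda>j. blinfun_apply h (x j)"] q_def by blast
    obtain g where g: "g \<in> G" "\<And>j. j < n \<Longrightarrow> \<bar>a j - g j\<bar> \<le> \<epsilon>"
      using net[OF a(1)] by blast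
    have "0 \<le> W"
      unfolding W_def using q by (intro weak_lp_norm_nonneg fin_seq_in_weak_lp_seq)
    have "(\<Sum>j<n. g j * blinfun_apply h (x j)) = blinfun_apply h (\<Sum>j<n. g j *\<^sub>R x j)"
      by (simp add: blinfun.bilinear_simps)
    also have "\<dots> \<le> norm h * norm (\<Sum>j<n. g j *\<^sub>R x j)"
      using norm_blinfun[of h "\<Sum>j<n. g j *\<^sub>R x j"] by simp
    also have "\<dots> \<le> 1 * B"
      using h le[OF g(1)] by (intro mult_mono) (auto intro: order_trans[OF norm_ge_zero])
    finally have 1: "(\<Sum>j<n. g j * blinfun_apply h (x j)) \<le> B" by simp
    have "(a j - g j) * blinfun_apply h (x j) \<le> \<epsilon> * W" if "j < n" for j
    proof -
      have "\<bar>blinfun_apply h (x j)\<bar> \<le> lp_norm q (fin_seq n (\<lambda>j. blinfun_apply h (x j)))"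
        using norm_le_lp_norm_fin_seq[OF q that, of "\<lambda>j. blinfun_apply h (x j)"] by simp
      also have "\<dots> \<le> W * norm h"
        unfolding W_def using q by (rule lp_norm_fin_seq_le_weak_lp_norm)
      also have "\<dots> \<le> W"
        using h \<open>0 \<le> W\<close> by (simp add: mult_left_le)
      finally have "\<bar>a j - g j\<bar> * \<bar>blinfun_apply h (x j)\<bar> \<le> \<epsilon> * W"
        using g(2)[OF that] by (intro mult_mono) auto
      then show ?thesis
        by (simp flip: abs_mult)
    qed
    then have "(\<Sum>j<n. (a j - g j) * blinfun_apply h (x j)) \<le> (\<Sum>j<n. \<epsilon> * W)"
      by (intro sum_mono) simp
    with 1 a(2) show "lp_norm q (fin_seq n (\<lambda>j. blinfun_apply h (x j))) \<le> B + n * \<epsilon> * W"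
      by (simp add: sum_subtractf left_diff_distrib mult.assoc)
  qed
  then show ?thesis
    by (simp add: W_def q_def algebra_simps)
qed

text \<open>Stands in for a norming vector, which may fail to exist.\<close>

lemma blinfun_norm_approx:
  fixes f :: "'a::real_normed_vector \<Rightarrow>\<^sub>L real"
  assumes "0 < \<delta>"
  obtains x where "norm x \<le> 1" "norm f - \<delta> \<le> blinfun_apply f x"
proof (rule ccontr)
  assume "\<not> thesis"
  with that have lt: "blinfun_apply f x < norm f - \<delta>" if "norm x \<le> 1" for x
    using \<open>norm x \<le> 1\<close> by force
  have "norm f \<le> norm f - \<delta>"
  proof (rule norm_blinfun_bound)
    show "0 \<le> norm f - \<delta>"
      using lt[of 0] by simp
    fix x
    show "norm (blinfun_apply f x) \<le> (norm f - \<delta>) * norm x"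
    proof (cases "x = 0")
      case False
      have "\<bar>blinfun_apply f ((1 / norm x) *\<^sub>R x)\<bar> \<le> norm f - \<delta>"
        using lt[of "(1 / norm x) *\<^sub>R x"] lt[of "- (1 / norm x) *\<^sub>R x"] False
        by (simp add: blinfun.bilinear_simps)
      with False show ?thesis
        by (simp add: blinfun.bilinear_simps divide_le_eq)
    qed simp
  qed
  with assms show False by simp
qed

lemma apply_bcontfun_sum:
  "apply_bcontfun (\<Sum>i\<in>A. f i) x = (\<Sum>i\<in>A. apply_bcontfun (f i) x)"
  by (induction A rule: infinite_finite_induct) auto

text \<open>
  Sandwiching on \<open>m\<close>-tuples with the supremum norm yields functionals \<open>\<phi> k\<close> with
  \<open>(\<Sum>k<m. norm (\<phi> k)) \<le> M\<close> such that \<open>\<Sum>k<m. a k j *\<^sub>R \<phi> k\<close> dominates \<open>y j\<close> on \<open>K\<close>.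
\<close>

lemma dominated_on_bidual_cone:
  fixes K :: "'a::real_normed_vector set" and a :: "nat \<Rightarrow> nat \<Rightarrow> real" and y :: "nat \<Rightarrow> 'a \<Rightarrow>\<^sub>L real"
    and f :: "nat \<Rightarrow> ('a \<Rightarrow>\<^sub>L real) \<Rightarrow>\<^sub>L real"
  assumes K: "convex_cone K" and M: "0 \<le> M"
    and le: "\<And>x B. (\<And>j. x j \<in> K) \<Longrightarrow> 0 \<le> B \<Longrightarrow> (\<And>k. k < m \<Longrightarrow> norm (\<Sum>j<n. a k j *\<^sub>R x j) \<le> B) \<Longrightarrow>
      (\<Sum>j<n. blinfun_apply (y j) (x j)) \<le> M * B"
    and f: "\<And>j. j < n \<Longrightarrow> f j \<in> dual_cone (dual_cone K)"
    and W: "\<And>k. k < m \<Longrightarrow> norm (\<Sum>j<n. a k j *\<^sub>R f j) \<le> W" "0 \<le> W"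
  shows "(\<Sum>j<n. blinfun_apply (f j) (y j)) \<le> M * W"
proof -
  \<comment> \<open>A sequence vanishing from \<open>m\<close> on stands for an
    \<open>m\<close>-tuple; bounded continuous functions on the discrete space \<open>nat\<close>
    supply the supremum norm.\<close>
  define tup :: "(nat \<Rightarrow> 'a) \<Rightarrow> nat \<Rightarrow>\<^sub>C 'a" where "tup w = Bcontfun (\<lambda>k. if k < m then w k else 0)" for w
  have tup: "apply_bcontfun (tup w) k = (if k < m then w k else 0)" for w k
  proof -
    have "range (\<lambda>k. if k < m then w k else 0) \<subseteq> insert 0 (w ` {..<m})"
      by auto
    then have "bounded (range (\<lambda>k. if k < m then w k else 0))"
      by (rule bounded_subset[rotated]) (simp add: finite_imp_bounded)
    then have "(\<lambda>k. if k < m then w k else 0) \<in> bcontfun"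
      by (simp add: bcontfun_def)
    then show ?thesis
      by (simp add: tup_def Bcontfun_inverse)
  qed
  have tup_add: "tup (\<lambda>k. w k + w' k) = tup w + tup w'" for w w'
    by (rule bcontfun_eqI) (simp add: tup)
  have tup_scaleR: "tup (\<lambda>k. c *\<^sub>R w k) = c *\<^sub>R tup w" for c w
    by (rule bcontfun_eqI) (simp add: tup)
  have norm_tup: "norm (tup w) \<le> B" if "\<And>k. k < m \<Longrightarrow> norm (w k) \<le> B" "0 \<le> B" for w B
    using that by (intro norm_bound) (auto simp: tup)
  define A where "A x = tup (\<lambda>k. \<Sum>j<n. a k j *\<^sub>R x j)" for x
  define L where "L x = (\<Sum>j<n. blinfun_apply (y j) (x j))" for x
  have A_add: "A (\<lambda>j. x j + x' j) = A x + A x'" for x x'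
    by (simp add: A_def scaleR_right_distrib sum.distrib flip: tup_add)
  have A_scaleR: "A (\<lambda>j. c *\<^sub>R x j) = c *\<^sub>R A x" for c x
    by (simp add: A_def scaleR_sum_right mult.commute flip: tup_scaleR)
  have L_add: "L (\<lambda>j. x j + x' j) = L x + L x'" for x x'
    by (simp add: L_def blinfun.bilinear_simps sum.distrib)
  have L_scaleR: "L (\<lambda>j. c *\<^sub>R x j) = c *\<^sub>R L x" for c x
    by (simp add: L_def blinfun.bilinear_simps sum_distrib_left)
  \<comment> \<open>Each family \<open>x\<close> in \<open>K\<close> demands a value of at least
    \<open>L x\<close> at the tuple \<open>A x\<close> of its combinations. The assumption
    \<open>le\<close> makes these demands compatible with the upper bound
    \<open>M * norm w\<close>.\<close>
  define D where "D = (\<lambda>x. (A x, L x)) ` {x. \<forall>j. x j \<in> K}"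
  have "convex_cone D"
    unfolding convex_cone_iff
  proof (intro conjI ballI allI impI)
    have "(A (\<lambda>_. 0), L (\<lambda>_. 0)) = 0"
      using A_scaleR[of 0 "\<lambda>_. 0"] L_scaleR[of 0 "\<lambda>_. 0"] by (simp add: zero_prod_def)
    moreover have "(\<lambda>_. 0) \<in> {x :: nat \<Rightarrow> 'a. \<forall>j. x j \<in> K}"
      using convex_cone_contains_0[OF K] by simp
    ultimately show "0 \<in> D"
      unfolding D_def by (metis (no_types, lifting) image_eqI)
  next
    fix d d' assume "d \<in> D" "d' \<in> D"
    then obtain x x' where "d = (A x, L x)" "d' = (A x', L x')" "\<forall>j. x j \<in> K" "\<forall>j. x' j \<in> K"
      by (auto simp: D_def)
    then show "d + d' \<in> D"
      unfolding D_def using convex_cone_add[OF K]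
      by (intro image_eqI[of _ _ "\<lambda>j. x j + x' j"]) (auto simp: A_add L_add)
  next
    fix d and c :: real assume "d \<in> D" "0 \<le> c"
    then obtain x where "d = (A x, L x)" "\<forall>j. x j \<in> K"
      by (auto simp: D_def)
    then show "c *\<^sub>R d \<in> D"
      unfolding D_def using convex_cone_scaleR[OF K \<open>0 \<le> c\<close>]
      by (intro image_eqI[of _ _ "\<lambda>j. c *\<^sub>R x j"]) (auto simp: A_scaleR L_scaleR)
  qed
  moreover have "sublinear (\<lambda>w :: nat \<Rightarrow>\<^sub>C 'a. M * norm w)"
  proof (rule sublinearI)
    fix w w' :: "nat \<Rightarrow>\<^sub>C 'a"
    show "M * norm (w + w') \<le> M * norm w + M * norm w'"
      using norm_triangle_ineq[of w w'] M by (simp add: mult_left_mono flip: distrib_left)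
  qed auto
  moreover have "c \<le> M * norm d" if dc: "(d, c) \<in> D" for d c
  proof -
    obtain x where x: "d = A x" "c = L x" "\<And>j. x j \<in> K"
      using dc by (auto simp: D_def)
    have "norm (\<Sum>j<n. a k j *\<^sub>R x j) \<le> norm (A x)" if "k < m" for k
      using norm_bounded[of "A x" k] that by (simp add: A_def tup)
    then show ?thesis
      using le[of x "norm (A x)"] x by (simp add: L_def)
  qed
  ultimately obtain \<psi> where \<psi>: "linear \<psi>" "\<And>w. \<psi> w \<le> M * norm w" "\<And>k c. (k, c) \<in> D \<Longrightarrow> c \<le> \<psi> k"
    using linear_sandwich[of "\<lambda>w :: nat \<Rightarrow>\<^sub>C 'a. M * norm w" D] by blast
  \<comment> \<open>Coordinate inclusions; composing \<open>\<psi>\<close> with them gives its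
    components \<open>\<phi> k\<close>.\<close>
  define single where "single k v = tup (\<lambda>i. if i = k then v else 0)" for k v
  have "\<exists>\<phi>. blinfun_apply \<phi> = (\<lambda>v. \<psi> (single k v))" for k
  proof -
    have "linear (\<lambda>v. \<psi> (single k v))"
    proof (rule linearI)
      fix v v' :: 'a and c :: real
      have "single k (v + v') = single k v + single k v'" "single k (c *\<^sub>R v) = c *\<^sub>R single k v"
        unfolding single_def by (auto simp: tup intro!: bcontfun_eqI)
      then show "\<psi> (single k (v + v')) = \<psi> (single k v) + \<psi> (single k v')"
        "\<psi> (single k (c *\<^sub>R v)) = c *\<^sub>R \<psi> (single k v)"
        using \<psi>(1) by (simp_all add: linear_add linear_scale)
    qed
    moreover have "\<psi> (single k v) \<le> M * norm v" for v
    proof -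
      have "norm (single k v) \<le> norm v"
        unfolding single_def by (intro norm_tup) auto
      with \<psi>(2)[of "single k v"] M show ?thesis
        by (meson mult_left_mono order_trans)
    qed
    ultimately show ?thesis
      using linear_le_norm_imp_blinfun M by metis
  qed
  then obtain \<phi> where \<phi>: "\<And>k. blinfun_apply (\<phi> k) = (\<lambda>v. \<psi> (single k v))"
    by metis
  have \<psi>_tup: "\<psi> (tup w) = (\<Sum>k<m. blinfun_apply (\<phi> k) (w k))" for w
  proof -
    have "tup w = (\<Sum>k<m. single k (w k))"
      by (rule bcontfun_eqI) (simp add: apply_bcontfun_sum single_def tup)
    then show ?thesis
      using \<psi>(1) by (simp add: \<phi> linear_sum)
  qed
  \<comment> \<open>The supremum norm has the sum norm as its dual: near-maximizers for all
    components are assembled into one tuple of norm at most 1.\<close>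
  have "(\<Sum>k<m. norm (\<phi> k)) \<le> M"
  proof (rule field_le_epsilon)
    fix \<epsilon> :: real assume \<epsilon>: "0 < \<epsilon>"
    \<comment> \<open>\<open>m\<close> errors of size \<open>\<delta>\<close> stay below
      \<open>\<epsilon>\<close>; the added 1 covers \<open>m = 0\<close>.\<close>
    define \<delta> where "\<delta> = \<epsilon> / (real m + 1)"
    have "0 < \<delta>" using \<epsilon> by (simp add: \<delta>_def)
    then have "\<exists>v. norm v \<le> 1 \<and> norm (\<phi> k) - \<delta> \<le> blinfun_apply (\<phi> k) v" for k
      using blinfun_norm_approx by blast
    then obtain w where w: "\<And>k. norm (w k) \<le> 1" "\<And>k. norm (\<phi> k) - \<delta> \<le> blinfun_apply (\<phi> k) (w k)"
      by metis
    have "(\<Sum>k<m. norm (\<phi> k) - \<delta>) \<le> \<psi> (tup w)"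
      unfolding \<psi>_tup using w(2) by (rule sum_mono)
    also have "\<dots> \<le> M * norm (tup w)"
      by (rule \<psi>(2))
    also have "\<dots> \<le> M"
      using norm_tup[of w 1] w(1) M by (simp add: mult_left_le)
    finally have "(\<Sum>k<m. norm (\<phi> k)) \<le> M + m * \<delta>"
      by (simp add: sum_subtractf)
    moreover have "m * \<delta> \<le> \<epsilon>"
      using \<epsilon> by (simp add: \<delta>_def field_simps)
    ultimately show "(\<Sum>k<m. norm (\<phi> k)) \<le> M + \<epsilon>" by linarith
  qed
  define h where "h k = (\<Sum>j<n. a k j *\<^sub>R f j)" for k
  have "blinfun_apply (f j) (y j) \<le> (\<Sum>k<m. a k j * blinfun_apply (f j) (\<phi> k))" if j: "j < n" for j
  proof -
    have "(\<Sum>k<m. a k j *\<^sub>R \<phi> k) - y j \<in> dual_cone K"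
      unfolding dual_cone_def
    proof safe
      fix z assume "z \<in> K"
      \<comment> \<open>A family with a single nonzero member isolates the contribution of index
        \<open>j\<close>.\<close>
      define x where "x i = (if i = j then z else 0)" for i
      have "\<forall>j. x j \<in> K"
        using \<open>z \<in> K\<close> convex_cone_contains_0[OF K] by (simp add: x_def)
      then have "L x \<le> \<psi> (A x)"
        by (intro \<psi>(3)) (auto simp: D_def)
      moreover have "L x = blinfun_apply (y j) z"
        using j by (simp add: L_def x_def if_distrib cong: if_cong)
      moreover have "(\<Sum>j<n. a k j *\<^sub>R x j) = a k j *\<^sub>R z" for k
        using j by (simp add: x_def if_distrib cong: if_cong)
      then have "\<psi> (A x) = (\<Sum>k<m. a k j * blinfun_apply (\<phi> k) z)"
        by (simp add: A_def \<psi>_tup blinfun.bilinear_simps)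
      ultimately show "0 \<le> blinfun_apply ((\<Sum>k<m. a k j *\<^sub>R \<phi> k) - y j) z"
        by (simp add: blinfun.bilinear_simps)
    qed
    \<comment> \<open>The passage to the bidual: domination on \<open>K\<close> says that a certain
      functional lies in \<open>dual_cone K\<close>, and that is exactly where \<open>f j\<close> is
      nonnegative.\<close>
    then have "0 \<le> blinfun_apply (f j) ((\<Sum>k<m. a k j *\<^sub>R \<phi> k) - y j)"
      using f[OF j] by (simp add: dual_cone_def)
    then show ?thesis
      by (simp add: blinfun.bilinear_simps)
  qed
  then have "(\<Sum>j<n. blinfun_apply (f j) (y j)) \<le> (\<Sum>j<n. \<Sum>k<m. a k j * blinfun_apply (f j) (\<phi> k))"
    by (intro sum_mono) simp
  also have "\<dots> = (\<Sum>k<m. blinfun_apply (h k) (\<phi> k))"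
    by (subst sum.swap) (simp add: h_def blinfun.bilinear_simps)
  also have "\<dots> \<le> (\<Sum>k<m. W * norm (\<phi> k))"
  proof (rule sum_mono)
    fix k assume "k \<in> {..<m}"
    have "blinfun_apply (h k) (\<phi> k) \<le> norm (h k) * norm (\<phi> k)"
      using norm_blinfun[of "h k" "\<phi> k"] by simp
    also have "\<dots> \<le> W * norm (\<phi> k)"
      using W(1)[of k] \<open>k \<in> {..<m}\<close> by (intro mult_right_mono) (auto simp: h_def)
    finally show "blinfun_apply (h k) (\<phi> k) \<le> W * norm (\<phi> k)" .
  qed
  also have "\<dots> \<le> M * W"
    using \<open>(\<Sum>k<m. norm (\<phi> k)) \<le> M\<close> W(2)
    using mult_left_mono[of _ M W] by (simp add: mult.commute[of M] flip: sum_distrib_left)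
  finally show ?thesis .
qed

text \<open>A positive form of the principle of local reflexivity for families in the bidual.\<close>

theorem weak_lp_dominated_on_bidual_cone:
  fixes K :: "'a::real_normed_vector set" and y :: "nat \<Rightarrow> 'a \<Rightarrow>\<^sub>L real"
    and f :: "nat \<Rightarrow> ('a \<Rightarrow>\<^sub>L real) \<Rightarrow>\<^sub>L real"
  assumes q: "1 \<le> q" and K: "convex_cone K" and M: "0 \<le> M"
    and le: "\<And>x. (\<And>j. x j \<in> K) \<Longrightarrow> (\<Sum>j<n. blinfun_apply (y j) (x j)) \<le> M * weak_lp_norm q (fin_seq n x)"
    and f: "\<And>j. j < n \<Longrightarrow> f j \<in> dual_cone (dual_cone K)"
  shows "(\<Sum>j<n. blinfun_apply (f j) (y j)) \<le> M * weak_lp_norm q (fin_seq n f)"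
proof -
  define p where "p = conj_exp q"
  have p: "1 \<le> p" "conj_exp p = q"
    using q by (simp_all add: p_def conj_exp_ge_1 conj_exp_conj_exp)
  define W where "W = weak_lp_norm q (fin_seq n f)"
  have "0 \<le> W"
    unfolding W_def using q by (intro weak_lp_norm_nonneg fin_seq_in_weak_lp_seq)
  define F where "F = (\<Sum>j<n. blinfun_apply (f j) (y j))"
  \<comment> \<open>A net of mesh \<open>1 / N\<close> loses the factor \<open>1 - n / N\<close>,
    positive since \<open>n < N\<close>; letting \<open>N\<close> grow recovers the constant
    \<open>M\<close>.\<close>
  have bound: "(1 - n * (1 / N)) * F \<le> M * W" if N: "n < N" for N :: nat
  proof -
    define c where "c = 1 - n * (1 / N)"
    have c: "0 < c"
      using N by (simp add: c_def)
    obtain G where G: "finite G" "\<And>g. g \<in> G \<Longrightarrow> lp_norm p (fin_seq n g) \<le> 1"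
      "\<And>a :: nat \<Rightarrow> real. lp_norm p (fin_seq n a) \<le> 1 \<Longrightarrow> \<exists>g\<in>G. \<forall>j<n. \<bar>a j - g j\<bar> \<le> 1 / N"
      using lp_unit_ball_net[OF p(1), of N n] N by auto
    obtain a where "bij_betw a {0..<card G} G"
      using ex_bij_betw_nat_finite[OF G(1)] by blast
    then have a: "G = a ` {..<card G}"
      by (simp add: bij_betw_def atLeast0LessThan)
    have "F \<le> M / c * W"
      unfolding F_def
    proof (rule dominated_on_bidual_cone[OF K, where m = "card G" and a = a])
      fix x B assume x: "\<And>j. x j \<in> K" and B: "\<And>k. k < card G \<Longrightarrow> norm (\<Sum>j<n. a k j *\<^sub>R x j) \<le> B"
      have "norm (\<Sum>j<n. g j *\<^sub>R x j) \<le> B" if "g \<in> G" for g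
        using that B by (subst (asm) a) auto
      then have "c * weak_lp_norm q (fin_seq n x) \<le> B"
        using weak_lp_norm_net_le[OF p(1) G(3), of x B] by (simp add: p(2) c_def)
      then have "M * weak_lp_norm q (fin_seq n x) \<le> M * (B / c)"
        using c M by (intro mult_left_mono) (auto simp: le_divide_eq mult.commute)
      with le[of x, OF x] show "(\<Sum>j<n. blinfun_apply (y j) (x j)) \<le> M / c * B"
        by simp
    next
      fix k assume "k < card G"
      then have ak: "lp_norm p (fin_seq n (a k)) \<le> 1"
        using G(2) a by auto
      \<comment> \<open>A norm in the bidual is tested on functionals \<open>\<phi>\<close>, which
        act on the \<open>f j\<close> through \<open>bidual_embed \<phi>\<close>, and these are
        among the functionals measured by \<open>W\<close>.\<close>
      show "norm (\<Sum>j<n. a k j *\<^sub>R f j) \<le> W"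
      proof (rule norm_blinfun_bound[OF \<open>0 \<le> W\<close>])
        fix \<phi>
        have "norm (blinfun_apply (\<Sum>j<n. a k j *\<^sub>R f j) \<phi>)
            = \<bar>\<Sum>j<n. a k j * fin_seq n (\<lambda>j. blinfun_apply (f j) \<phi>) j\<bar>"
          by (simp add: blinfun.bilinear_simps fin_seq_def)
        also have "\<dots> \<le> lp_norm q (fin_seq n (\<lambda>j. blinfun_apply (f j) \<phi>))"
          using abs_sum_mult_le_lp_norm[OF p(1) _ ak] by (simp add: p(2) fin_seq_in_lp_seq)
        also have "\<dots> \<le> W * norm (bidual_embed \<phi>)"
          using lp_norm_fin_seq_le_weak_lp_norm[OF q, of n "bidual_embed \<phi>" f] by (simp add: W_def)
        also have "\<dots> \<le> W * norm \<phi>"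
          using \<open>0 \<le> W\<close> norm_bidual_embed_le by (rule mult_left_mono[rotated])
        finally show "norm (blinfun_apply (\<Sum>j<n. a k j *\<^sub>R f j) \<phi>) \<le> W * norm \<phi>" .
      qed
    qed (use M c f \<open>0 \<le> W\<close> in auto)
    then have "c * F \<le> M * W"
      using c by (simp add: le_divide_eq mult.commute)
    then show ?thesis
      by (simp add: c_def)
  qed
  have "(\<lambda>N. (1 - n * (1 / real N)) * F) \<longlonglongrightarrow> (1 - real n * 0) * F"
    by (intro tendsto_intros lim_1_over_n)
  then have "F \<le> M * W"
    using bound by (intro LIMSEQ_le_const2[of _ F]) (auto intro!: exI[of _ "Suc n"])
  then show ?thesis
    by (simp add: F_def W_def)
qed

section \<open>Positively nuclear operators\<close>

lemma Hoelder_lp_seq: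
  assumes "1 \<le> p" "a \<in> lp_seq p" "b \<in> lp_seq (conj_exp p)"
  shows "(\<Sum>j<n. norm (a j) * norm (b j)) \<le> lp_norm p a * lp_norm (conj_exp p) b"
proof -
  have "(\<Sum>j<n. norm (a j) * norm (b j)) \<le> lp_norm p (fin_seq n a) * lp_norm (conj_exp p) (fin_seq n b)"
    using assms(1) by (rule Hoelder_fin_seq)
  also have "\<dots> \<le> lp_norm p a * lp_norm (conj_exp p) b"
    using assms by (intro mult_mono lp_norm_fin_seq_le lp_norm_fin_seq_nonneg lp_norm_nonneg conj_exp_ge_1)
  finally show ?thesis .
qed

section \<open>Sums, multiples and tails of representations\<close>

text \<open>Alternating the terms keeps \<open>nat\<close> as index set. Each series is spread out
  with zeros, which does not change its sum, and the two are added.\<close>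

lemma sums_interleave:
  fixes a b :: "nat \<Rightarrow> 'a::real_normed_vector"
  assumes "a sums A" "b sums B"
  shows "(\<lambda>n. if even n then a (n div 2) else b (n div 2)) sums (A + B)"
proof -
  have a: "(\<lambda>n. if even n then a (n div 2) else 0) sums A"
  proof (subst sums_mono_reindex[of "\<lambda>n. 2 * n", symmetric])
    show "strict_mono (\<lambda>n::nat. 2 * n)"
      by (simp add: strict_mono_def)
  qed (use assms(1) in \<open>auto elim!: evenE\<close>)
  have b: "(\<lambda>n. if even n then 0 else b (n div 2)) sums B"
  proof (subst sums_mono_reindex[of "\<lambda>n. 2 * n + 1", symmetric])
    show "strict_mono (\<lambda>n::nat. 2 * n + 1)"
      by (simp add: strict_mono_def)
  qed (use assms(2) in \<open>auto elim!: oddE\<close>)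
  have "(\<lambda>n. (if even n then a (n div 2) else 0) + (if even n then 0 else b (n div 2))) sums (A + B)"
    using a b by (rule sums_add)
  moreover have "(\<lambda>n. (if even n then a (n div 2) else 0) + (if even n then 0 else b (n div 2)))
      = (\<lambda>n. if even n then a (n div 2) else b (n div 2))"
    by auto
  ultimately show ?thesis by simp
qed

lemma lp_seq_interleave:
  assumes "u \<in> lp_seq p" "v \<in> lp_seq p"
  shows "(\<lambda>n. if even n then u (n div 2) else v (n div 2)) \<in> lp_seq p"
proof (cases "p = \<infinity>")
  case True
  have "range (\<lambda>n. if even n then u (n div 2) else v (n div 2)) \<subseteq> range u \<union> range v"
    by auto
  then have "bounded (range (\<lambda>n. if even n then u (n div 2) else v (n div 2)))"
    by (rule bounded_subset[rotated]) (use assms True in \<open>simp add: lp_seq_def\<close>)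
  with True show ?thesis by (simp add: lp_seq_def)
next
  case False
  then have "summable (\<lambda>n. norm (u n) powr enn2real p)" "summable (\<lambda>n. norm (v n) powr enn2real p)"
    using assms by (auto simp: lp_seq_def)
  from sums_summable[OF sums_interleave[OF this[THEN summable_sums]]]
  have "summable (\<lambda>n. norm (if even n then u (n div 2) else v (n div 2)) powr enn2real p)"
    by (simp add: if_distrib[of norm] if_distrib[of "\<lambda>x. x powr _"])
  with False show ?thesis by (simp add: lp_seq_def)
qed

lemma tendsto_interleave:
  assumes "u \<longlonglongrightarrow> l" "v \<longlonglongrightarrow> l"
  shows "(\<lambda>n. if even n then u (n div 2) else v (n div 2)) \<longlonglongrightarrow> l"
proof -
  have "filterlim (\<lambda>n::nat. n div 2) sequentially sequentially"
    unfolding filterlim_at_top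
  proof
    fix Z :: nat
    show "\<forall>\<^sub>F n in sequentially. Z \<le> n div 2"
      using eventually_ge_at_top[of "2 * Z"] by eventually_elim simp
  qed
  then have "(\<lambda>n. u (n div 2)) \<longlonglongrightarrow> l" "(\<lambda>n. v (n div 2)) \<longlonglongrightarrow> l"
    using assms by (auto intro: filterlim_compose)
  then show ?thesis
    by (intro filterlim_If) (auto intro: tendsto_mono[OF inf_le1])
qed

abbreviation tensor :: "('x::real_normed_vector \<Rightarrow>\<^sub>L real) \<Rightarrow> 'e::real_normed_vector \<Rightarrow> 'x \<Rightarrow>\<^sub>L 'e" where
  "tensor f u \<equiv> blinfun_scaleR_left u o\<^sub>L f"

lemma convex_cone_dual_cone: "convex_cone (dual_cone K)"
  by (auto simp: convex_cone_iff dual_cone_def blinfun.bilinear_simps)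

lemma convex_cone_dual_pos: "convex_cone dual_pos"
  by (simp add: dual_pos_def convex_cone_dual_cone)

lemma zero_in_dual_pos: "0 \<in> dual_pos"
  using convex_cone_contains_0[OF convex_cone_dual_pos] .

lemma pos_nuclear_rep_fin_seq:
  fixes u :: "nat \<Rightarrow> 'e::banach"
  assumes "\<And>j. j < n \<Longrightarrow> x j \<in> dual_pos"
  shows "pos_nuclear_rep p (\<Sum>j<n. tensor (x j) (u j)) (fin_seq n x) (fin_seq n u)"
proof -
  have "fin_seq n u \<longlonglongrightarrow> 0"
    by (rule tendsto_eventually) (auto simp: fin_seq_def eventually_sequentially intro!: exI[of _ n])
  moreover have "(\<lambda>j. blinfun_apply (fin_seq n x j) y *\<^sub>R fin_seq n u j) sums
      blinfun_apply (\<Sum>j<n. tensor (x j) (u j)) y" for y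
    using sums_finite[of "{..<n}" "\<lambda>j. blinfun_apply (fin_seq n x j) y *\<^sub>R fin_seq n u j"]
    by (simp add: fin_seq_def blinfun.bilinear_simps)
  moreover have "fin_seq n x j \<in> dual_pos" for j
    using assms by (simp add: fin_seq_def zero_in_dual_pos)
  ultimately show ?thesis
    by (simp add: pos_nuclear_rep_def fin_seq_in_lp_seq fin_seq_in_weak_lp_seq)
qed

text \<open>Alternation keeps all functionals positive. Besides closure under sums, it allows two
  representations of one operator to be compared.\<close>

lemma pos_nuclear_rep_add:
  assumes "pos_nuclear_rep p T xs us" "pos_nuclear_rep p T' xs' us'"
  shows "pos_nuclear_rep p (T + T') (\<lambda>n. if even n then xs (n div 2) else xs' (n div 2))
    (\<lambda>n. if even n then us (n div 2) else us' (n div 2))"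
proof -
  have "(\<lambda>n. if even n then xs (n div 2) else xs' (n div 2)) \<in> weak_lp_seq (conj_exp p)"
    unfolding weak_lp_seq_def
  proof safe
    fix f :: "('a \<Rightarrow>\<^sub>L real) \<Rightarrow>\<^sub>L real"
    have "(\<lambda>n. if even n then blinfun_apply f (xs (n div 2)) else blinfun_apply f (xs' (n div 2))) \<in> lp_seq (conj_exp p)"
      using assms lp_seq_interleave[of "\<lambda>n. blinfun_apply f (xs n)" _ "\<lambda>n. blinfun_apply f (xs' n)"]
      by (simp add: pos_nuclear_rep_def weak_lp_seq_def)
    then show "(\<lambda>n. blinfun_apply f (if even n then xs (n div 2) else xs' (n div 2))) \<in> lp_seq (conj_exp p)"
      by (simp add: if_distrib[of "blinfun_apply f"])
  qed
  moreover have "(\<lambda>n. blinfun_apply (if even n then xs (n div 2) else xs' (n div 2)) x *\<^sub>R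
      (if even n then us (n div 2) else us' (n div 2))) sums blinfun_apply (T + T') x" for x
  proof -
    have "(\<lambda>n. if even n then blinfun_apply (xs (n div 2)) x *\<^sub>R us (n div 2)
        else blinfun_apply (xs' (n div 2)) x *\<^sub>R us' (n div 2)) sums blinfun_apply (T + T') x"
      using sums_interleave[of "\<lambda>n. blinfun_apply (xs n) x *\<^sub>R us n" _
          "\<lambda>n. blinfun_apply (xs' n) x *\<^sub>R us' n"] assms
      by (simp add: pos_nuclear_rep_def blinfun.bilinear_simps)
    then show ?thesis
      by (rule sums_cong[THEN iffD1, rotated]) simp
  qed
  ultimately show ?thesis
    using assms by (auto simp: pos_nuclear_rep_def intro!: lp_seq_interleave tendsto_interleave)
qed

text \<open>The scalar goes to the vectors, so that a negative one leaves the functionals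
  positive.\<close>

lemma pos_nuclear_rep_scaleR:
  assumes "1 \<le> p" "pos_nuclear_rep p T xs us"
  shows "pos_nuclear_rep p (c *\<^sub>R T) xs (\<lambda>n. c *\<^sub>R us n)"
proof -
  have "(\<lambda>n. blinfun_apply (xs n) x *\<^sub>R c *\<^sub>R us n) sums (c *\<^sub>R blinfun_apply T x)" for x
    using sums_scaleR_right[of "\<lambda>n. blinfun_apply (xs n) x *\<^sub>R us n" _ c] assms(2)
    by (simp add: pos_nuclear_rep_def mult.commute)
  moreover have "(\<lambda>n. c *\<^sub>R us n) \<longlonglongrightarrow> 0" if "us \<longlonglongrightarrow> 0"
    using tendsto_scaleR[OF tendsto_const that, of c] by simp
  ultimately show ?thesis
    using assms lp_seq_scaleR(1)[of us p c] by (auto simp: pos_nuclear_rep_def blinfun.bilinear_simps)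
qed

text \<open>The nuclear norm of the remainder is thus at most a fixed weak norm times the norm of a
  tail of \<open>us\<close>, so representations converge in the nuclear norm.\<close>

lemma pos_nuclear_rep_tail:
  assumes "1 \<le> p" "pos_nuclear_rep p T xs us"
  shows "pos_nuclear_rep p (T - (\<Sum>j<N. tensor (xs j) (us j))) (\<lambda>k. xs (k + N)) (\<lambda>k. us (k + N))"
proof -
  have "(\<lambda>k. blinfun_apply (xs (k + N)) x *\<^sub>R us (k + N)) sums
      blinfun_apply (T - (\<Sum>j<N. tensor (xs j) (us j))) x" for x
    using sums_split_initial_segment[of "\<lambda>n. blinfun_apply (xs n) x *\<^sub>R us n" _ N] assms(2)
    by (simp add: pos_nuclear_rep_def blinfun.bilinear_simps)
  moreover have "(\<lambda>k. us (k + N)) \<longlonglongrightarrow> 0" if "us \<longlonglongrightarrow> 0"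
    using that by (rule LIMSEQ_ignore_initial_segment)
  ultimately show ?thesis
    using assms by (auto simp: pos_nuclear_rep_def intro!: conj_exp_ge_1 weak_lp_seq_shift(1) lp_seq_shift(1))
qed

lemma pos_nuclear_add: "T \<in> pos_nuclear p \<Longrightarrow> T' \<in> pos_nuclear p \<Longrightarrow> T + T' \<in> pos_nuclear p"
  unfolding pos_nuclear_def using pos_nuclear_rep_add by blast

lemma pos_nuclear_scaleR: "1 \<le> p \<Longrightarrow> T \<in> pos_nuclear p \<Longrightarrow> c *\<^sub>R T \<in> pos_nuclear p"
  unfolding pos_nuclear_def using pos_nuclear_rep_scaleR by blast

lemma sum_tensor_in_pos_nuclear:
  fixes n :: nat
  assumes "\<And>j. j < n \<Longrightarrow> x j \<in> dual_pos"
  shows "(\<Sum>j<n. tensor (x j) (u j)) \<in> pos_nuclear p"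
proof -
  have "pos_nuclear_rep p (\<Sum>j<n. tensor (x j) (u j)) (fin_seq n x) (fin_seq n u)"
    using assms by (rule pos_nuclear_rep_fin_seq)
  then show ?thesis
    by (auto simp: pos_nuclear_def)
qed

lemma tensor_in_pos_nuclear: "x \<in> dual_pos \<Longrightarrow> tensor x u \<in> pos_nuclear p"
  using sum_tensor_in_pos_nuclear[of "Suc 0" "\<lambda>_. x" "\<lambda>_. u"] by simp

lemma zero_in_pos_nuclear: "(0 :: 'x::banach_lattice \<Rightarrow>\<^sub>L 'e::banach) \<in> pos_nuclear p"
proof -
  have "(\<Sum>j<0::nat. tensor (0 :: 'x \<Rightarrow>\<^sub>L real) (0 :: 'e)) \<in> pos_nuclear p"
    by (rule sum_tensor_in_pos_nuclear) simp
  then show ?thesis by simp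
qed

section \<open>The nuclear norm\<close>

lemma pos_nuclear_rep_norm_nonneg:
  "1 \<le> p \<Longrightarrow> pos_nuclear_rep p T xs us \<Longrightarrow> 0 \<le> weak_lp_norm (conj_exp p) xs * lp_norm p us"
  by (auto simp: pos_nuclear_rep_def intro!: mult_nonneg_nonneg weak_lp_norm_nonneg lp_norm_nonneg conj_exp_ge_1)

lemma pos_nuclear_norm_le:
  assumes "1 \<le> p" "pos_nuclear_rep p T xs us"
  shows "pos_nuclear_norm p T \<le> weak_lp_norm (conj_exp p) xs * lp_norm p us"
  unfolding pos_nuclear_norm_def
  using assms pos_nuclear_rep_norm_nonneg[OF assms(1)]
  by (intro cInf_lower bdd_belowI[of _ 0]) auto

lemma pos_nuclear_norm_greatest:
  assumes "T \<in> pos_nuclear p" "0 < C"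
    and "\<And>xs us. pos_nuclear_rep p T xs us \<Longrightarrow> b \<le> C * (weak_lp_norm (conj_exp p) xs * lp_norm p us)"
  shows "b \<le> C * pos_nuclear_norm p T"
proof -
  have "b / C \<le> pos_nuclear_norm p T"
    unfolding pos_nuclear_norm_def
  proof (rule cInf_greatest)
    show "{weak_lp_norm (conj_exp p) xs * lp_norm p us |xs us. pos_nuclear_rep p T xs us} \<noteq> {}"
      using assms(1) by (auto simp: pos_nuclear_def)
  qed (use assms in \<open>auto simp: divide_le_eq mult.commute\<close>)
  then show ?thesis
    using assms(2) by (simp add: divide_le_eq mult.commute)
qed

lemma pos_nuclear_norm_nonneg:
  assumes "1 \<le> p" "T \<in> pos_nuclear p"
  shows "0 \<le> pos_nuclear_norm p T"
proof -
  have "0 \<le> 1 * pos_nuclear_norm p T"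
    by (rule pos_nuclear_norm_greatest[OF assms(2)]) (simp_all add: pos_nuclear_rep_norm_nonneg[OF assms(1)])
  then show ?thesis by simp
qed

lemma pos_nuclear_norm_scaleR_le:
  assumes "1 \<le> p" "T \<in> pos_nuclear p" "0 < c"
  shows "pos_nuclear_norm p (c *\<^sub>R T) \<le> c * pos_nuclear_norm p T"
proof (rule pos_nuclear_norm_greatest[OF assms(2,3)])
  fix xs us assume rep: "pos_nuclear_rep p T xs us"
  have "pos_nuclear_norm p (c *\<^sub>R T) \<le> weak_lp_norm (conj_exp p) xs * lp_norm p (\<lambda>n. c *\<^sub>R us n)"
    using assms(1) pos_nuclear_rep_scaleR[OF assms(1) rep] by (rule pos_nuclear_norm_le)
  also have "lp_norm p (\<lambda>n. c *\<^sub>R us n) = c * lp_norm p us"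
    using rep assms by (simp add: pos_nuclear_rep_def lp_seq_scaleR)
  finally show "pos_nuclear_norm p (c *\<^sub>R T) \<le> c * (weak_lp_norm (conj_exp p) xs * lp_norm p us)"
    by (simp add: mult_ac)
qed

lemma pos_nuclear_norm_zero:
  assumes "1 \<le> p"
  shows "pos_nuclear_norm p (0 :: 'x::banach_lattice \<Rightarrow>\<^sub>L 'e::banach) = 0"
proof -
  have "pos_nuclear_norm p (c *\<^sub>R (0 :: 'x \<Rightarrow>\<^sub>L 'e)) \<le> c * pos_nuclear_norm p (0 :: 'x \<Rightarrow>\<^sub>L 'e)" if "0 < c" for c
    using pos_nuclear_norm_scaleR_le[OF assms zero_in_pos_nuclear that] .
  \<comment> \<open>Halving leaves the zero operator unchanged, so its norm is at most half of
    itself.\<close>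
  from this[of "1 / 2"] have "pos_nuclear_norm p (0 :: 'x \<Rightarrow>\<^sub>L 'e) \<le> 0"
    by simp
  moreover have "0 \<le> pos_nuclear_norm p (0 :: 'x \<Rightarrow>\<^sub>L 'e)"
    using assms zero_in_pos_nuclear by (rule pos_nuclear_norm_nonneg)
  ultimately show ?thesis by simp
qed

lemma pos_nuclear_norm_tensor_le:
  assumes "1 \<le> p" "x \<in> dual_pos"
  shows "pos_nuclear_norm p (tensor x u) \<le> norm x * norm u"
proof -
  have one: "lp_norm r (fin_seq (Suc 0) b) \<le> norm (b 0)" if "1 \<le> r" for r and b :: "nat \<Rightarrow> 'c::real_normed_vector"
  proof (cases r)
    case (real s)
    with that have "1 \<le> s"
      by (metis ennreal_1 ennreal_le_iff)
    with real show ?thesis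
      by (simp add: lp_norm_fin_seq_real powr_powr)
  qed (simp add: lp_norm_fin_seq_infty)
  have "pos_nuclear_norm p (tensor x u)
      \<le> weak_lp_norm (conj_exp p) (fin_seq (Suc 0) (\<lambda>_. x)) * lp_norm p (fin_seq (Suc 0) (\<lambda>_. u))"
    using pos_nuclear_norm_le[OF assms(1) pos_nuclear_rep_fin_seq[of "Suc 0" "\<lambda>_. x" p "\<lambda>_. u"]] assms(2) by simp
  also have "\<dots> \<le> norm x * norm u"
  proof (intro mult_mono lp_norm_fin_seq_nonneg)
    show "weak_lp_norm (conj_exp p) (fin_seq (Suc 0) (\<lambda>_. x)) \<le> norm x"
    proof (rule weak_lp_norm_fin_seqI)
      fix h :: "('a \<Rightarrow>\<^sub>L real) \<Rightarrow>\<^sub>L real" assume h: "norm h \<le> 1"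
      have "lp_norm (conj_exp p) (fin_seq (Suc 0) (\<lambda>j. blinfun_apply h x)) \<le> norm (blinfun_apply h x)"
        using one[OF conj_exp_ge_1[OF assms(1)], of "\<lambda>_. blinfun_apply h x"] .
      also have "\<dots> \<le> norm h * norm x"
        by (rule norm_blinfun)
      also have "\<dots> \<le> norm x"
        using h by (simp add: mult_left_le_one_le)
      finally show "lp_norm (conj_exp p) (fin_seq (Suc 0) (\<lambda>j. blinfun_apply h x)) \<le> norm x" .
    qed
  qed (use one[OF assms(1), of "\<lambda>_. u"] in auto)
  finally show ?thesis .
qed

section \<open>Independence of the trace of the representation\<close>

lemma bidual_embed_in_bidual_cone: "x \<in> dual_pos \<Longrightarrow> bidual_embed x \<in> dual_cone bidual_pos"
  by (simp add: bidual_pos_def dual_cone_def)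

text \<open>The canonical embedding is a contraction, and contractions do not increase weak
  norms.\<close>

lemma weak_lp_norm_bidual_embed_le:
  fixes xs :: "nat \<Rightarrow> 'a::real_normed_vector"
  assumes "1 \<le> p" "xs \<in> weak_lp_seq p"
  shows "weak_lp_norm p (fin_seq n (\<lambda>j. bidual_embed (xs j))) \<le> weak_lp_norm p xs"
proof -
  define J :: "'a \<Rightarrow>\<^sub>L ('a \<Rightarrow>\<^sub>L real) \<Rightarrow>\<^sub>L real" where "J = Blinfun bidual_embed"
  have "bounded_linear (bidual_embed :: 'a \<Rightarrow> _)"
    using norm_bidual_embed_le
    by (intro bounded_linear_intro[where K = 1]) (auto intro!: blinfun_eqI simp: blinfun.bilinear_simps)
  then have J: "blinfun_apply J = bidual_embed"
    unfolding J_def by (rule bounded_linear_Blinfun_apply)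
  have "norm J \<le> 1"
    by (rule norm_blinfun_bound) (simp_all add: J norm_bidual_embed_le)
  from weak_lp_seq_blinfun[OF assms this] show ?thesis
    using weak_lp_norm_fin_seq_le[OF assms(1)] order_trans unfolding J by blast
qed

lemma pos_majorizing_boundD:
  assumes "pos_majorizing_bound p P S C" "\<And>j. j < n \<Longrightarrow> norm (u j) \<le> 1" "\<And>j. j < n \<Longrightarrow> f j \<in> dual_cone P"
  shows "lp_norm p (fin_seq n (\<lambda>j. blinfun_apply (f j) (blinfun_apply S (u j)))) \<le> C * weak_lp_norm p (fin_seq n f)"
  using assms unfolding pos_majorizing_bound_def by simp

lemma trace_partial_sums_le:
  assumes p: "1 \<le> p" and S: "pos_majorizing_bound (conj_exp p) bidual_pos S C" "0 \<le> C"
    and xs: "xs \<in> weak_lp_seq (conj_exp p)" "\<And>n. xs n \<in> dual_pos" and us: "us \<in> lp_seq p"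
  shows "(\<Sum>n<N. \<bar>blinfun_apply (blinfun_apply S (us n)) (xs n)\<bar>)
    \<le> C * (weak_lp_norm (conj_exp p) xs * lp_norm p us)"
proof -
  define q where "q = conj_exp p"
  have q: "1 \<le> q"
    using p by (simp add: q_def conj_exp_ge_1)
  \<comment> \<open>The majorizing estimate asks for vectors in the unit ball, and the norms of the
    \<open>us n\<close> become coefficients. For \<open>us n = 0\<close> division by zero gives
    \<open>v n = 0\<close>, so \<open>us_eq\<close> still holds.\<close>
  define v where "v n = (1 / norm (us n)) *\<^sub>R us n" for n
  define b where "b n = blinfun_apply (blinfun_apply S (v n)) (xs n)" for n
  have us_eq: "us n = norm (us n) *\<^sub>R v n" and v: "norm (v n) \<le> 1" for n
    by (simp_all add: v_def)
  have "lp_norm q (fin_seq N (\<lambda>j. blinfun_apply (bidual_embed (xs j)) (blinfun_apply S (v j))))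
      \<le> C * weak_lp_norm q (fin_seq N (\<lambda>j. bidual_embed (xs j)))"
    using v bidual_embed_in_bidual_cone[OF xs(2)] by (intro pos_majorizing_boundD[OF S(1)[folded q_def]])
  also have "\<dots> \<le> C * weak_lp_norm q xs"
    using weak_lp_norm_bidual_embed_le[OF q] xs(1) S(2) by (intro mult_left_mono) (auto simp: q_def)
  finally have b: "lp_norm q (fin_seq N b) \<le> C * weak_lp_norm q xs"
    by (simp add: b_def[abs_def])
  have "(\<Sum>n<N. \<bar>blinfun_apply (blinfun_apply S (us n)) (xs n)\<bar>) = (\<Sum>n<N. norm (us n) * norm (b n))"
    by (subst us_eq) (simp add: b_def blinfun.bilinear_simps abs_mult)
  also have "\<dots> \<le> lp_norm p (fin_seq N us) * lp_norm q (fin_seq N b)"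
    unfolding q_def using p by (rule Hoelder_fin_seq)
  also have "\<dots> \<le> lp_norm p us * (C * weak_lp_norm q xs)"
    using b by (intro mult_mono lp_norm_fin_seq_le lp_norm_nonneg lp_norm_fin_seq_nonneg p us)
  finally show ?thesis
    by (simp add: q_def mult_ac)
qed

lemma trace_summable:
  assumes "1 \<le> p" "pos_majorizing_bound (conj_exp p) bidual_pos S C" "0 \<le> C"
    and "xs \<in> weak_lp_seq (conj_exp p)" "\<And>n. xs n \<in> dual_pos" "us \<in> lp_seq p"
  shows "summable (\<lambda>n. blinfun_apply (blinfun_apply S (us n)) (xs n))"
    and "\<bar>\<Sum>n. blinfun_apply (blinfun_apply S (us n)) (xs n)\<bar> \<le> C * (weak_lp_norm (conj_exp p) xs * lp_norm p us)"
proof -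
  let ?b = "\<lambda>n. blinfun_apply (blinfun_apply S (us n)) (xs n)"
  note le = trace_partial_sums_le[OF assms]
  have sm: "summable (\<lambda>n. \<bar>?b n\<bar>)"
  proof (rule bounded_imp_summable)
    show "(\<Sum>n\<le>N. \<bar>?b n\<bar>) \<le> C * (weak_lp_norm (conj_exp p) xs * lp_norm p us)" for N
      using le[of "Suc N"] by (simp add: lessThan_Suc_atMost)
  qed simp
  then show "summable ?b"
    by (rule summable_rabs_cancel)
  have "\<bar>suminf ?b\<bar> \<le> (\<Sum>n. \<bar>?b n\<bar>)"
    using sm by (rule summable_rabs)
  also have "\<dots> \<le> C * (weak_lp_norm (conj_exp p) xs * lp_norm p us)"
    using sm le by (rule suminf_le_const)
  finally show "\<bar>suminf ?b\<bar> \<le> C * (weak_lp_norm (conj_exp p) xs * lp_norm p us)" .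
qed

text \<open>The partial sums of \<open>\<Sum>n. e (us n) *\<^sub>R xs n\<close> converge to \<open>e o\<^sub>L T\<close> in norm, so \<open>\<phi>\<close> need not be weak*-continuous.\<close>

lemma pos_nuclear_adjoint_sums:
  fixes T :: "'x::banach_lattice \<Rightarrow>\<^sub>L 'e::banach" and \<phi> :: "('x \<Rightarrow>\<^sub>L real) \<Rightarrow>\<^sub>L real" and e :: "'e \<Rightarrow>\<^sub>L real"
  assumes p: "1 \<le> p" and rep: "pos_nuclear_rep p T xs us"
  shows "(\<lambda>n. blinfun_apply e (us n) * blinfun_apply \<phi> (xs n)) sums blinfun_apply \<phi> (e o\<^sub>L T)"
proof -
  define q where "q = conj_exp p"
  have q: "1 \<le> q"
    using p by (simp add: q_def conj_exp_ge_1)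
  have xs: "xs \<in> weak_lp_seq q" and us: "us \<in> lp_seq p" "p = \<infinity> \<Longrightarrow> us \<longlonglongrightarrow> 0"
    and sums: "\<And>x. (\<lambda>n. blinfun_apply (xs n) x *\<^sub>R us n) sums blinfun_apply T x"
    using rep by (auto simp: pos_nuclear_rep_def q_def)
  define W where "W = weak_lp_norm q xs"
  have W: "0 \<le> W"
    unfolding W_def using q xs by (rule weak_lp_norm_nonneg)
  define G where "G N = (\<Sum>n<N. blinfun_apply e (us n) *\<^sub>R xs n)" for N
  have eus: "(\<lambda>n. norm e *\<^sub>R us n) \<in> lp_seq p" "\<And>n. norm (blinfun_apply e (us n)) \<le> norm (norm e *\<^sub>R us n)"
    using lp_seq_scaleR(1)[OF us(1) p] norm_blinfun[of e] by simp_all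
  have a: "(\<lambda>n. blinfun_apply e (us n)) \<in> lp_seq p"
    using lp_seq_mono(1)[OF p eus] .
  have a0: "(\<lambda>n. blinfun_apply e (us n)) \<longlonglongrightarrow> 0" if "p = \<infinity>"
    using blinfun.tendsto[OF tendsto_const us(2)[OF that], of e] by simp
  \<comment> \<open>Tested on \<open>x\<close>, the remainder pairs a tail of
    \<open>e (us n)\<close> with the values \<open>xs n x\<close>, whose norm for the exponent
    \<open>q\<close> is at most \<open>W * norm x\<close>. This uniformity in \<open>x\<close>
    upgrades pointwise to norm convergence.\<close>
  have bound: "norm ((e o\<^sub>L T) - G N) \<le> W * lp_norm p (\<lambda>k. blinfun_apply e (us (k + N)))" for N
  proof (rule norm_blinfun_bound)
    have tail: "(\<lambda>k. blinfun_apply e (us (k + N))) \<in> lp_seq p"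
      using lp_seq_shift(1)[OF p a] .
    then show nonneg: "0 \<le> W * lp_norm p (\<lambda>k. blinfun_apply e (us (k + N)))"
      using W lp_norm_nonneg[OF p tail] by simp
    fix x
    let ?b = "\<lambda>n. blinfun_apply e (us n) * blinfun_apply (xs n) x"
    have "?b sums blinfun_apply e (blinfun_apply T x)"
      using bounded_linear.sums[OF blinfun.bounded_linear_right sums[of x], of e]
      by (simp add: blinfun.bilinear_simps mult.commute)
    then have tsums: "(\<lambda>k. ?b (k + N)) sums blinfun_apply ((e o\<^sub>L T) - G N) x"
      using sums_split_initial_segment[of ?b _ N] by (simp add: G_def blinfun.bilinear_simps)
    have shift: "(\<lambda>k. xs (k + N)) \<in> weak_lp_seq q" "weak_lp_norm q (\<lambda>k. xs (k + N)) \<le> W"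
      unfolding W_def using weak_lp_seq_shift[OF q xs] by auto
    have x_lp: "(\<lambda>k. blinfun_apply (bidual_embed x) (xs (k + N))) \<in> lp_seq q"
      using shift(1) unfolding weak_lp_seq_def by blast
    have "\<bar>\<Sum>k<n. ?b (k + N)\<bar> \<le> W * lp_norm p (\<lambda>k. blinfun_apply e (us (k + N))) * norm x" for n
    proof -
      have "\<bar>\<Sum>k<n. ?b (k + N)\<bar> \<le> (\<Sum>k<n. norm (blinfun_apply e (us (k + N))) *
          norm (blinfun_apply (bidual_embed x) (xs (k + N))))"
        using sum_abs[of "\<lambda>k. ?b (k + N)" "{..<n}"] by (simp add: abs_mult)
      also have "\<dots> \<le> lp_norm p (\<lambda>k. blinfun_apply e (us (k + N))) *
          lp_norm q (\<lambda>k. blinfun_apply (bidual_embed x) (xs (k + N)))"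
        unfolding q_def using p tail x_lp[unfolded q_def] by (rule Hoelder_lp_seq)
      also have "\<dots> \<le> lp_norm p (\<lambda>k. blinfun_apply e (us (k + N))) * (W * norm x)"
      proof (intro mult_left_mono lp_norm_nonneg[OF p tail])
        have "lp_norm q (\<lambda>k. blinfun_apply (bidual_embed x) (xs (k + N)))
            \<le> weak_lp_norm q (\<lambda>k. xs (k + N)) * norm (bidual_embed x)"
          using q shift(1) by (rule lp_norm_le_weak_lp_norm)
        also have "\<dots> \<le> W * norm x"
          using shift W norm_bidual_embed_le by (intro mult_mono) auto
        finally show "lp_norm q (\<lambda>k. blinfun_apply (bidual_embed x) (xs (k + N))) \<le> W * norm x" .
      qed
      finally show ?thesis
        by (simp add: mult_ac)
    qed
    moreover have "(\<lambda>n. \<bar>\<Sum>k<n. ?b (k + N)\<bar>) \<longlonglongrightarrow> \<bar>blinfun_apply ((e o\<^sub>L T) - G N) x\<bar>"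
      using tsums unfolding sums_def by (rule tendsto_rabs)
    ultimately show "norm (blinfun_apply ((e o\<^sub>L T) - G N) x)
        \<le> W * lp_norm p (\<lambda>k. blinfun_apply e (us (k + N))) * norm x"
      by (simp add: LIMSEQ_le_const2)
  qed
  have "(\<lambda>N. W * lp_norm p (\<lambda>k. blinfun_apply e (us (k + N)))) \<longlonglongrightarrow> W * 0"
    using lp_norm_tail[OF p a a0] by (intro tendsto_intros)
  then have "(\<lambda>N. (e o\<^sub>L T) - G N) \<longlonglongrightarrow> 0"
    using bound by (intro Lim_null_comparison[of "\<lambda>N. (e o\<^sub>L T) - G N"]) auto
  then have "(\<lambda>N. (e o\<^sub>L T) - ((e o\<^sub>L T) - G N)) \<longlonglongrightarrow> (e o\<^sub>L T) - 0"
    by (intro tendsto_intros)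
  then have "(\<lambda>N. blinfun_apply \<phi> (G N)) \<longlonglongrightarrow> blinfun_apply \<phi> (e o\<^sub>L T)"
    by (intro tendsto_intros) simp
  then show ?thesis
    by (simp add: sums_def G_def blinfun.bilinear_simps)
qed

section \<open>Finite rank perturbations of the trace\<close>

text \<open>Writing \<open>R\<close> as a sum of rank one maps splits the series into finitely many
  adjoint series of the zero operator, each evaluated at a fixed \<open>S (b i)\<close>.\<close>

lemma trace_finite_rank_left:
  fixes S :: "'e::banach \<Rightarrow>\<^sub>L ('x::banach_lattice \<Rightarrow>\<^sub>L real) \<Rightarrow>\<^sub>L real"
  assumes p: "1 \<le> p" and rep: "pos_nuclear_rep p 0 xs us" and R: "finite_rank R"
  shows "(\<lambda>n. blinfun_apply (blinfun_apply S (blinfun_apply R (us n))) (xs n)) sums 0"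
proof -
  obtain m :: nat and f b where R: "\<forall>u. blinfun_apply R u = (\<Sum>i<m. blinfun_apply (f i) u *\<^sub>R b i)"
    using finite_rank_eq_sum[OF R] by blast
  have "(\<lambda>n. blinfun_apply (f i) (us n) * blinfun_apply (blinfun_apply S (b i)) (xs n)) sums 0" for i
    using pos_nuclear_adjoint_sums[OF p rep, of "f i" "blinfun_apply S (b i)"] by (simp add: blinfun.bilinear_simps)
  then have "(\<lambda>n. \<Sum>i<m. blinfun_apply (f i) (us n) * blinfun_apply (blinfun_apply S (b i)) (xs n)) sums (\<Sum>i<m. 0)"
    by (intro sums_sum)
  then show ?thesis
    by (simp add: R blinfun.bilinear_simps)
qed

text \<open>The roles are exchanged: the functional on E is \<open>u \<mapsto> S u (b i)\<close>,
  and the adjoint series is evaluated at \<open>f i\<close>, an arbitrary element of the bidual of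
  X.\<close>

lemma trace_finite_rank_right:
  fixes S :: "'e::banach \<Rightarrow>\<^sub>L ('x::banach_lattice \<Rightarrow>\<^sub>L real) \<Rightarrow>\<^sub>L real"
  assumes p: "1 \<le> p" and rep: "pos_nuclear_rep p 0 xs us" and R: "finite_rank R"
  shows "(\<lambda>n. blinfun_apply (blinfun_apply S (us n)) (blinfun_apply R (xs n))) sums 0"
proof -
  obtain m :: nat and f b where R: "\<forall>u. blinfun_apply R u = (\<Sum>i<m. blinfun_apply (f i) u *\<^sub>R b i)"
    using finite_rank_eq_sum[OF R] by blast
  have "(\<lambda>n. blinfun_apply (f i) (xs n) * blinfun_apply (blinfun_apply S (us n)) (b i)) sums 0" for i
    using pos_nuclear_adjoint_sums[OF p rep, of "bidual_embed (b i) o\<^sub>L S" "f i"]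
    by (simp add: blinfun.bilinear_simps mult.commute)
  then have "(\<lambda>n. \<Sum>i<m. blinfun_apply (f i) (xs n) * blinfun_apply (blinfun_apply S (us n)) (b i)) sums (\<Sum>i<m. 0)"
    by (intro sums_sum)
  then show ?thesis
    by (simp add: R blinfun.bilinear_simps)
qed

section \<open>Factorization through a null sequence\<close>

text \<open>The weights are reciprocal square roots of tail sums: they tend to infinity, while the
  weighted series is dominated by a telescoping one.\<close>

lemma summable_times_unbounded:
  fixes a :: "nat \<Rightarrow> real"
  assumes a: "summable a" "\<And>n. 0 \<le> a n"
  obtains c where "\<And>n. 0 < c n" "filterlim c at_top sequentially" "summable (\<lambda>n. a n * c n)"
proof -
  \<comment> \<open>The geometric term keeps every tail sum positive even if \<open>a\<close>
    vanishes from some index on.\<close>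
  define b where "b n = a n + (1 / 2) ^ n" for n
  have b: "0 < b n" "a n \<le> b n" for n
    using a(2)[of n] by (simp_all add: b_def add_nonneg_pos)
  have sm: "summable b"
    unfolding b_def by (intro summable_add a(1) summable_geometric) simp
  define r where "r n = (\<Sum>k. b (k + n))" for n
  have smr: "summable (\<lambda>k. b (k + n))" for n
    using sm by (rule summable_ignore_initial_segment)
  have r_pos: "0 < r n" for n
    unfolding r_def using smr b(1) by (intro suminf_pos)
  have r_Suc: "r n = b n + r (Suc n)" for n
    using suminf_split_head[OF smr, of n] by (simp add: r_def)
  have r_lim: "r \<longlonglongrightarrow> 0"
    using suminf_exist_split2[OF sm] by (simp add: r_def[abs_def])
  define c where "c n = 1 / sqrt (r n)" for n
  have "filterlim (\<lambda>n. sqrt (r n)) (at_right 0) sequentially"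
  proof -
    have "(\<lambda>n. sqrt (r n)) \<longlonglongrightarrow> sqrt 0"
      using r_lim by (rule tendsto_real_sqrt)
    then show ?thesis
      using r_pos by (auto simp: filterlim_at intro!: always_eventually less_imp_neq[symmetric])
  qed
  then have "filterlim c at_top sequentially"
    unfolding c_def using filterlim_compose[OF filterlim_inverse_at_top_right]
    by (simp add: inverse_eq_divide)
  moreover have "0 < c n" for n
    using r_pos by (simp add: c_def)
  moreover have "summable (\<lambda>n. a n * c n)"
  proof (rule summable_comparison_test')
    have "(\<lambda>n. sqrt (r n)) \<longlonglongrightarrow> sqrt 0"
      using r_lim by (rule tendsto_real_sqrt)
    then show "summable (\<lambda>n. 2 * (sqrt (r n) - sqrt (r (Suc n))))"
      by (intro summable_mult telescope_summable')
    fix n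
    define s t where "s = sqrt (r n)" and "t = sqrt (r (Suc n))"
    have st: "0 < s" "0 < t" "t \<le> s" and b_eq: "b n = s\<^sup>2 - t\<^sup>2"
      using r_pos[of n] r_pos[of "Suc n"] r_Suc[of n] b(1)[of n] by (simp_all add: s_def t_def)
    \<comment> \<open>Since \<open>t \<le> s\<close>, this gives
      \<open>b n / s \<le> 2 * (s - t)\<close>, which telescopes.\<close>
    have "b n = (s + t) * (s - t)"
      by (simp add: b_eq power2_eq_square algebra_simps)
    also have "\<dots> \<le> (2 * s) * (s - t)"
      using st by (intro mult_right_mono) auto
    finally have "a n / s \<le> 2 * (s - t)"
      using b(2)[of n] st by (simp add: divide_le_eq mult_ac)
    then show "norm (a n * c n) \<le> 2 * (sqrt (r n) - sqrt (r (Suc n)))"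
      using a(2)[of n] st by (simp add: c_def s_def t_def)
  qed
  ultimately show thesis
    by (intro that)
qed

text \<open>For finite \<open>p\<close> the weights of \<open>summable_times_unbounded\<close> are
  moved into \<open>l\<close>, which stays \<open>p\<close>-summable, and their reciprocal roots
  force \<open>v\<close> to zero. For \<open>p = \<infinity>\<close> the sequence is null already
  and \<open>l\<close> is constant.\<close>

lemma lp_seq_factor_null:
  fixes u :: "nat \<Rightarrow> 'a::real_normed_vector"
  assumes p: "1 \<le> p" and u: "u \<in> lp_seq p" and null: "p = \<infinity> \<Longrightarrow> u \<longlonglongrightarrow> 0"
  obtains l :: "nat \<Rightarrow> real" and v where "l \<in> lp_seq p" "v \<longlonglongrightarrow> 0" "\<And>n. u n = l n *\<^sub>R v n"
proof (cases p)
  case top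
  have "(\<lambda>_::nat. 1 :: real) \<in> lp_seq p"
    using top by (simp add: lp_seq_def)
  then show thesis
    using that[of "\<lambda>_. 1" u] null top by simp
next
  case (real r)
  with p have r: "1 \<le> r"
    by (metis ennreal_1 ennreal_le_iff)
  have "summable (\<lambda>n. norm (u n) powr r)"
    using u real by (simp add: lp_seq_def)
  then obtain c where c: "\<And>n. 0 < c n" "filterlim c at_top sequentially"
      "summable (\<lambda>n. norm (u n) powr r * c n)"
    by (rule summable_times_unbounded) auto
  define d where "d n = c n powr (1 / r)" for n
  have d: "0 < d n" for n
    using c(1)[of n] by (simp add: d_def)
  define l where "l n = norm (u n) * d n" for n
  \<comment> \<open>Where \<open>u n = 0\<close> also \<open>l n = 0\<close>, and division by zero
    gives \<open>v n = 0\<close>.\<close>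
  define v where "v n = (1 / l n) *\<^sub>R u n" for n
  have "norm (l n) powr r = norm (u n) powr r * c n" for n
    using c(1)[of n] r by (simp add: l_def d_def powr_mult powr_powr)
  then have "l \<in> lp_seq p"
    using c(3) real by (simp add: lp_seq_def)
  moreover have "v \<longlonglongrightarrow> 0"
  proof (rule Lim_null_comparison)
    show "\<forall>\<^sub>F n in sequentially. norm (v n) \<le> c n powr (- (1 / r))"
    proof (intro always_eventually allI)
      fix n
      show "norm (v n) \<le> c n powr (- (1 / r))"
        using d[of n] by (cases "u n = 0") (simp_all add: v_def l_def abs_mult powr_minus_divide flip: d_def)
    qed
    show "(\<lambda>n. c n powr (- (1 / r))) \<longlonglongrightarrow> 0"
      using c(2) r by (intro tendsto_neg_powr) auto
  qed
  moreover have "u n = l n *\<^sub>R v n" for n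
    using d[of n] by (cases "u n = 0") (auto simp: v_def l_def)
  ultimately show thesis
    by (rule that)
qed

lemma trace_zero_rep_ap:
  fixes S :: "'e::banach \<Rightarrow>\<^sub>L ('x::banach_lattice \<Rightarrow>\<^sub>L real) \<Rightarrow>\<^sub>L real"
  assumes p: "1 \<le> p" and S: "pos_majorizing_bound (conj_exp p) bidual_pos S C" "0 \<le> C"
    and rep: "pos_nuclear_rep p 0 xs us" and ap: "approximation_property TYPE('e)"
  shows "(\<Sum>n. blinfun_apply (blinfun_apply S (us n)) (xs n)) = 0" (is "?t = 0")
proof -
  have xs: "xs \<in> weak_lp_seq (conj_exp p)" "\<And>n. xs n \<in> dual_pos"
    and us: "us \<in> lp_seq p" "p = \<infinity> \<Longrightarrow> us \<longlonglongrightarrow> 0"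
    using rep by (auto simp: pos_nuclear_rep_def)
  define W where "W = weak_lp_norm (conj_exp p) xs"
  have W: "0 \<le> W"
    unfolding W_def using xs p by (intro weak_lp_norm_nonneg conj_exp_ge_1)
  obtain l :: "nat \<Rightarrow> real" and v where l: "l \<in> lp_seq p" and v: "v \<longlonglongrightarrow> 0" and lv: "\<And>n. us n = l n *\<^sub>R v n"
    using lp_seq_factor_null[OF p us] by blast
  \<comment> \<open>Closeness of \<open>R\<close> to the identity on the \<open>us n\<close> would
    bound the errors only uniformly; on the \<open>v n\<close> it bounds them by multiples
    \<open>\<epsilon> * \<bar>l n\<bar>\<close>, hence in the \<open>p\<close>-norm.\<close>
  have "compact (insert 0 (range v))"
    using compactin_sequence_with_limit[of euclidean v 0 "range v"] v by simp
  have le: "\<bar>?t\<bar> \<le> \<epsilon> * (C * W * lp_norm p l)" if \<epsilon>: "0 < \<epsilon>" for \<epsilon>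
  proof -
    have "\<exists>R :: 'e \<Rightarrow>\<^sub>L 'e. finite_rank R \<and> (\<forall>w\<in>insert 0 (range v). norm (blinfun_apply R w - w) < \<epsilon>)"
      using ap[unfolded approximation_property_def, rule_format, OF \<epsilon>] \<open>compact (insert 0 (range v))\<close> .
    then obtain R :: "'e \<Rightarrow>\<^sub>L 'e" where R: "finite_rank R"
        "\<And>n. norm (blinfun_apply R (v n) - v n) < \<epsilon>"
      by auto
    define ws where "ws n = us n - blinfun_apply R (us n)" for n
    have ws: "norm (ws n) \<le> norm (\<epsilon> *\<^sub>R l n)" for n
    proof -
      have "ws n = l n *\<^sub>R (v n - blinfun_apply R (v n))"
        by (simp add: ws_def lv blinfun.bilinear_simps scaleR_diff_right)
      moreover have "\<bar>l n\<bar> * norm (v n - blinfun_apply R (v n)) \<le> \<bar>l n\<bar> * \<epsilon>"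
        using R(2)[of n] by (intro mult_left_mono) (simp_all add: norm_minus_commute)
      ultimately show ?thesis
        using \<epsilon> by (simp add: abs_mult mult.commute[of \<epsilon>])
    qed
    have ws_lp: "ws \<in> lp_seq p" "lp_norm p ws \<le> \<epsilon> * lp_norm p l"
      using lp_seq_mono[OF p lp_seq_scaleR(1)[OF l p, of \<epsilon>] ws] lp_seq_scaleR(2)[OF l p, of \<epsilon>] \<epsilon> by auto
    have "(\<lambda>n. blinfun_apply (blinfun_apply S (us n)) (xs n)) sums ?t"
      using trace_summable(1)[OF p S xs us(1)] by (rule summable_sums)
    \<comment> \<open>The trace with \<open>R\<close> inserted is 0, so replacing \<open>us\<close>
      by the small \<open>ws\<close> leaves the value \<open>?t\<close> unchanged.\<close>
    from sums_diff[OF this trace_finite_rank_left[OF p rep R(1), of S]]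
    have "(\<lambda>n. blinfun_apply (blinfun_apply S (ws n)) (xs n)) sums ?t"
      by (simp add: ws_def blinfun.bilinear_simps)
    then have "\<bar>?t\<bar> \<le> C * (W * lp_norm p ws)"
      using trace_summable(2)[OF p S xs ws_lp(1)] by (simp add: sums_iff W_def)
    also have "\<dots> \<le> C * (W * (\<epsilon> * lp_norm p l))"
      using ws_lp(2) W S(2) by (intro mult_left_mono)
    finally show ?thesis
      by (simp add: mult_ac)
  qed
  have "((\<lambda>\<epsilon>. \<epsilon> * (C * W * lp_norm p l)) \<longlongrightarrow> 0 * (C * W * lp_norm p l)) (at_right 0)"
    by (intro tendsto_intros)
  then have "\<bar>?t\<bar> \<le> 0 * (C * W * lp_norm p l)"
    by (rule tendsto_lowerbound) (auto simp: eventually_at_right_less intro!: eventually_mono[OF eventually_at_right_less] le)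
  then show ?thesis by simp
qed

lemma trace_zero_rep_pmap:
  fixes S :: "'e::banach \<Rightarrow>\<^sub>L ('x::banach_lattice \<Rightarrow>\<^sub>L real) \<Rightarrow>\<^sub>L real"
  assumes p: "1 \<le> p" and S: "pos_majorizing_bound (conj_exp p) bidual_pos S C" "0 \<le> C"
    and rep: "pos_nuclear_rep p 0 xs us"
    and pmap: "positive_metric_approximation_property (dual_pos :: ('x \<Rightarrow>\<^sub>L real) set)"
  shows "(\<Sum>n. blinfun_apply (blinfun_apply S (us n)) (xs n)) = 0" (is "?t = 0")
proof -
  define q where "q = conj_exp p"
  have q: "1 \<le> q"
    using p by (simp add: q_def conj_exp_ge_1)
  have xs: "xs \<in> weak_lp_seq q" "\<And>n. xs n \<in> dual_pos"
    and us: "us \<in> lp_seq p" "p = \<infinity> \<Longrightarrow> us \<longlonglongrightarrow> 0"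
    using rep by (auto simp: pos_nuclear_rep_def q_def)
  define W where "W = weak_lp_norm q xs"
  have W: "0 \<le> W"
    unfolding W_def using q xs(1) by (rule weak_lp_norm_nonneg)
  let ?b = "\<lambda>n. blinfun_apply (blinfun_apply S (us n)) (xs n)"
  have sums: "?b sums ?t"
    using trace_summable(1)[OF p S xs[unfolded q_def] us(1)] by (rule summable_sums)
  \<comment> \<open>The factor 2 counts two tails, one with \<open>xs\<close> and one with
    \<open>R xs\<close>; the first \<open>N\<close> terms contribute at most
    \<open>\<epsilon>\<close>.\<close>
  have tail: "\<bar>?t\<bar> \<le> 2 * C * W * lp_norm p (\<lambda>k. us (k + N))" for N
  proof (rule field_le_epsilon)
    fix \<epsilon> :: real assume \<epsilon>: "0 < \<epsilon>"
    define D where "D = (\<Sum>n<N. norm S * norm (us n))"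
    have "0 \<le> D"
      by (simp add: D_def sum_nonneg)
    \<comment> \<open>\<open>D\<close> bounds the sensitivity of the first \<open>N\<close> terms to
      changes of \<open>xs\<close>; the added 1 covers \<open>D = 0\<close>.\<close>
    define \<delta> where "\<delta> = \<epsilon> / (D + 1)"
    have \<delta>: "0 < \<delta>" "D * \<delta> \<le> \<epsilon>"
      using \<epsilon> \<open>0 \<le> D\<close> by (simp_all add: \<delta>_def field_simps)
    have "compact (xs ` {..<N})"
      by (intro finite_imp_compact) simp
    then obtain R :: "('x \<Rightarrow>\<^sub>L real) \<Rightarrow>\<^sub>L ('x \<Rightarrow>\<^sub>L real)" where R: "finite_rank R"
        "\<And>x. x \<in> dual_pos \<Longrightarrow> blinfun_apply R x \<in> dual_pos" "norm R \<le> 1"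
        "\<And>x. x \<in> xs ` {..<N} \<Longrightarrow> norm (blinfun_apply R x - x) < \<delta>"
      using pmap \<delta>(1) unfolding positive_metric_approximation_property_def by metis
    let ?c = "\<lambda>n. blinfun_apply (blinfun_apply S (us n)) (blinfun_apply R (xs n))"
    have Rxs: "(\<lambda>n. blinfun_apply R (xs n)) \<in> weak_lp_seq q"
        "weak_lp_norm q (\<lambda>n. blinfun_apply R (xs n)) \<le> W"
      unfolding W_def using weak_lp_seq_blinfun[OF q xs(1) R(3)] by auto
    \<comment> \<open>Positivity of \<open>R\<close> and \<open>norm R \<le> 1\<close> let this
      apply to \<open>R xs\<close> as well as to \<open>xs\<close>. The bound does not depend on
      \<open>R\<close>, which is chosen after \<open>N\<close>.\<close>
    have tail_le: "\<bar>\<Sum>k. blinfun_apply (blinfun_apply S (us (k + N))) (ys (k + N))\<bar>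
        \<le> C * W * lp_norm p (\<lambda>k. us (k + N))"
      if ys: "ys \<in> weak_lp_seq q" "weak_lp_norm q ys \<le> W" "\<And>n. ys n \<in> dual_pos" for ys
    proof -
      have shift: "(\<lambda>k. ys (k + N)) \<in> weak_lp_seq q" "weak_lp_norm q (\<lambda>k. ys (k + N)) \<le> W"
        "(\<lambda>k. us (k + N)) \<in> lp_seq p"
        using weak_lp_seq_shift[OF q ys(1), of N] ys(2) lp_seq_shift(1)[OF p us(1)] by auto
      have "\<bar>\<Sum>k. blinfun_apply (blinfun_apply S (us (k + N))) (ys (k + N))\<bar>
          \<le> C * (weak_lp_norm q (\<lambda>k. ys (k + N)) * lp_norm p (\<lambda>k. us (k + N)))"
        unfolding q_def using shift ys(3) by (intro trace_summable(2)[OF p S]) (auto simp: q_def)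
      also have "\<dots> \<le> C * (W * lp_norm p (\<lambda>k. us (k + N)))"
        using shift S(2) lp_norm_nonneg[OF p] by (intro mult_left_mono mult_right_mono)
      finally show ?thesis by (simp add: mult_ac)
    qed
    have "\<bar>?b n - ?c n\<bar> \<le> norm S * norm (us n) * \<delta>" if "n < N" for n
    proof -
      have "\<bar>?b n - ?c n\<bar> = \<bar>blinfun_apply (blinfun_apply S (us n)) (xs n - blinfun_apply R (xs n))\<bar>"
        by (simp add: blinfun.bilinear_simps)
      also have "\<dots> \<le> norm (blinfun_apply S (us n)) * norm (xs n - blinfun_apply R (xs n))"
        using norm_blinfun[of "blinfun_apply S (us n)"] by simp
      also have "\<dots> \<le> norm S * norm (us n) * \<delta>"
        using R(4)[of "xs n"] that norm_blinfun[of S "us n"]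
        by (intro mult_mono) (auto simp: norm_minus_commute)
      finally show ?thesis .
    qed
    then have "(\<Sum>n<N. \<bar>?b n - ?c n\<bar>) \<le> (\<Sum>n<N. norm S * norm (us n) * \<delta>)"
      by (intro sum_mono) simp
    also have "\<dots> = D * \<delta>"
      by (simp add: D_def sum_distrib_right)
    finally have head: "\<bar>\<Sum>n<N. ?b n - ?c n\<bar> \<le> \<epsilon>"
      using sum_abs[of "\<lambda>n. ?b n - ?c n" "{..<N}"] \<delta>(2) by linarith
    have "?c sums 0"
      using p rep R(1) by (rule trace_finite_rank_right)
    then have "(\<Sum>k. ?c (k + N)) = - (\<Sum>n<N. ?c n)"
      using suminf_split_initial_segment[OF sums_summable, of ?c 0 N] by (simp add: sums_iff)
    moreover have "?t = (\<Sum>k. ?b (k + N)) + (\<Sum>n<N. ?b n)"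
      using suminf_split_initial_segment[OF sums_summable[OF sums], of N] .
    ultimately have "?t = (\<Sum>k. ?b (k + N)) - (\<Sum>k. ?c (k + N)) + (\<Sum>n<N. ?b n - ?c n)"
      by (simp add: sum_subtractf)
    then show "\<bar>?t\<bar> \<le> 2 * C * W * lp_norm p (\<lambda>k. us (k + N)) + \<epsilon>"
      using head tail_le[of xs] tail_le[of "\<lambda>n. blinfun_apply R (xs n)"] xs Rxs R(2) W_def by simp
  qed
  have "(\<lambda>N. 2 * C * W * lp_norm p (\<lambda>k. us (k + N))) \<longlonglongrightarrow> 2 * C * W * 0"
    using lp_norm_tail[OF p us] by (intro tendsto_intros)
  then have "\<bar>?t\<bar> \<le> 2 * C * W * 0"
    using tail by (intro LIMSEQ_le_const) auto
  then show ?thesis by simp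
qed

section \<open>Trace duality\<close>

text \<open>The difference of two representations of \<open>T\<close> represents the zero operator.\<close>

lemma trace_rep_unique:
  fixes S :: "'e::banach \<Rightarrow>\<^sub>L ('x::banach_lattice \<Rightarrow>\<^sub>L real) \<Rightarrow>\<^sub>L real"
  assumes p: "1 \<le> p" and S: "pos_majorizing_bound (conj_exp p) bidual_pos S C" "0 \<le> C"
    and approx: "approximation_property TYPE('e) \<or>
      positive_metric_approximation_property (dual_pos :: ('x \<Rightarrow>\<^sub>L real) set)"
    and rep: "pos_nuclear_rep p T xs us" and rep': "pos_nuclear_rep p T xs' us'"
  shows "(\<Sum>n. blinfun_apply (blinfun_apply S (us n)) (xs n))
    = (\<Sum>n. blinfun_apply (blinfun_apply S (us' n)) (xs' n))" (is "?t = ?t'")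
proof -
  let ?ys = "\<lambda>n. if even n then xs (n div 2) else xs' (n div 2)"
  \<comment> \<open>The sign sits on the vectors, since the functionals have to stay
    positive.\<close>
  let ?ws = "\<lambda>n. if even n then us (n div 2) else (-1) *\<^sub>R us' (n div 2)"
  have "pos_nuclear_rep p (T + (-1) *\<^sub>R T) ?ys ?ws"
    using pos_nuclear_rep_add[OF rep pos_nuclear_rep_scaleR[OF p rep', of "-1"]] .
  then have "pos_nuclear_rep p 0 ?ys ?ws"
    by simp
  then have zero: "(\<Sum>n. blinfun_apply (blinfun_apply S (?ws n)) (?ys n)) = 0"
    using approx trace_zero_rep_ap[OF p S] trace_zero_rep_pmap[OF p S] by blast
  have "(\<lambda>n. blinfun_apply (blinfun_apply S (us n)) (xs n)) sums ?t"
    "(\<lambda>n. blinfun_apply (blinfun_apply S (us' n)) (xs' n)) sums ?t'"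
    using rep rep' by (auto intro!: summable_sums trace_summable(1)[OF p S] simp: pos_nuclear_rep_def)
  from sums_interleave[OF this(1) sums_minus[OF this(2)]]
  have "(\<lambda>n. blinfun_apply (blinfun_apply S (?ws n)) (?ys n)) sums (?t + - ?t')"
    by (rule sums_cong[THEN iffD1, rotated]) (simp add: blinfun.bilinear_simps)
  with zero show ?thesis
    by (simp add: sums_iff)
qed

text \<open>Resolves the definite description: every value of \<open>trace_duality\<close> on a
  nuclear operator is accessed through this convergence.\<close>

lemma trace_duality_sums:
  fixes S :: "'e::banach \<Rightarrow>\<^sub>L ('x::banach_lattice \<Rightarrow>\<^sub>L real) \<Rightarrow>\<^sub>L real"
  assumes p: "1 \<le> p" and S: "S \<in> pos_majorizing (conj_exp p) bidual_pos"
    and approx: "approximation_property TYPE('e) \<or>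
      positive_metric_approximation_property (dual_pos :: ('x \<Rightarrow>\<^sub>L real) set)"
    and rep: "pos_nuclear_rep p T xs us"
  shows "(\<lambda>n. blinfun_apply (blinfun_apply S (us n)) (xs n)) sums trace_duality p S T"
proof -
  obtain C where C: "pos_majorizing_bound (conj_exp p) bidual_pos S C" "0 \<le> C"
    using S by (auto simp: pos_majorizing_def intro: less_imp_le)
  define t where "t = (\<Sum>n. blinfun_apply (blinfun_apply S (us n)) (xs n))"
  have t: "(\<lambda>n. blinfun_apply (blinfun_apply S (us' n)) (xs' n)) sums t"
    if rep': "pos_nuclear_rep p T xs' us'" for xs' us'
  proof -
    have "(\<lambda>n. blinfun_apply (blinfun_apply S (us' n)) (xs' n)) sums
        (\<Sum>n. blinfun_apply (blinfun_apply S (us' n)) (xs' n))"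
      using rep' by (auto intro!: summable_sums trace_summable(1)[OF p C] simp: pos_nuclear_rep_def)
    then show ?thesis
      using trace_rep_unique[OF p C approx rep rep'] by (simp add: t_def)
  qed
  have "T \<in> pos_nuclear p"
    using rep by (auto simp: pos_nuclear_def)
  then have "trace_duality p S T = (THE t. \<forall>xs us. pos_nuclear_rep p T xs us \<longrightarrow>
      (\<lambda>n. blinfun_apply (blinfun_apply S (us n)) (xs n)) sums t)"
    by (simp add: trace_duality_def)
  also have "\<dots> = t"
  proof (rule the_equality)
    fix t' assume "\<forall>xs us. pos_nuclear_rep p T xs us \<longrightarrow>
      (\<lambda>n. blinfun_apply (blinfun_apply S (us n)) (xs n)) sums t'"
    then show "t' = t"
      using t[OF rep] rep sums_unique2 by blast
  qed (use t in blast)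
  finally show ?thesis
    using t[OF rep] by simp
qed

section \<open>Linear structure of the majorizing operators\<close>

text \<open>Serves to make a constant strictly positive, as \<open>pos_majorizing\<close> and the
  infimum in its norm require.\<close>

lemma pos_majorizing_bound_mono:
  fixes S :: "'e::banach \<Rightarrow>\<^sub>L 'y::banach"
  assumes "1 \<le> p" "pos_majorizing_bound p P S C" "C \<le> C'"
  shows "pos_majorizing_bound p P S C'"
  unfolding pos_majorizing_bound_def
proof (intro allI impI)
  fix n :: nat and u :: "nat \<Rightarrow> 'e" and f :: "nat \<Rightarrow> 'y \<Rightarrow>\<^sub>L real"
    assume "\<forall>j<n. norm (u j) \<le> 1" "\<forall>j<n. f j \<in> dual_cone P"
  then have "lp_norm p (fin_seq n (\<lambda>j. blinfun_apply (f j) (blinfun_apply S (u j)))) \<le> C * weak_lp_norm p (fin_seq n f)"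
    using assms(2) by (intro pos_majorizing_boundD) auto
  also have "\<dots> \<le> C' * weak_lp_norm p (fin_seq n f)"
    using assms by (intro mult_right_mono weak_lp_norm_nonneg fin_seq_in_weak_lp_seq)
  finally show "lp_norm p (fin_seq n (\<lambda>j. blinfun_apply (f j) (blinfun_apply S (u j))))
      \<le> C' * weak_lp_norm p (fin_seq n f)" .
qed

text \<open>The triangle inequality for the exponent \<open>p\<close> is obtained by pairing with
  the unit ball of the conjugate exponent, where the sum splits by linearity.\<close>

lemma pos_majorizing_add:
  fixes S S' :: "'e::banach \<Rightarrow>\<^sub>L 'y::banach"
  assumes p: "1 \<le> p" and "S \<in> pos_majorizing p P" "S' \<in> pos_majorizing p P"
  shows "S + S' \<in> pos_majorizing p P"
proof -
  obtain C C' where C: "0 < C" "pos_majorizing_bound p P S C" "0 < C'" "pos_majorizing_bound p P S' C'"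
    using assms by (auto simp: pos_majorizing_def)
  define q where "q = conj_exp p"
  have q: "1 \<le> q" "conj_exp q = p"
    using p by (simp_all add: q_def conj_exp_ge_1 conj_exp_conj_exp)
  have "pos_majorizing_bound p P (S + S') (C + C')"
    unfolding pos_majorizing_bound_def
  proof (intro allI impI)
    fix n :: nat and u :: "nat \<Rightarrow> 'e" and f :: "nat \<Rightarrow> 'y \<Rightarrow>\<^sub>L real"
    assume u: "\<forall>j<n. norm (u j) \<le> 1" and f: "\<forall>j<n. f j \<in> dual_cone P"
    show "lp_norm p (fin_seq n (\<lambda>j. blinfun_apply (f j) (blinfun_apply (S + S') (u j))))
        \<le> (C + C') * weak_lp_norm p (fin_seq n f)"
    proof (rule lp_norm_fin_seq_leI[OF q(1), unfolded q(2)])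
      fix a :: "nat \<Rightarrow> real" assume a: "lp_norm q (fin_seq n a) \<le> 1"
      have le: "(\<Sum>j<n. a j * blinfun_apply (f j) (blinfun_apply R (u j))) \<le> D * weak_lp_norm p (fin_seq n f)"
        if R: "pos_majorizing_bound p P R D" for R :: "'e \<Rightarrow>\<^sub>L 'y" and D
      proof -
        have "(\<Sum>j<n. a j * fin_seq n (\<lambda>j. blinfun_apply (f j) (blinfun_apply R (u j))) j)
            \<le> lp_norm p (fin_seq n (\<lambda>j. blinfun_apply (f j) (blinfun_apply R (u j))))"
          using abs_sum_mult_le_lp_norm[OF q(1) _ a, unfolded q(2), OF fin_seq_in_lp_seq] abs_le_D1 by blast
        also have "\<dots> \<le> D * weak_lp_norm p (fin_seq n f)"
          using u f by (intro pos_majorizing_boundD[OF R]) auto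
        finally show ?thesis by (simp add: fin_seq_def)
      qed
      show "(\<Sum>j<n. a j * blinfun_apply (f j) (blinfun_apply (S + S') (u j))) \<le> (C + C') * weak_lp_norm p (fin_seq n f)"
        using le[OF C(2)] le[OF C(4)]
        by (simp add: blinfun.bilinear_simps distrib_left distrib_right sum.distrib)
    qed
  qed
  with C show ?thesis
    by (auto simp: pos_majorizing_def intro!: exI[of _ "C + C'"])
qed

lemma pos_majorizing_scaleR:
  fixes S :: "'e::banach \<Rightarrow>\<^sub>L 'y::banach"
  assumes p: "1 \<le> p" and "S \<in> pos_majorizing p P"
  shows "c *\<^sub>R S \<in> pos_majorizing p P"
proof -
  obtain C where C: "0 < C" "pos_majorizing_bound p P S C"
    using assms by (auto simp: pos_majorizing_def)
  have "pos_majorizing_bound p P (c *\<^sub>R S) (\<bar>c\<bar> * C)"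
    unfolding pos_majorizing_bound_def
  proof (intro allI impI)
    fix n :: nat and u :: "nat \<Rightarrow> 'e" and f :: "nat \<Rightarrow> 'y \<Rightarrow>\<^sub>L real"
    assume uf: "\<forall>j<n. norm (u j) \<le> 1" "\<forall>j<n. f j \<in> dual_cone P"
    let ?b = "fin_seq n (\<lambda>j. blinfun_apply (f j) (blinfun_apply S (u j)))"
    have "fin_seq n (\<lambda>j. blinfun_apply (f j) (blinfun_apply (c *\<^sub>R S) (u j))) = (\<lambda>j. c *\<^sub>R ?b j)"
      by (auto simp: fin_seq_def blinfun.bilinear_simps)
    then have "lp_norm p (fin_seq n (\<lambda>j. blinfun_apply (f j) (blinfun_apply (c *\<^sub>R S) (u j)))) = \<bar>c\<bar> * lp_norm p ?b"
      by (simp only: lp_seq_scaleR(2)[OF fin_seq_in_lp_seq p])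
    also have "\<dots> \<le> \<bar>c\<bar> * (C * weak_lp_norm p (fin_seq n f))"
      using uf by (intro mult_left_mono pos_majorizing_boundD[OF C(2)]) auto
    finally show "lp_norm p (fin_seq n (\<lambda>j. blinfun_apply (f j) (blinfun_apply (c *\<^sub>R S) (u j))))
        \<le> \<bar>c\<bar> * C * weak_lp_norm p (fin_seq n f)"
      by (simp add: mult.assoc)
  qed
  \<comment> \<open>For \<open>c = 0\<close> the constant would be 0; the added 1 makes it
    admissible.\<close>
  then have "pos_majorizing_bound p P (c *\<^sub>R S) (\<bar>c\<bar> * C + 1)"
    by (rule pos_majorizing_bound_mono[OF p]) simp
  moreover have "0 < \<bar>c\<bar> * C + 1"
    using C(1) by (simp add: add_nonneg_pos)
  ultimately show ?thesis
    by (auto simp: pos_majorizing_def)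
qed

section \<open>Functionals on the nuclear operators\<close>

lemma normed_dual_zero:
  assumes "V \<in> normed_dual (pos_nuclear p) \<nu>"
  shows "V 0 = 0"
proof -
  have "V (0 *\<^sub>R 0) = 0 * V 0"
    using assms zero_in_pos_nuclear unfolding normed_dual_def by blast
  then show ?thesis by simp
qed

lemma normed_dual_norm_le:
  fixes V :: "('x::banach_lattice \<Rightarrow>\<^sub>L 'e::banach) \<Rightarrow> real"
  assumes p: "1 \<le> p" and "0 \<le> C" "\<And>T. T \<in> pos_nuclear p \<Longrightarrow> \<bar>V T\<bar> \<le> C * pos_nuclear_norm p T"
  shows "normed_dual_norm (pos_nuclear p) (pos_nuclear_norm p) V \<le> C"
  unfolding normed_dual_norm_def
proof (rule cSUP_least)
  show "{T \<in> pos_nuclear p. pos_nuclear_norm p T \<le> 1} \<noteq> {}"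
    by (auto intro!: exI[of _ 0] simp: zero_in_pos_nuclear pos_nuclear_norm_zero[OF p])
  fix T :: "'x \<Rightarrow>\<^sub>L 'e" assume "T \<in> {T \<in> pos_nuclear p. pos_nuclear_norm p T \<le> 1}"
  then show "\<bar>V T\<bar> \<le> C"
    using assms(2) assms(3)[of T] mult_left_mono[of "pos_nuclear_norm p T" 1 C] by simp
qed

lemma normed_dual_norm_bound:
  fixes V :: "('x::banach_lattice \<Rightarrow>\<^sub>L 'e::banach) \<Rightarrow> real"
  assumes p: "1 \<le> p" and V: "V \<in> normed_dual (pos_nuclear p) (pos_nuclear_norm p)"
  defines "M \<equiv> normed_dual_norm (pos_nuclear p) (pos_nuclear_norm p) V"
  shows "0 \<le> M" and "T \<in> pos_nuclear p \<Longrightarrow> \<bar>V T\<bar> \<le> M * pos_nuclear_norm p T"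
proof -
  obtain C where C: "\<And>T. T \<in> pos_nuclear p \<Longrightarrow> \<bar>V T\<bar> \<le> C * pos_nuclear_norm p T"
    using V unfolding normed_dual_def by blast
  have scale: "V (c *\<^sub>R T) = c * V T" if "T \<in> pos_nuclear p" for c and T :: "'x \<Rightarrow>\<^sub>L 'e"
    using V that by (auto simp: normed_dual_def)
  have "bdd_above ((\<lambda>T. \<bar>V T\<bar>) ` {T \<in> pos_nuclear p. pos_nuclear_norm p T \<le> 1})"
  proof (rule bdd_aboveI2)
    fix T :: "'x \<Rightarrow>\<^sub>L 'e" assume "T \<in> {T \<in> pos_nuclear p. pos_nuclear_norm p T \<le> 1}"
    then have T: "T \<in> pos_nuclear p" "0 \<le> pos_nuclear_norm p T" "pos_nuclear_norm p T \<le> 1"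
      using pos_nuclear_norm_nonneg[OF p] by auto
    have "\<bar>V T\<bar> \<le> C * pos_nuclear_norm p T"
      using C T(1) by blast
    also have "\<dots> \<le> \<bar>C\<bar> * 1"
      using T by (intro mult_mono) auto
    finally show "\<bar>V T\<bar> \<le> \<bar>C\<bar>" by simp
  qed
  then have unit: "\<bar>V T\<bar> \<le> M" if "T \<in> pos_nuclear p" "pos_nuclear_norm p T \<le> 1" for T :: "'x \<Rightarrow>\<^sub>L 'e"
    unfolding M_def normed_dual_norm_def using that by (intro cSUP_upper) auto
  show "0 \<le> M"
    using unit[OF zero_in_pos_nuclear] by (simp add: pos_nuclear_norm_zero[OF p] normed_dual_zero[OF V])
  show "\<bar>V T\<bar> \<le> M * pos_nuclear_norm p T" if T: "T \<in> pos_nuclear p" for T :: "'x \<Rightarrow>\<^sub>L 'e"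
  proof (cases "pos_nuclear_norm p T = 0")
    \<comment> \<open>No rescaling is possible here, but the bound with \<open>C\<close> already
      forces \<open>V T = 0\<close>.\<close>
    case True
    with C[OF T] show ?thesis by simp
  next
    case False
    with pos_nuclear_norm_nonneg[OF p T] have pos: "0 < pos_nuclear_norm p T" by simp
    define c where "c = 1 / pos_nuclear_norm p T"
    have c: "0 < c"
      using pos by (simp add: c_def)
    have "pos_nuclear_norm p (c *\<^sub>R T) \<le> c * pos_nuclear_norm p T"
      using p T c by (rule pos_nuclear_norm_scaleR_le)
    then have "\<bar>V (c *\<^sub>R T)\<bar> \<le> M"
      using pos by (intro unit pos_nuclear_scaleR p T) (simp add: c_def)
    then show ?thesis
      using pos by (simp add: scale[OF T] c_def abs_mult divide_le_eq)
  qed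
qed

lemma normed_dual_sum_tensor:
  fixes n :: nat
  assumes V: "V \<in> normed_dual (pos_nuclear p) \<nu>" and x: "\<And>j. j < n \<Longrightarrow> x j \<in> dual_pos"
  shows "V (\<Sum>j<n. tensor (x j) (u j)) = (\<Sum>j<n. V (tensor (x j) (u j)))"
  using x
proof (induction n)
  case 0
  then show ?case using normed_dual_zero[OF V] by simp
next
  case (Suc n)
  have "(\<Sum>j<n. tensor (x j) (u j)) \<in> pos_nuclear p" "tensor (x n) (u n) \<in> pos_nuclear p"
    using Suc.prems by (auto intro!: sum_tensor_in_pos_nuclear tensor_in_pos_nuclear)
  then have "V ((\<Sum>j<n. tensor (x j) (u j)) + tensor (x n) (u n))
      = V (\<Sum>j<n. tensor (x j) (u j)) + V (tensor (x n) (u n))"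
    using V unfolding normed_dual_def by blast
  with Suc show ?case by simp
qed

text \<open>Coefficients \<open>a\<close> in the unit ball linearize the norm to be estimated and
  are absorbed into the vectors: the operator
  \<open>\<Sum>j<n. tensor (x j) (a j *\<^sub>R u j)\<close> has nuclear norm at most the weak norm
  of \<open>x\<close>. This is the hypothesis of \<open>weak_lp_dominated_on_bidual_cone\<close> for
  the elements \<open>a j *\<^sub>R S (u j)\<close>. The constant is exactly the norm of
  \<open>V\<close>, as the isometry demands.\<close>

lemma pos_majorizing_bound_of_normed_dual:
  fixes S :: "'e::banach \<Rightarrow>\<^sub>L ('x::banach_lattice \<Rightarrow>\<^sub>L real) \<Rightarrow>\<^sub>L real"
  assumes p: "1 \<le> p" and V: "V \<in> normed_dual (pos_nuclear p) (pos_nuclear_norm p)"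
    and VS: "\<And>x u. x \<in> dual_pos \<Longrightarrow> V (tensor x u) = blinfun_apply (blinfun_apply S u) x"
  shows "pos_majorizing_bound (conj_exp p) bidual_pos S (normed_dual_norm (pos_nuclear p) (pos_nuclear_norm p) V)"
proof -
  define M where "M = normed_dual_norm (pos_nuclear p) (pos_nuclear_norm p) V"
  note M = normed_dual_norm_bound[OF p V, folded M_def]
  define q where "q = conj_exp p"
  have q: "1 \<le> q"
    using p by (simp add: q_def conj_exp_ge_1)
  have "pos_majorizing_bound q bidual_pos S M"
    unfolding pos_majorizing_bound_def
  proof (intro allI impI)
    fix n :: nat and u :: "nat \<Rightarrow> 'e" and f :: "nat \<Rightarrow> (('x \<Rightarrow>\<^sub>L real) \<Rightarrow>\<^sub>L real) \<Rightarrow>\<^sub>L real"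
    assume u: "\<forall>j<n. norm (u j) \<le> 1"
      and f: "\<forall>j<n. f j \<in> dual_cone (bidual_pos :: (('x \<Rightarrow>\<^sub>L real) \<Rightarrow>\<^sub>L real) set)"
    show "lp_norm q (fin_seq n (\<lambda>j. blinfun_apply (f j) (blinfun_apply S (u j)))) \<le> M * weak_lp_norm q (fin_seq n f)"
      unfolding q_def
    proof (rule lp_norm_fin_seq_leI[OF p], fold q_def)
      fix a :: "nat \<Rightarrow> real" assume a: "lp_norm p (fin_seq n a) \<le> 1"
      have "(\<Sum>j<n. blinfun_apply (f j) (a j *\<^sub>R blinfun_apply S (u j))) \<le> M * weak_lp_norm q (fin_seq n f)"
      proof (rule weak_lp_dominated_on_bidual_cone[OF q convex_cone_dual_pos M(1)])
        show "f j \<in> dual_cone (dual_cone dual_pos)" if "j < n" for j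
          using f that by (simp add: bidual_pos_def)
        fix x :: "nat \<Rightarrow> 'x \<Rightarrow>\<^sub>L real" assume x: "\<And>j. x j \<in> dual_pos"
        let ?T = "\<Sum>j<n. tensor (x j) (a j *\<^sub>R u j)"
        have rep: "pos_nuclear_rep p ?T (fin_seq n x) (fin_seq n (\<lambda>j. a j *\<^sub>R u j))"
          using x by (rule pos_nuclear_rep_fin_seq)
        have "(\<Sum>j<n. blinfun_apply (a j *\<^sub>R blinfun_apply S (u j)) (x j)) = V ?T"
          using x by (simp add: normed_dual_sum_tensor[OF V] VS blinfun.bilinear_simps)
        also have "\<dots> \<le> M * pos_nuclear_norm p ?T"
          using M(2)[OF sum_tensor_in_pos_nuclear[OF x]] by (rule abs_le_D1)
        also have "\<dots> \<le> M * (weak_lp_norm q (fin_seq n x) * lp_norm p (fin_seq n (\<lambda>j. a j *\<^sub>R u j)))"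
          using pos_nuclear_norm_le[OF p rep] M(1) unfolding q_def by (rule mult_left_mono)
        also have "\<dots> \<le> M * (weak_lp_norm q (fin_seq n x) * 1)"
        proof (intro mult_left_mono M(1) weak_lp_norm_nonneg[OF q fin_seq_in_weak_lp_seq])
          have "lp_norm p (fin_seq n (\<lambda>j. a j *\<^sub>R u j)) \<le> lp_norm p (fin_seq n a)"
            using u by (intro lp_norm_fin_seq_mono) (simp add: mult_left_le)
          with a show "lp_norm p (fin_seq n (\<lambda>j. a j *\<^sub>R u j)) \<le> 1" by simp
        qed
        finally show "(\<Sum>j<n. blinfun_apply (a j *\<^sub>R blinfun_apply S (u j)) (x j)) \<le> M * weak_lp_norm q (fin_seq n x)"
          by simp
      qed
      then show "(\<Sum>j<n. a j * blinfun_apply (f j) (blinfun_apply S (u j))) \<le> M * weak_lp_norm q (fin_seq n f)"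
        by (simp add: blinfun.bilinear_simps)
    qed
  qed
  then show ?thesis
    by (simp add: M_def q_def)
qed

text \<open>Every functional is the difference of the positive ones \<open>g\<close> and
  \<open>g - x\<close>.\<close>

lemma blinfun_eq_on_dual_pos:
  fixes \<phi> \<psi> :: "('x::banach_lattice \<Rightarrow>\<^sub>L real) \<Rightarrow>\<^sub>L real"
  assumes "\<And>x. x \<in> dual_pos \<Longrightarrow> blinfun_apply \<phi> x = blinfun_apply \<psi> x"
  shows "\<phi> = \<psi>"
proof (rule blinfun_eqI)
  fix x :: "'x \<Rightarrow>\<^sub>L real"
  obtain g where "g \<in> dual_pos" "g - x \<in> dual_pos"
    using exists_dual_pos_dominating[of x] by blast
  then have "blinfun_apply \<phi> g - blinfun_apply \<phi> (g - x) = blinfun_apply \<psi> g - blinfun_apply \<psi> (g - x)"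
    using assms by simp
  then show "blinfun_apply \<phi> x = blinfun_apply \<psi> x"
    by (simp add: blinfun.bilinear_simps)
qed

text \<open>The norm estimate for rank one operators concerns positive functionals, so a general
  \<open>x\<close> is written as \<open>g - (g - x)\<close>. Only boundedness of the bilinear form
  is at stake; the sharp constant comes from
  \<open>pos_majorizing_bound_of_normed_dual\<close>.\<close>

lemma normed_dual_tensor_blinfun:
  fixes V :: "('x::banach_lattice \<Rightarrow>\<^sub>L 'e::banach) \<Rightarrow> real"
  assumes p: "1 \<le> p" and V: "V \<in> normed_dual (pos_nuclear p) (pos_nuclear_norm p)"
  obtains S :: "'e \<Rightarrow>\<^sub>L ('x \<Rightarrow>\<^sub>L real) \<Rightarrow>\<^sub>L real"
    where "\<And>x u. V (tensor x u) = blinfun_apply (blinfun_apply S u) x"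
proof -
  define M where "M = normed_dual_norm (pos_nuclear p) (pos_nuclear_norm p) V"
  note M = normed_dual_norm_bound[OF p V, folded M_def]
  have V_add: "V (T + T') = V T + V T'" if "T \<in> pos_nuclear p" "T' \<in> pos_nuclear p" for T T' :: "'x \<Rightarrow>\<^sub>L 'e"
    using V that by (auto simp: normed_dual_def)
  have V_scale: "V (c *\<^sub>R T) = c * V T" if "T \<in> pos_nuclear p" for c and T :: "'x \<Rightarrow>\<^sub>L 'e"
    using V that by (auto simp: normed_dual_def)
  have tensor_minus: "tensor x u = tensor y u + (-1) *\<^sub>R tensor (y - x) u" for x y :: "'x \<Rightarrow>\<^sub>L real" and u :: 'e
    by (rule blinfun_eqI) (simp add: blinfun.bilinear_simps scaleR_diff_left)
  have mem: "tensor x u \<in> pos_nuclear p" for x :: "'x \<Rightarrow>\<^sub>L real" and u :: 'e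
  proof -
    obtain g where g: "g \<in> dual_pos" "g - x \<in> dual_pos"
      using exists_dual_pos_dominating[of x] by blast
    then have "tensor g u + (-1) *\<^sub>R tensor (g - x) u \<in> pos_nuclear p"
      by (intro pos_nuclear_add pos_nuclear_scaleR p tensor_in_pos_nuclear)
    then show ?thesis
      by (simp only: tensor_minus[symmetric])
  qed
  have pos: "\<bar>V (tensor x u)\<bar> \<le> M * (norm x * norm u)" if "x \<in> dual_pos" for x u
  proof -
    have "\<bar>V (tensor x u)\<bar> \<le> M * pos_nuclear_norm p (tensor x u)"
      using mem by (rule M(2))
    also have "\<dots> \<le> M * (norm x * norm u)"
      using pos_nuclear_norm_tensor_le[OF p that] M(1) by (rule mult_left_mono)
    finally show ?thesis .
  qed
  \<comment> \<open>\<open>norm g \<le> norm x\<close> and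
    \<open>norm (g - x) \<le> 2 * norm x\<close> add up to the factor 3.\<close>
  have bound: "\<bar>V (tensor x u)\<bar> \<le> norm u * norm x * (3 * M)" for x u
  proof -
    obtain g where g: "g \<in> dual_pos" "g - x \<in> dual_pos" "norm g \<le> norm x"
      using exists_dual_pos_dominating[of x] by blast
    have "norm (g - x) \<le> 2 * norm x"
      using norm_triangle_ineq4[of g x] g(3) by simp
    have "V (tensor x u) = V (tensor g u + (-1) *\<^sub>R tensor (g - x) u)"
      by (rule arg_cong[OF tensor_minus])
    also have "\<dots> = V (tensor g u) - V (tensor (g - x) u)"
      by (simp only: V_add[OF mem pos_nuclear_scaleR[OF p mem]] V_scale[OF mem])
    finally have "\<bar>V (tensor x u)\<bar> \<le> \<bar>V (tensor g u)\<bar> + \<bar>V (tensor (g - x) u)\<bar>"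
      by simp
    also have "\<dots> \<le> M * (norm g * norm u) + M * (norm (g - x) * norm u)"
      using g by (intro add_mono pos)
    also have "\<dots> \<le> M * (norm x * norm u) + M * ((2 * norm x) * norm u)"
      using g(3) \<open>norm (g - x) \<le> 2 * norm x\<close>
      by (intro add_mono mult_left_mono mult_right_mono M(1)) auto
    finally show ?thesis by (simp add: algebra_simps)
  qed
  have bilinear: "bounded_bilinear (\<lambda>u x. V (tensor x u))"
  proof
    fix u u' :: 'e and x x' :: "'x \<Rightarrow>\<^sub>L real" and r :: real
    have "tensor x (u + u') = tensor x u + tensor x u'" "tensor (x + x') u = tensor x u + tensor x' u"
      "tensor x (r *\<^sub>R u) = r *\<^sub>R tensor x u" "tensor (r *\<^sub>R x) u = r *\<^sub>R tensor x u"
      by (auto intro!: blinfun_eqI simp: blinfun.bilinear_simps scaleR_add_left scaleR_add_right mult.commute)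
    then show "V (tensor x (u + u')) = V (tensor x u) + V (tensor x u')"
      "V (tensor (x + x') u) = V (tensor x u) + V (tensor x' u)"
      "V (tensor x (r *\<^sub>R u)) = r *\<^sub>R V (tensor x u)" "V (tensor (r *\<^sub>R x) u) = r *\<^sub>R V (tensor x u)"
      by (simp_all add: V_add V_scale mem)
  next
    show "\<exists>K. \<forall>u x. norm (V (tensor x u)) \<le> norm u * norm x * K"
      using bound by auto
  qed
  define S where "S = Blinfun (bounded_bilinear.prod_right (\<lambda>u x. V (tensor x u)))"
  have "blinfun_apply (blinfun_apply S u) x = V (tensor x u)" for u x
    unfolding S_def
    by (simp add: bounded_linear_Blinfun_apply[OF bounded_bilinear.bounded_linear_prod_right[OF bilinear]]
        bounded_bilinear.prod_right.rep_eq[OF bilinear])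
  then show thesis
    by (intro that[of S]) simp
qed

text \<open>Remainders of a representation are small in the nuclear norm, for which \<open>V\<close>
  is bounded, so \<open>V\<close> may be applied term by term. This is what identifies
  \<open>V\<close> with a trace.\<close>

lemma normed_dual_sums:
  fixes V :: "('x::banach_lattice \<Rightarrow>\<^sub>L 'e::banach) \<Rightarrow> real"
  assumes p: "1 \<le> p" and V: "V \<in> normed_dual (pos_nuclear p) (pos_nuclear_norm p)"
    and rep: "pos_nuclear_rep p T xs us"
  shows "(\<lambda>n. V (tensor (xs n) (us n))) sums V T"
proof -
  define M where "M = normed_dual_norm (pos_nuclear p) (pos_nuclear_norm p) V"
  note M = normed_dual_norm_bound[OF p V, folded M_def]
  define q where "q = conj_exp p"
  have q: "1 \<le> q"
    using p by (simp add: q_def conj_exp_ge_1)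
  have xs: "xs \<in> weak_lp_seq q" "\<And>n. xs n \<in> dual_pos"
    and us: "us \<in> lp_seq p" "p = \<infinity> \<Longrightarrow> us \<longlonglongrightarrow> 0"
    using rep by (auto simp: pos_nuclear_rep_def q_def)
  define W where "W = weak_lp_norm q xs"
  let ?G = "\<lambda>N. \<Sum>j<N. tensor (xs j) (us j)"
  have bound: "norm (V T - V (?G N)) \<le> M * (W * lp_norm p (\<lambda>k. us (k + N)))" for N
  proof -
    note tail = pos_nuclear_rep_tail[OF p rep, of N]
    have mem: "T - ?G N \<in> pos_nuclear p" "?G N \<in> pos_nuclear p"
      using tail xs(2) by (auto simp: pos_nuclear_def intro!: sum_tensor_in_pos_nuclear[unfolded pos_nuclear_def, simplified])
    then have "V ((T - ?G N) + ?G N) = V (T - ?G N) + V (?G N)"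
      using V unfolding normed_dual_def by blast
    then have "norm (V T - V (?G N)) = \<bar>V (T - ?G N)\<bar>"
      by simp
    also have "\<dots> \<le> M * pos_nuclear_norm p (T - ?G N)"
      using M(2)[OF mem(1)] .
    also have "\<dots> \<le> M * (weak_lp_norm q (\<lambda>k. xs (k + N)) * lp_norm p (\<lambda>k. us (k + N)))"
      unfolding q_def using pos_nuclear_norm_le[OF p tail] M(1) by (rule mult_left_mono)
    also have "\<dots> \<le> M * (W * lp_norm p (\<lambda>k. us (k + N)))"
      unfolding W_def using weak_lp_seq_shift(2)[OF q xs(1)] lp_norm_nonneg[OF p lp_seq_shift(1)[OF p us(1)]]
      by (intro mult_left_mono mult_right_mono M(1))
    finally show ?thesis .
  qed
  have "(\<lambda>N. M * (W * lp_norm p (\<lambda>k. us (k + N)))) \<longlonglongrightarrow> M * (W * 0)"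
    using lp_norm_tail[OF p us] by (intro tendsto_intros)
  then have "(\<lambda>N. V T - V (?G N)) \<longlonglongrightarrow> 0"
    using bound by (intro Lim_null_comparison[of "\<lambda>N. V T - V (?G N)"]) auto
  then have "(\<lambda>N. V T - (V T - V (?G N))) \<longlonglongrightarrow> V T - 0"
    by (intro tendsto_intros)
  then have "(\<lambda>N. V (?G N)) \<longlonglongrightarrow> V T"
    by simp
  moreover have "V (?G N) = (\<Sum>j<N. V (tensor (xs j) (us j)))" for N
    using xs(2) by (rule normed_dual_sum_tensor[OF V])
  ultimately show ?thesis
    by (simp add: sums_def)
qed

theorem theorem2p12:
  fixes p :: ennreal
  defines "N \<equiv> (pos_nuclear p :: ('x::banach_lattice \<Rightarrow>\<^sub>L 'e::banach) set)"
    and "\<Upsilon> \<equiv> (pos_majorizing (conj_exp p) bidual_pos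
              :: ('e \<Rightarrow>\<^sub>L (('x \<Rightarrow>\<^sub>L real) \<Rightarrow>\<^sub>L real)) set)"
  assumes "1 \<le> p"
    and "approximation_property TYPE('e) \<or>
         positive_metric_approximation_property (dual_pos :: ('x \<Rightarrow>\<^sub>L real) set)"
  shows
    \<comment> \<open>the trace is well defined, independently of the representation\<close>
    "(\<forall>S\<in>\<Upsilon>. \<forall>T\<in>N. \<forall>xs us. pos_nuclear_rep p T xs us \<longrightarrow>
        (\<lambda>n. blinfun_apply (blinfun_apply S (us n)) (xs n)) sums trace_duality p S T) \<and>
     \<comment> \<open>linearity\<close>
     (\<forall>S\<in>\<Upsilon>. \<forall>S'\<in>\<Upsilon>. S + S' \<in> \<Upsilon> \<and>
        (\<forall>T\<in>N. trace_duality p (S + S') T = trace_duality p S T + trace_duality p S' T)) \<and>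
     (\<forall>c. \<forall>S\<in>\<Upsilon>. c *\<^sub>R S \<in> \<Upsilon> \<and>
        (\<forall>T\<in>N. trace_duality p (c *\<^sub>R S) T = c * trace_duality p S T)) \<and>
     \<comment> \<open>bijectivity onto the dual\<close>
     bij_betw (trace_duality p) \<Upsilon> (normed_dual N (pos_nuclear_norm p)) \<and>
     \<comment> \<open>isometry\<close>
     (\<forall>S\<in>\<Upsilon>. normed_dual_norm N (pos_nuclear_norm p) (trace_duality p S)
            = pos_majorizing_norm (conj_exp p) bidual_pos S)"
proof -
  note p = \<open>1 \<le> p\<close>
  have q: "1 \<le> conj_exp p"
    using p by (rule conj_exp_ge_1)
  have sums: "(\<lambda>n. blinfun_apply (blinfun_apply S (us n)) (xs n)) sums trace_duality p S T"
    if "S \<in> \<Upsilon>" "pos_nuclear_rep p T xs us" for S T xs us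
    using trace_duality_sums[OF p _ assms(4) that(2)] that(1) by (simp add: \<Upsilon>_def)
  have rep: "\<exists>xs us. pos_nuclear_rep p T xs us" if "T \<in> N" for T
    using that by (simp add: N_def pos_nuclear_def)
  have add: "S + S' \<in> \<Upsilon>" if "S \<in> \<Upsilon>" "S' \<in> \<Upsilon>" for S S'
    using that q by (simp add: \<Upsilon>_def pos_majorizing_add)
  have scale: "c *\<^sub>R S \<in> \<Upsilon>" if "S \<in> \<Upsilon>" for S c
    using that q by (simp add: \<Upsilon>_def pos_majorizing_scaleR)
  have trace_add: "trace_duality p (S + S') T = trace_duality p S T + trace_duality p S' T"
    if S: "S \<in> \<Upsilon>" "S' \<in> \<Upsilon>" and T: "T \<in> N" for S S' T
  proof -
    obtain xs us where r: "pos_nuclear_rep p T xs us"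
      using rep[OF T] by blast
    have "(\<lambda>n. blinfun_apply (blinfun_apply (S + S') (us n)) (xs n)) sums (trace_duality p S T + trace_duality p S' T)"
      using sums_add[OF sums[OF S(1) r] sums[OF S(2) r]] by (simp add: blinfun.bilinear_simps)
    then show ?thesis
      using sums[OF add[OF S] r] sums_unique2 by blast
  qed
  have trace_scale: "trace_duality p (c *\<^sub>R S) T = c * trace_duality p S T"
    if S: "S \<in> \<Upsilon>" and T: "T \<in> N" for c S T
  proof -
    obtain xs us where r: "pos_nuclear_rep p T xs us"
      using rep[OF T] by blast
    have "(\<lambda>n. blinfun_apply (blinfun_apply (c *\<^sub>R S) (us n)) (xs n)) sums (c * trace_duality p S T)"
      using sums_mult[OF sums[OF S r], of c] by (simp add: blinfun.bilinear_simps)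
    then show ?thesis
      using sums[OF scale[OF S] r] sums_unique2 by blast
  qed
  \<comment> \<open>The values on rank one operators recover \<open>S\<close> from its trace
    functional; both injectivity and the bound on the majorizing norm rest on them.\<close>
  have trace_tensor: "trace_duality p S (tensor x u) = blinfun_apply (blinfun_apply S u) x"
    if "S \<in> \<Upsilon>" "x \<in> dual_pos" for S x u
  proof -
    have "pos_nuclear_rep p (\<Sum>j<Suc 0. tensor x u) (fin_seq (Suc 0) (\<lambda>_. x)) (fin_seq (Suc 0) (\<lambda>_. u))"
      using that(2) by (rule pos_nuclear_rep_fin_seq)
    then have r: "pos_nuclear_rep p (tensor x u) (fin_seq (Suc 0) (\<lambda>_. x)) (fin_seq (Suc 0) (\<lambda>_. u))"
      by simp
    have "(\<lambda>n. blinfun_apply (blinfun_apply S (fin_seq (Suc 0) (\<lambda>_. u) n)) (fin_seq (Suc 0) (\<lambda>_. x) n)) sums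
        (\<Sum>n<Suc 0. blinfun_apply (blinfun_apply S (fin_seq (Suc 0) (\<lambda>_. u) n)) (fin_seq (Suc 0) (\<lambda>_. x) n))"
      by (rule sums_finite) (auto simp: fin_seq_def)
    from sums_unique2[OF sums[OF that(1) r] this] show ?thesis
      by (simp add: fin_seq_def)
  qed
  have trace_bound: "\<bar>trace_duality p S T\<bar> \<le> C * pos_nuclear_norm p T"
    if "S \<in> \<Upsilon>" "T \<in> N" "0 < C" "pos_majorizing_bound (conj_exp p) bidual_pos S C" for S T C
  proof (rule pos_nuclear_norm_greatest)
    show "T \<in> pos_nuclear p" "0 < C"
      using that by (simp_all add: N_def)
    fix xs us assume r: "pos_nuclear_rep p T xs us"
    then have "\<bar>\<Sum>n. blinfun_apply (blinfun_apply S (us n)) (xs n)\<bar> \<le> C * (weak_lp_norm (conj_exp p) xs * lp_norm p us)"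
      using that by (intro trace_summable(2) p) (auto simp: pos_nuclear_rep_def)
    then show "\<bar>trace_duality p S T\<bar> \<le> C * (weak_lp_norm (conj_exp p) xs * lp_norm p us)"
      using sums[OF that(1) r] by (simp add: sums_iff)
  qed
  have dual: "trace_duality p S \<in> normed_dual N (pos_nuclear_norm p)" if S: "S \<in> \<Upsilon>" for S
  proof -
    obtain C where C: "0 < C" "pos_majorizing_bound (conj_exp p) bidual_pos S C"
      using S by (auto simp: \<Upsilon>_def pos_majorizing_def)
    have "trace_duality p S (T + T') = trace_duality p S T + trace_duality p S T'" if T: "T \<in> N" "T' \<in> N" for T T'
    proof -
      obtain xs us xs' us' where r: "pos_nuclear_rep p T xs us" "pos_nuclear_rep p T' xs' us'"
        using rep[OF T(1)] rep[OF T(2)] by blast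
      have "(\<lambda>n. blinfun_apply (blinfun_apply S (if even n then us (n div 2) else us' (n div 2)))
          (if even n then xs (n div 2) else xs' (n div 2))) sums (trace_duality p S T + trace_duality p S T')"
        using sums_interleave[OF sums[OF S r(1)] sums[OF S r(2)]]
        by (rule sums_cong[THEN iffD1, rotated]) simp
      then show ?thesis
        using sums[OF S pos_nuclear_rep_add[OF r]] sums_unique2 by blast
    qed
    moreover have "trace_duality p S (c *\<^sub>R T) = c * trace_duality p S T" if T: "T \<in> N" for c T
    proof -
      obtain xs us where r: "pos_nuclear_rep p T xs us"
        using rep[OF T] by blast
      have "(\<lambda>n. blinfun_apply (blinfun_apply S (c *\<^sub>R us n)) (xs n)) sums (c * trace_duality p S T)"
        using sums_mult[OF sums[OF S r], of c] by (simp add: blinfun.bilinear_simps)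
      then show ?thesis
        using sums[OF S pos_nuclear_rep_scaleR[OF p r]] sums_unique2 by blast
    qed
    moreover have "trace_duality p S \<in> extensional N"
      by (simp add: trace_duality_def N_def)
    moreover have "\<exists>C. \<forall>T\<in>N. \<bar>trace_duality p S T\<bar> \<le> C * pos_nuclear_norm p T"
      using trace_bound[OF S _ C] by blast
    ultimately show ?thesis
      by (simp add: normed_dual_def)
  qed
  have isometry: "normed_dual_norm N (pos_nuclear_norm p) (trace_duality p S) = pos_majorizing_norm (conj_exp p) bidual_pos S"
    if S: "S \<in> \<Upsilon>" for S
  proof (rule antisym)
    let ?M = "normed_dual_norm N (pos_nuclear_norm p) (trace_duality p S)"
    let ?B = "{C. 0 < C \<and> pos_majorizing_bound (conj_exp p) bidual_pos S C}"
    show "?M \<le> pos_majorizing_norm (conj_exp p) bidual_pos S"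
      unfolding pos_majorizing_norm_def
    proof (rule cInf_greatest)
      show "?B \<noteq> {}"
        using S by (auto simp: \<Upsilon>_def pos_majorizing_def)
      fix C assume "C \<in> ?B"
      then show "?M \<le> C"
        unfolding N_def using trace_bound[OF S] by (intro normed_dual_norm_le[OF p]) (auto simp: N_def)
    qed
    show "pos_majorizing_norm (conj_exp p) bidual_pos S \<le> ?M"
    \<comment> \<open>\<open>?M\<close> is an admissible bound but may be 0, a value that the
      infimum excludes; hence the detour through \<open>?M + \<epsilon>\<close>.\<close>
    proof (rule field_le_epsilon)
      fix \<epsilon> :: real assume "0 < \<epsilon>"
      have "pos_majorizing_bound (conj_exp p) bidual_pos S ?M"
        unfolding N_def using dual[OF S] trace_tensor[OF S]
        by (intro pos_majorizing_bound_of_normed_dual[OF p]) (auto simp: N_def)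
      then have "pos_majorizing_bound (conj_exp p) bidual_pos S (?M + \<epsilon>)"
        by (rule pos_majorizing_bound_mono[OF q]) (use \<open>0 < \<epsilon>\<close> in simp)
      moreover have "0 \<le> ?M"
        using normed_dual_norm_bound(1)[OF p dual[OF S, unfolded N_def]] by (simp add: N_def)
      ultimately have "?M + \<epsilon> \<in> ?B"
        using \<open>0 < \<epsilon>\<close> by simp
      then show "pos_majorizing_norm (conj_exp p) bidual_pos S \<le> ?M + \<epsilon>"
        unfolding pos_majorizing_norm_def by (intro cInf_lower bdd_belowI[of _ 0]) auto
    qed
  qed
  have inj: "inj_on (trace_duality p) \<Upsilon>"
  proof (rule inj_onI)
    fix S S' assume S: "S \<in> \<Upsilon>" "S' \<in> \<Upsilon>" "trace_duality p S = trace_duality p S'"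
    show "S = S'"
    proof (rule blinfun_eqI, rule blinfun_eq_on_dual_pos)
      fix u :: 'e and x :: "'x \<Rightarrow>\<^sub>L real" assume x: "x \<in> dual_pos"
      show "blinfun_apply (blinfun_apply S u) x = blinfun_apply (blinfun_apply S' u) x"
        using trace_tensor[OF S(1) x, of u] trace_tensor[OF S(2) x, of u] S(3) by simp
    qed
  qed
  have surj: "V \<in> trace_duality p ` \<Upsilon>" if V: "V \<in> normed_dual N (pos_nuclear_norm p)" for V
  proof -
    note V' = V[unfolded N_def]
    obtain S :: "'e \<Rightarrow>\<^sub>L ('x \<Rightarrow>\<^sub>L real) \<Rightarrow>\<^sub>L real"
      where S: "\<And>x u. V (tensor x u) = blinfun_apply (blinfun_apply S u) x"
      using normed_dual_tensor_blinfun[OF p V'] by blast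
    have "pos_majorizing_bound (conj_exp p) bidual_pos S (normed_dual_norm N (pos_nuclear_norm p) V)"
      unfolding N_def using S by (rule pos_majorizing_bound_of_normed_dual[OF p V'])
    then have "pos_majorizing_bound (conj_exp p) bidual_pos S (normed_dual_norm N (pos_nuclear_norm p) V + 1)"
      by (rule pos_majorizing_bound_mono[OF q]) simp
    moreover have "0 < normed_dual_norm N (pos_nuclear_norm p) V + 1"
      using normed_dual_norm_bound(1)[OF p V'] by (simp add: N_def)
    ultimately have S_mem: "S \<in> \<Upsilon>"
      by (auto simp: \<Upsilon>_def pos_majorizing_def)
    have "V T = trace_duality p S T" for T
    proof (cases "T \<in> N")
      case True
      then obtain xs us where r: "pos_nuclear_rep p T xs us"
        using rep by blast
      have "(\<lambda>n. blinfun_apply (blinfun_apply S (us n)) (xs n)) sums V T"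
        using normed_dual_sums[OF p V' r] by (simp add: S)
      then show ?thesis
        using sums[OF S_mem r] sums_unique2 by blast
    next
      \<comment> \<open>Outside \<open>N\<close> both functions are \<open>undefined\<close> by
        extensionality.\<close>
      case False
      then show ?thesis
        using V by (simp add: trace_duality_def normed_dual_def N_def extensional_def)
    qed
    then have "V = trace_duality p S" by blast
    with S_mem show ?thesis by blast
  qed
  have bij: "bij_betw (trace_duality p) \<Upsilon> (normed_dual N (pos_nuclear_norm p))"
    using inj dual surj by (auto simp: bij_betw_def)
  show ?thesis
    by (intro conjI ballI allI impI sums add trace_add scale trace_scale bij isometry)
qed

end
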